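(* Let $\beta\in\,]0,2[$ and let $u$ be the solution of the stochastic wave equation in $\mathbb{R}^3$ with vanishing initial conditions $v_0=\tilde v_0=0$, coefficients $\sigma\equiv1$, $b\equiv0$, and noise covariance density $f(x)=|x|^{-\beta}$ (see context). Then: (a) Fix $t\in\,]0,T]$ and a compact set $K\subset\mathbb{R}^3$. There is a constant $c_1>0$ such that for all $x,y\in K$, $$E\left(|u(t,x)-u(t,y)|^2\right)\ge c_1|x-y|^{2-\beta}.$$ Consequently, a.s. the mapping $x\mapsto u(t,x)$ is not $\gamma$-Hölder continuous for $\gamma>\frac{2-\beta}{2}$, though it is for $\gamma<\frac{2-\beta}{2}$. (b) Fix $x\in\mathbb{R}^3$ and $t_0>0$. There is a constant $c_2>0$ such that for all $t,\bar t\in[t_0,T]$ with $|\bar t-t|$ sufficiently small, $$E\left(|u(t,x)-u(\bar t,x)|^2\right)\ge c_2|t-\bar t|^{2-\beta}.$$ Hence, a.s., the mapping $t\mapsto u(t,x)$ is not $\gamma$-Hölder continuous for $\gamma>\frac{2-\beta}{2}$, while it is for $\gamma<\frac{2-\beta}{2}$.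
   Context: Fix $T>0$. $G(t)=\frac{1}{4\pi t}\sigma_t$, $t>0$, where $\sigma_t$ is the uniform surface measure (total mass $4\pi t^2$) on the sphere of radius $t$ centred at $0$ in $\mathbb{R}^3$; $\mathcal{F}G(t)(\xi)=\sin(t|\xi|)/|\xi|$. The noise $F$ is a centred Gaussian process indexed by $\mathcal{D}(\mathbb{R}^4)$ with covariance $E(F(\phi)F(\psi))=\int_{\mathbb{R}_+}ds\int_{\mathbb{R}^3}dx\,|x|^{-\beta}(\phi(s)*\tilde\psi(s))(x)$, $\tilde\psi(s)(x)=\psi(s)(-x)$; $M$ is the martingale measure extending $F$. The spectral measure of the noise is $\mu(d\xi)=c_\beta|\xi|^{\beta-3}d\xi$ with a constant $c_\beta>0$. In this case the solution of $(\partial_t^2-\Delta)u=\dot F$ with zero initial data is the stochastic convolution $u(t,x)=\int_0^t\int_{\mathbb{R}^3}G(t-s,x-y)M(ds,dy)$, $(t,x)\in[0,T]\times\mathbb{R}^3$. It is a centred Gaussian process, stationary in $x$, with $$E(u(t,x)u(\bar t,y))=\int_0^{t\wedge\bar t}ds\int_{\mathbb{R}^3}\mu(d\xi)\,e^{i\xi\cdot(x-y)}\,\mathcal{F}G(t-s)(\xi)\,\mathcal{F}G(\bar t-s)(\xi).$$ Hölder continuity of $x\mapsto u(t,x)$ is understood on compact sets, and path regularity statements refer to a suitable (continuous) version. *)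

theory Defs
  imports "HOL-Probability.Probability"
begin

text \<open>The degenerate law (variance zero) counts as Gaussian.\<close>

definition centred_gaussian :: "'w measure \<Rightarrow> ('w \<Rightarrow> real) \<Rightarrow> bool" where
  "centred_gaussian P X \<longleftrightarrow> X \<in> borel_measurable P \<and>
     ((AE \<omega> in P. X \<omega> = 0) \<or>
      (\<exists>\<sigma>>0. distributed P lborel X (\<lambda>r. ennreal (normal_density 0 \<sigma> r))))"

definition centred_gaussian_process ::
    "'w measure \<Rightarrow> 'i set \<Rightarrow> ('i \<Rightarrow> 'w \<Rightarrow> real) \<Rightarrow> bool" where
  "centred_gaussian_process P I X \<longleftrightarrow>
     (\<forall>J a. finite J \<and> J \<subseteq> I \<longrightarrow> centred_gaussian P (\<lambda>\<omega>. \<Sum>j\<in>J. a j * X j \<omega>))"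

primrec C_k :: "nat \<Rightarrow> ('a::euclidean_space \<Rightarrow> real) \<Rightarrow> bool" where
  "C_k 0 f \<longleftrightarrow> continuous_on UNIV f"
| "C_k (Suc k) f \<longleftrightarrow> (\<forall>z. f differentiable (at z)) \<and>
     (\<forall>b\<in>Basis. C_k k (\<lambda>z. frechet_derivative f (at z) b))"

text \<open>The space \<open>D(R\<^sup>4)\<close>, with \<open>R\<^sup>4\<close> written as time \<open>\<times>\<close> space.\<close>

definition test_functions :: "(real \<times> (real^3) \<Rightarrow> real) set" where
  "test_functions = {\<phi>. (\<forall>k. C_k k \<phi>) \<and> compact (closure {z. \<phi> z \<noteq> 0})}"

definition convolution :: "(real^3 \<Rightarrow> real) \<Rightarrow> (real^3 \<Rightarrow> real) \<Rightarrow> real^3 \<Rightarrow> real" where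
  "convolution f g x = (LINT y|lborel. f y * g (x - y))"

definition noise_covariance ::
    "real \<Rightarrow> (real \<times> (real^3) \<Rightarrow> real) \<Rightarrow> (real \<times> (real^3) \<Rightarrow> real) \<Rightarrow> real" where
  "noise_covariance \<beta> \<phi> \<psi> =
     (LINT s:{0..}|lborel. LINT x|lborel.
        norm x powr (-\<beta>) * convolution (\<lambda>y. \<phi> (s, y)) (\<lambda>y. \<psi> (s, -y)) x)"

definition riesz_noise ::
    "'w measure \<Rightarrow> real \<Rightarrow> ((real \<times> (real^3) \<Rightarrow> real) \<Rightarrow> 'w \<Rightarrow> real) \<Rightarrow> bool" where
  "riesz_noise P \<beta> F \<longleftrightarrow>
     centred_gaussian_process P test_functions F \<and>
     (\<forall>\<phi>\<in>test_functions. \<forall>\<psi>\<in>test_functions.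
        (LINT \<omega>|P. F \<phi> \<omega> * F \<psi> \<omega>) = noise_covariance \<beta> \<phi> \<psi>)"

text \<open>Convention: \<open>\<integral> exp (-i \<xi> \<bullet> y) dy\<close>, without a normalising factor.\<close>

definition fourier :: "(real^3 \<Rightarrow> real) \<Rightarrow> real^3 \<Rightarrow> complex" where
  "fourier f \<xi> = (LINT y|lborel. cis (- (\<xi> \<bullet> y)) * complex_of_real (f y))"

definition fourier_measure :: "(real^3) measure \<Rightarrow> real^3 \<Rightarrow> complex" where
  "fourier_measure \<nu> \<xi> = (LINT y|\<nu>. cis (- (\<xi> \<bullet> y)))"

text \<open>
  With this convention, \<open>\<integral> |x| powr (-\<beta>) * \<phi> x dx = \<integral> fourier \<phi> d(spectral_measure \<beta>)\<close>
  for Schwartz functions \<open>\<phi>\<close> and \<open>0 < \<beta> < 3\<close>, which fixes the constant.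
\<close>

definition spectral_const :: "real \<Rightarrow> real" where
  "spectral_const \<beta> =
     2 powr (-\<beta>) * pi powr (-(3/2)) * Gamma ((3 - \<beta>) / 2) / Gamma (\<beta> / 2)"

definition spectral_measure :: "real \<Rightarrow> (real^3) measure" where
  "spectral_measure \<beta> =
     density lborel (\<lambda>\<xi>. ennreal (spectral_const \<beta> * norm \<xi> powr (\<beta> - 3)))"

text \<open>
  Squared distance between two integrands on \<open>R\<^sub>+ \<times> R\<^sup>3\<close>, each given by its Fourier
  transform in the space variable as a function of time.
\<close>

definition spectral_dist2 ::
    "real \<Rightarrow> (real \<Rightarrow> real^3 \<Rightarrow> complex) \<Rightarrow> (real \<Rightarrow> real^3 \<Rightarrow> complex) \<Rightarrow> ennreal" where
  "spectral_dist2 \<beta> g h =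
     (\<integral>\<^sup>+ s\<in>{0..}. (\<integral>\<^sup>+ \<xi>. ennreal ((cmod (g s \<xi> - h s \<xi>))\<^sup>2) \<partial>spectral_measure \<beta>) \<partial>lborel)"

definition L2_dist2 :: "'w measure \<Rightarrow> ('w \<Rightarrow> real) \<Rightarrow> ('w \<Rightarrow> real) \<Rightarrow> ennreal" where
  "L2_dist2 P X Y = (\<integral>\<^sup>+ \<omega>. ennreal ((X \<omega> - Y \<omega>)\<^sup>2) \<partial>P)"

text \<open>
  \<open>M t A\<close> is the value of the extension of \<open>F\<close> at the indicator of \<open>[0,t] \<times> A\<close>,
  obtained by approximation with test functions.
\<close>

definition martingale_measure_extending ::
    "'w measure \<Rightarrow> real \<Rightarrow> ((real \<times> (real^3) \<Rightarrow> real) \<Rightarrow> 'w \<Rightarrow> real) \<Rightarrow>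
     (real \<Rightarrow> (real^3) set \<Rightarrow> 'w \<Rightarrow> real) \<Rightarrow> bool" where
  "martingale_measure_extending P \<beta> F M \<longleftrightarrow>
     (\<forall>t\<ge>0. \<forall>A. A \<in> sets borel \<and> bounded A \<longrightarrow>
        M t A \<in> borel_measurable P \<and>
        (\<exists>\<phi>. (\<forall>n. \<phi> n \<in> test_functions) \<and>
          (\<lambda>n::nat. spectral_dist2 \<beta> (\<lambda>s. fourier (\<lambda>y. \<phi> n (s, y)))
             (\<lambda>s. fourier (\<lambda>y. indicator {0..t} s * indicator A y))) \<longlonglongrightarrow> 0 \<and>
          (\<lambda>n. L2_dist2 P (F (\<phi> n)) (M t A)) \<longlonglongrightarrow> 0))"

text \<open>
  A list entry \<open>(a, r, q, A)\<close> stands for the summand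
  \<open>a * indicator {r<..q} s * indicator A y\<close> of an elementary integrand.
\<close>

type_synonym elementary = "(real \<times> real \<times> real \<times> (real^3) set) list"

definition is_elementary :: "elementary \<Rightarrow> bool" where
  "is_elementary g \<longleftrightarrow>
     (\<forall>(a, r, q, A)\<in>set g. 0 \<le> r \<and> r \<le> q \<and> A \<in> sets borel \<and> bounded A)"

definition elementary_fun :: "elementary \<Rightarrow> real \<Rightarrow> real^3 \<Rightarrow> real" where
  "elementary_fun g s y = (\<Sum>(a, r, q, A)\<leftarrow>g. a * indicator {r<..q} s * indicator A y)"

definition elementary_integral ::
    "(real \<Rightarrow> (real^3) set \<Rightarrow> 'w \<Rightarrow> real) \<Rightarrow> elementary \<Rightarrow> 'w \<Rightarrow> real" where
  "elementary_integral M g \<omega> = (\<Sum>(a, r, q, A)\<leftarrow>g. a * (M q A \<omega> - M r A \<omega>))"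

text \<open>
  \<open>X\<close> is (a representative of) the stochastic integral with respect to \<open>M\<close> of the
  measure-valued deterministic integrand \<open>S\<close>: the isometric extension of the elementary
  integral to the closure in the spectral norm.
\<close>

definition is_stochastic_integral ::
    "'w measure \<Rightarrow> real \<Rightarrow> (real \<Rightarrow> (real^3) set \<Rightarrow> 'w \<Rightarrow> real) \<Rightarrow>
     (real \<Rightarrow> (real^3) measure) \<Rightarrow> ('w \<Rightarrow> real) \<Rightarrow> bool" where
  "is_stochastic_integral P \<beta> M S X \<longleftrightarrow>
     X \<in> borel_measurable P \<and>
     (\<exists>g. (\<forall>n. is_elementary (g n)) \<and>
       (\<lambda>n::nat. spectral_dist2 \<beta> (\<lambda>s. fourier (elementary_fun (g n) s))
          (\<lambda>s. fourier_measure (S s))) \<longlonglongrightarrow> 0 \<and>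
       (\<lambda>n. L2_dist2 P (elementary_integral M (g n)) X) \<longlonglongrightarrow> 0)"

text \<open>
  The surface measure is the normalised image of the uniform distribution on the unit ball
  under radial projection to the sphere.
\<close>

definition sphere_measure :: "real \<Rightarrow> (real^3) measure" where
  "sphere_measure t =
     scale_measure (ennreal (4 * pi * t\<^sup>2))
       (distr (uniform_measure lborel (ball 0 1)) borel (\<lambda>y. t *\<^sub>R sgn y))"

definition wave_green :: "real \<Rightarrow> (real^3) measure" where
  "wave_green t = scale_measure (ennreal (1 / (4 * pi * t))) (sphere_measure t)"

text \<open>The measure \<open>G(t - s, x - dy)\<close>, set to zero outside \<open>0 \<le> s < t\<close>.\<close>

definition wave_kernel :: "real \<Rightarrow> real^3 \<Rightarrow> real \<Rightarrow> (real^3) measure" where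
  "wave_kernel t x s =
     (if 0 \<le> s \<and> s < t then distr (wave_green (t - s)) borel (\<lambda>z. x - z)
      else null_measure borel)"

definition wave_solution ::
    "'w measure \<Rightarrow> real \<Rightarrow> (real \<Rightarrow> (real^3) set \<Rightarrow> 'w \<Rightarrow> real) \<Rightarrow> real \<Rightarrow>
     (real \<Rightarrow> real^3 \<Rightarrow> 'w \<Rightarrow> real) \<Rightarrow> bool" where
  "wave_solution P \<beta> M T u \<longleftrightarrow>
     (\<forall>t\<in>{0..T}. \<forall>x. is_stochastic_integral P \<beta> M (wave_kernel t x) (u t x))"

definition continuous_version ::
    "'w measure \<Rightarrow> real \<Rightarrow> (real \<Rightarrow> real^3 \<Rightarrow> 'w \<Rightarrow> real) \<Rightarrow>
     (real \<Rightarrow> real^3 \<Rightarrow> 'w \<Rightarrow> real) \<Rightarrow> bool" where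
  "continuous_version P T u v \<longleftrightarrow>
     (\<forall>t\<in>{0..T}. \<forall>x. v t x \<in> borel_measurable P \<and> (AE \<omega> in P. v t x \<omega> = u t x \<omega>)) \<and>
     (AE \<omega> in P. continuous_on ({0..T} \<times> UNIV) (\<lambda>(t, x). v t x \<omega>))"

definition holder_on :: "real \<Rightarrow> 'a::metric_space set \<Rightarrow> ('a \<Rightarrow> real) \<Rightarrow> bool" where
  "holder_on \<gamma> S f \<longleftrightarrow> (\<exists>C. \<forall>x\<in>S. \<forall>y\<in>S. \<bar>f x - f y\<bar> \<le> C * dist x y powr \<gamma>)"

end

theory Submission
  imports Defs
begin

text \<open>
  Up to a positive constant \<open>C\<close>, \<open>F\<close> is an isometry for the spectral norm: writing the Riesz kernel as
  a mixture of Gaussians reduces this to Parseval's identity for Gaussian kernels. Passing to the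
  closure, \<open>E |u(t,x) - u(t',y)|\<^sup>2\<close> is \<open>C\<close> times the spectral distance of
  \<open>cis (-\<xi> \<bullet> x) * sin ((t-s)|\<xi>|) / |\<xi>|\<close> and its analogue for \<open>(t',y)\<close>. By scaling it is at most of order
  \<open>(|t-t'| + |x-y|) powr (2-\<beta>)\<close>, and frequencies of the order of the inverse increment already give the
  matching lower bounds. The increments are \<open>L\<^sup>2\<close> limits of centred Gaussian variables, so they obey
  Gaussian moment and small-ball estimates: the former feed a chaining argument, which yields a
  continuous version with all exponents below \<open>(2-\<beta>)/2\<close>; the latter and Borel-Cantelli along
  \<open>2 powr (-n)\<close> at countably many points exclude all larger exponents.
\<close>

section \<open>Fourier transform of the wave kernel\<close>

text \<open>The power 2 - \<beta> comes from homogeneity: for an increment of size d the energy is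
  at most a multiple of the integral of |\<xi>|^(\<beta>-5) min(2, d|\<xi>|)^2, and the substitution
  \<xi> -> \<xi>/d extracts d^(2-\<beta>). In dimension 3 this integral converges at the origin
  because \<beta> > 0 and at infinity because \<beta> < 2. The obstacle in passing to the closure is
  that covariances are prescribed for test functions, while the wave kernel is a singular measure in
  space, reached through two successive approximations: from test functions to \<open>M\<close>, and
  from elementary integrands to the solution. Every random variable is therefore carried together
  with its Fourier symbol, and one combination of noise variables has to be close in both norms at
  once; in this form the isometry survives both limits. The path statements concern an arbitrary
  continuous version and one null set for all exponents and all sets. Hence versions are compared on
  a countable dense set, and exponents and base points are first drawn from countable sets.\<close>

lemma lborel_distr_orthogonal:
  fixes f :: "real^3 \<Rightarrow> real^3"
  assumes "orthogonal_transformation f"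
  shows "distr lborel borel f = lborel"
proof (rule lborel_eqI[symmetric])
  have lin: "linear f" using assms by (rule orthogonal_transformation_linear)
  then have [measurable]: "f \<in> borel_measurable borel"
    by (intro borel_measurable_continuous_onI linear_continuous_on linear_conv_bounded_linear[THEN iffD1])
  fix l u :: "real^3" assume le: "\<And>b. b \<in> Basis \<Longrightarrow> l \<bullet> b \<le> u \<bullet> b"
  define g where "g = inv f"
  have g: "orthogonal_transformation g"
    unfolding g_def by (rule orthogonal_transformation_inv[OF assms])
  have eq: "f -` box l u = g ` box l u"
    unfolding g_def by (rule bij_vimage_eq_inv_image[OF orthogonal_transformation_bij[OF assms]])
  have m: "box l u \<in> lmeasurable" by simp
  have m': "f -` box l u \<in> lmeasurable"
    unfolding eq by (rule measurable_orthogonal_image[OF g m])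
  have s: "f -` box l u \<in> sets borel"
    using measurable_sets[of f borel borel "box l u"] by simp
  have "emeasure (distr lborel borel f) (box l u) = emeasure lborel (f -` box l u)"
    by (simp add: emeasure_distr)
  also have "\<dots> = emeasure lebesgue (f -` box l u)" using s by simp
  also have "\<dots> = ennreal (measure lebesgue (f -` box l u))"
    using m' by (simp add: emeasure_eq_measure2)
  also have "\<dots> = ennreal (measure lebesgue (box l u))"
    unfolding eq using measure_orthogonal_image[OF g m] by simp
  also have "\<dots> = (\<Prod>b\<in>Basis. (u - l) \<bullet> b)"
    using le by (simp add: measure_lborel_box_eq)
  finally show "emeasure (distr lborel borel f) (box l u) = ennreal (\<Prod>b\<in>Basis. (u - l) \<bullet> b)" .
qed simp

section \<open>Polar coordinates in R^3\<close>

lemma nn_integral_lborel_scale: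
  fixes f :: "'a::euclidean_space \<Rightarrow> ennreal"
  assumes [measurable]: "f \<in> borel_measurable borel" and c: "c > 0"
  shows "(\<integral>\<^sup>+x. f x \<partial>lborel) = ennreal (c ^ DIM('a)) * (\<integral>\<^sup>+x. f (c *\<^sub>R x) \<partial>lborel)"
  using c by (subst lborel_affine[of c 0])
    (simp_all add: nn_integral_density nn_integral_distr nn_integral_cmult)

lemma nn_integral_lborel_reflect:
  fixes f :: "'a::euclidean_space \<Rightarrow> ennreal"
  assumes [measurable]: "f \<in> borel_measurable borel"
  shows "(\<integral>\<^sup>+x. f (a - x) \<partial>lborel) = (\<integral>\<^sup>+x. f x \<partial>lborel)"
  by (subst (2) lborel_affine[of "-1" a])
    (simp_all add: nn_integral_density nn_integral_distr)

lemma borel_measurable_sgn_vec [measurable]: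
  "sgn \<in> borel_measurable (borel :: 'a::{real_normed_vector,second_countable_topology} measure)"
  unfolding sgn_div_norm[abs_def] by measurable

lemma nn_integral_square_lessThan:
  "(\<integral>\<^sup>+r. ennreal (3 * r\<^sup>2) * indicator {0<..<R} r \<partial>lborel) = ennreal (R ^ 3)" if "0 < R"
proof -
  have "((\<lambda>r. 3 * r\<^sup>2) has_integral (R ^ 3 - 0 ^ 3)) {0..R}"
    using that by (intro fundamental_theorem_of_calculus)
      (auto intro!: derivative_eq_intros simp: has_real_derivative_iff_has_vector_derivative[symmetric])
  then have "((\<lambda>r. 3 * r\<^sup>2) has_integral R ^ 3) {0<..<R}"
    by (simp add: has_integral_Icc_iff_Ioo)
  from nn_integral_has_integral_lebesgue'[OF _ this] show ?thesis by simp
qed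

text \<open>Polar coordinates are obtained without a surface measure: the image of
  \<open>g (sgn y) dy\<close> under the norm and the radial measure on the right agree on every half
  line \<open>{..<R}\<close>, because scaling by \<open>R\<close> maps the unit ball to the ball of
  radius \<open>R\<close> and leaves \<open>sgn\<close> unchanged. The weight 3 r^2 has integral 1
  over the unit interval, so the angular constant is an integral over the unit ball. Its finiteness
  provides the finite exhaustion that uniqueness of measures demands.\<close>

lemma nn_integral_polar:
  fixes f :: "real \<Rightarrow> ennreal" and g :: "real^3 \<Rightarrow> ennreal"
  assumes [measurable]: "f \<in> borel_measurable borel" "g \<in> borel_measurable borel"
    and fin: "(\<integral>\<^sup>+y. g (sgn y) * indicator (ball 0 1) y \<partial>lborel) < \<infinity>"
  shows "(\<integral>\<^sup>+y. f (norm y) * g (sgn y) \<partial>lborel) =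
    (\<integral>\<^sup>+y. g (sgn y) * indicator (ball 0 1) y \<partial>lborel) *
    (\<integral>\<^sup>+r. f r * ennreal (3 * r\<^sup>2) * indicator {0<..} r \<partial>lborel)"
proof -
  define c where "c = (\<integral>\<^sup>+y. g (sgn y) * indicator (ball 0 1) y \<partial>lborel)"
  define N1 where "N1 = distr (density lborel (\<lambda>y. g (sgn y))) borel (norm :: real^3 \<Rightarrow> real)"
  define N2 where "N2 = density lborel (\<lambda>r::real. c * (ennreal (3 * r\<^sup>2) * indicator {0<..} r))"
  have e1: "emeasure N1 {..<R} = c * ennreal (max 0 R ^ 3)" for R
  proof (cases "R > 0")
    case True
    have "emeasure N1 {..<R} = (\<integral>\<^sup>+y. g (sgn y) * indicator {..<R} (norm y) \<partial>lborel)"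
      unfolding N1_def by (simp add: emeasure_distr emeasure_density indicator_def vimage_def)
    also have "\<dots> = ennreal (R ^ 3) * (\<integral>\<^sup>+y. g (sgn (R *\<^sub>R y)) * indicator {..<R} (norm (R *\<^sub>R y)) \<partial>lborel)"
      using True by (subst nn_integral_lborel_scale[of _ R]) simp_all
    also have "(\<lambda>y. g (sgn (R *\<^sub>R y)) * indicator {..<R} (norm (R *\<^sub>R y))) =
        (\<lambda>y. g (sgn y) * indicator (ball 0 1) y)"
      using True by (auto simp: fun_eq_iff sgn_scaleR indicator_def)
    finally show ?thesis using True by (simp add: c_def mult.commute)
  next
    case False
    have "emeasure N1 {..<R} = (\<integral>\<^sup>+y. g (sgn y) * indicator {..<R} (norm y) \<partial>lborel)"
      unfolding N1_def by (simp add: emeasure_distr emeasure_density indicator_def vimage_def)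
    also have "(\<lambda>y::real^3. g (sgn y) * indicator {..<R} (norm y)) = (\<lambda>y. 0)"
    proof
      fix y :: "real^3"
      have "\<not> norm y < R" using False norm_ge_zero[of y] by linarith
      then show "g (sgn y) * indicator {..<R} (norm y) = 0" by simp
    qed
    finally show ?thesis using False by simp
  qed
  have e2: "emeasure N2 {..<R} = c * ennreal (max 0 R ^ 3)" for R
  proof -
    have "emeasure N2 {..<R} = (\<integral>\<^sup>+r. c * (ennreal (3 * r\<^sup>2) * indicator {0<..<R} r) \<partial>lborel)"
      unfolding N2_def by (subst emeasure_density) (auto intro!: nn_integral_cong split: split_indicator)
    also have "\<dots> = c * (\<integral>\<^sup>+r. ennreal (3 * r\<^sup>2) * indicator {0<..<R} r \<partial>lborel)"
      by (rule nn_integral_cmult) simp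
    also have "(\<integral>\<^sup>+r. ennreal (3 * r\<^sup>2) * indicator {0<..<R} r \<partial>lborel) = ennreal (max 0 R ^ 3)"
      by (cases "R > 0") (simp_all add: nn_integral_square_lessThan)
    finally show ?thesis .
  qed
  have "N1 = N2"
  proof (rule measure_eqI_generator_eq_countable[where E="range lessThan" and \<Omega>=UNIV
        and A="(\<lambda>n::nat. {..<real n}) ` UNIV"])
    show "Int_stable (range (lessThan :: real \<Rightarrow> real set))"
    proof -
      have "{..<a} \<inter> {..<b} = {..<min a b}" for a b :: real by auto
      then show ?thesis by (simp add: Int_stable_def)
    qed
    show "\<Union> (range (\<lambda>n::nat. {..<real n})) = UNIV"
      using reals_Archimedean2 by auto
    show "emeasure N1 a \<noteq> \<infinity>" if a: "a \<in> range (\<lambda>n::nat. {..<real n})" for a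
    proof -
      obtain n :: nat where "a = {..<real n}" using a by blast
      moreover have "c * ennreal (max 0 (real n) ^ 3) < \<infinity>"
        using fin unfolding c_def by (simp add: ennreal_mult_less_top)
      ultimately show ?thesis using e1[of "real n"] by simp
    qed
    have s: "sets borel = sigma_sets UNIV (range (lessThan :: real \<Rightarrow> real set))"
      by (subst borel_Iio) (simp add: sets_measure_of)
    show "sets N1 = sigma_sets UNIV (range lessThan)" "sets N2 = sigma_sets UNIV (range lessThan)"
      using s by (simp_all add: N1_def N2_def)
    show "emeasure N1 X = emeasure N2 X" if "X \<in> range lessThan" for X
      using that e1 e2 by auto
  qed auto
  have "(\<integral>\<^sup>+y. f (norm y) * g (sgn y) \<partial>lborel) = (\<integral>\<^sup>+r. f r \<partial>N1)"
    unfolding N1_def by (simp add: nn_integral_distr nn_integral_density mult.commute)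
  also have "\<dots> = c * (\<integral>\<^sup>+r. f r * ennreal (3 * r\<^sup>2) * indicator {0<..} r \<partial>lborel)"
  proof -
    have "(\<integral>\<^sup>+r. f r \<partial>N1) =
        (\<integral>\<^sup>+r. c * (ennreal (3 * r\<^sup>2) * indicator {0<..} r) * f r \<partial>lborel)"
      unfolding \<open>N1 = N2\<close> N2_def by (rule nn_integral_density) simp_all
    also have "\<dots> = (\<integral>\<^sup>+r. c * (f r * ennreal (3 * r\<^sup>2) * indicator {0<..} r) \<partial>lborel)"
      by (simp add: mult_ac)
    also have "\<dots> = c * (\<integral>\<^sup>+r. f r * ennreal (3 * r\<^sup>2) * indicator {0<..} r \<partial>lborel)"
      by (rule nn_integral_cmult) simp
    finally show ?thesis .
  qed
  finally show ?thesis by (simp add: c_def)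
qed

section \<open>Moments of a uniform direction\<close>

lemma nn_integral_gaussian_even_moment:
  "(\<integral>\<^sup>+x. ennreal (x ^ (2 * k) * exp (- x\<^sup>2)) * indicator {0<..} x \<partial>lborel) =
    ennreal (sqrt pi / 2 * (fact (2 * k) / (2 ^ (2 * k) * fact k)))"
proof -
  have "(\<integral>\<^sup>+x. ennreal (x ^ (2 * k) * exp (- x\<^sup>2)) * indicator {0<..} x \<partial>lborel) =
     (\<integral>\<^sup>+x. ennreal (indicator {0..} x *\<^sub>R (exp (-x\<^sup>2)*x^(2 * k))) \<partial>lborel)"
  proof (rule nn_integral_cong_AE, rule eventually_mono[OF AE_lborel_singleton[of 0]])
    fix x :: real assume "x \<noteq> 0"
    then show "ennreal (x ^ (2 * k) * exp (- x\<^sup>2)) * indicator {0<..} x =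
        ennreal (indicator {0..} x *\<^sub>R (exp (-x\<^sup>2)*x^(2 * k)))"
      by (simp add: indicator_def)
  qed
  also have "\<dots> = ennreal (sqrt pi / 2 * (fact (2 * k) / (2 ^ (2 * k) * fact k)))"
  proof (subst nn_integral_eq_integral)
    show "integrable lborel (\<lambda>x. indicator {0..} x *\<^sub>R (exp (-x\<^sup>2)*x^(2 * k)) :: real)"
      using gaussian_moment_even_pos[of k] by (rule integrable.intros)
    show "AE x in lborel. 0 \<le> (indicator {0..} x *\<^sub>R (exp (-x\<^sup>2)*x^(2 * k)) :: real)"
      by (intro AE_I2) simp
    show "ennreal (LBINT x. indicator {0..} x *\<^sub>R (exp (-x\<^sup>2)*x^(2 * k)) :: real) =
        ennreal (sqrt pi / 2 * (fact (2 * k) / (2 ^ (2 * k) * fact k)))"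
      using gaussian_moment_even_pos[of k] by (simp only: has_bochner_integral_integral_eq)
  qed
  finally show ?thesis .
qed

lemma nn_integral_gaussian_even_moment_UNIV:
  "(\<integral>\<^sup>+x. ennreal (x ^ (2 * k) * exp (- x\<^sup>2)) \<partial>lborel) =
    ennreal (sqrt pi * (fact (2 * k) / (2 ^ (2 * k) * fact k)))"
proof -
  have "has_bochner_integral lborel (\<lambda>x::real. exp (-x\<^sup>2)*x^(2 * k)) (2 *\<^sub>R ((sqrt pi / 2) * (fact (2 * k) / (2 ^ (2 * k) * fact k))))"
    by (rule has_bochner_integral_even_function[OF gaussian_moment_even_pos]) simp
  then have "has_bochner_integral lborel (\<lambda>x::real. x ^ (2 * k) * exp (- x\<^sup>2))
      (sqrt pi * (fact (2 * k) / (2 ^ (2 * k) * fact k)))"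
    by (simp only: mult.commute[of "exp _"]) simp
  then show ?thesis
    by (intro trans[OF nn_integral_eq_integral])
      (simp_all only: has_bochner_integral_iff, auto intro!: AE_I2 mult_nonneg_nonneg zero_le_even_power)
qed

text \<open>Along a coordinate axis the integrand is a product over coordinates: one factor is an
  even Gaussian moment, the two others are total Gaussian masses \<open>sqrt pi\<close>.\<close>

lemma nn_integral_gaussian_moment_axis:
  fixes e :: "real^3"
  assumes e: "e \<in> Basis"
  shows "(\<integral>\<^sup>+y. ennreal ((e \<bullet> y) ^ (2 * k) * exp (- (norm y)\<^sup>2)) \<partial>lborel) =
    ennreal (pi * sqrt pi * (fact (2 * k) / (2 ^ (2 * k) * fact k)))"
proof -
  define f where "f b x = ennreal (x ^ (2 * (if b = e then k else 0)) * exp (- x\<^sup>2))" for b :: "real^3" and x :: real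
  have "ennreal ((e \<bullet> y) ^ (2 * k) * exp (- (norm y)\<^sup>2)) = (\<Prod>b\<in>Basis. f b (y \<bullet> b))" for y
  proof -
    have "(\<Prod>b\<in>Basis. f b (y \<bullet> b)) = ennreal (\<Prod>b\<in>Basis. (y \<bullet> b) ^ (2 * (if b = e then k else 0)) * exp (- (y \<bullet> b)\<^sup>2))"
      unfolding f_def by (subst prod_ennreal) auto
    also have "(\<Prod>b\<in>Basis. (y \<bullet> b) ^ (2 * (if b = e then k else 0)) * exp (- (y \<bullet> b)\<^sup>2)) =
      (\<Prod>b\<in>Basis. if b = e then (y \<bullet> b) ^ (2 * k) else 1) * exp (\<Sum>b\<in>Basis. - (y \<bullet> b)\<^sup>2)"
      by (simp add: prod.distrib exp_sum if_distrib[of "\<lambda>n. _ ^ (2 * n)"] cong: if_cong)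
    also have "(\<Prod>b\<in>Basis. if b = e then (y \<bullet> b) ^ (2 * k) else 1) = (y \<bullet> e) ^ (2 * k)"
      using e by (simp add: prod.delta)
    also have "(\<Sum>b\<in>Basis. - (y \<bullet> b)\<^sup>2) = - (norm y)\<^sup>2"
      unfolding power2_norm_eq_inner euclidean_inner[of y y] by (simp add: sum_negf power2_eq_square)
    finally show ?thesis by (simp add: inner_commute)
  qed
  then have "(\<integral>\<^sup>+y. ennreal ((e \<bullet> y) ^ (2 * k) * exp (- (norm y)\<^sup>2)) \<partial>lborel) =
     (\<integral>\<^sup>+y. (\<Prod>b\<in>Basis. f b (y \<bullet> b)) \<partial>lborel)" by simp
  also have "\<dots> = (\<Prod>b\<in>Basis. \<integral>\<^sup>+x. f b x \<partial>lborel)"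
    by (rule nn_integral_lborel_prod) (auto simp: f_def)
  also have "\<dots> = (\<Prod>b\<in>Basis. if b = e then ennreal (sqrt pi * (fact (2 * k) / (2 ^ (2 * k) * fact k))) else ennreal (sqrt pi))"
    unfolding f_def nn_integral_gaussian_even_moment_UNIV by (intro prod.cong) auto
  also have "\<dots> = ennreal (sqrt pi * (fact (2 * k) / (2 ^ (2 * k) * fact k))) * ennreal (sqrt pi) ^ 2"
    using e by (subst prod.remove[OF _ e]) (auto simp: card_Diff_singleton)
  also have "\<dots> = ennreal (pi * sqrt pi * (fact (2 * k) / (2 ^ (2 * k) * fact k)))"
    by (simp add: ennreal_power ennreal_mult[symmetric] mult_ac)
  finally show ?thesis .
qed

lemma nn_integral_gaussian_moment_unit:
  fixes u :: "real^3"
  assumes u: "norm u = 1"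
  shows "(\<integral>\<^sup>+y. ennreal ((u \<bullet> y) ^ (2 * k) * exp (- (norm y)\<^sup>2)) \<partial>lborel) =
    ennreal (pi * sqrt pi * (fact (2 * k) / (2 ^ (2 * k) * fact k)))"
proof -
  obtain e :: "real^3" where e: "e \<in> Basis" using nonempty_Basis by blast
  then obtain f where f: "orthogonal_transformation f" "f e = u"
    using orthogonal_transformation_exists[of e u] u by auto
  have [measurable]: "f \<in> borel_measurable borel"
    using orthogonal_transformation_linear[OF f(1)]
    by (intro borel_measurable_continuous_onI linear_continuous_on linear_conv_bounded_linear[THEN iffD1])
  have "(\<integral>\<^sup>+y. ennreal ((u \<bullet> y) ^ (2 * k) * exp (- (norm y)\<^sup>2)) \<partial>lborel) =
     (\<integral>\<^sup>+y. ennreal ((u \<bullet> y) ^ (2 * k) * exp (- (norm y)\<^sup>2)) \<partial>distr lborel borel f)"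
    by (simp add: lborel_distr_orthogonal[OF f(1)])
  also have "\<dots> = (\<integral>\<^sup>+y. ennreal ((u \<bullet> f y) ^ (2 * k) * exp (- (norm (f y))\<^sup>2)) \<partial>lborel)"
    by (rule nn_integral_distr) simp_all
  also have "\<dots> = (\<integral>\<^sup>+y. ennreal ((e \<bullet> y) ^ (2 * k) * exp (- (norm y)\<^sup>2)) \<partial>lborel)"
    using f by (simp add: orthogonal_transformation_def orthogonal_transformation_norm flip: f(2))
  finally show ?thesis using nn_integral_gaussian_moment_axis[OF e] by simp
qed

lemma emeasure_unit_ball3: "emeasure lborel (ball (0::real^3) 1) = ennreal (4 * pi / 3)"
  by (simp add: emeasure_ball unit_ball_vol_3)

text \<open>The Gaussian moment of \<open>u \<bullet> y\<close> is computed twice: rotation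
  invariance reduces it to one dimension, and polar coordinates split it into the angular moment
  sought and a radial Gaussian moment. Up to the ball volume 4 pi / 3, the quotient is the moment
  1/(2k+1) of the uniform law on [-1,1], as in Archimedes' theorem on spherical zones.\<close>

lemma nn_integral_ball_sgn_moment:
  fixes u :: "real^3"
  assumes u: "norm u = 1"
  shows "(\<integral>\<^sup>+y. ennreal ((u \<bullet> sgn y) ^ (2 * k)) * indicator (ball 0 1) y \<partial>lborel) =
    ennreal (4 * pi / (3 * (2 * real k + 1)))"
proof -
  define c where "c = (\<integral>\<^sup>+y. ennreal ((u \<bullet> sgn y) ^ (2 * k)) * indicator (ball 0 1) y \<partial>lborel)"
  have "c \<le> (\<integral>\<^sup>+y. indicator (ball 0 1) y \<partial>(lborel::(real^3) measure))"
    unfolding c_def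
  proof (rule nn_integral_mono)
    fix y :: "real^3"
    have "\<bar>u \<bullet> sgn y\<bar> \<le> 1"
      using Cauchy_Schwarz_ineq2[of u "sgn y"] u by (simp add: norm_sgn split: if_splits)
    then have "(u \<bullet> sgn y) ^ (2 * k) \<le> 1"
      by (simp add: power_mult abs_square_le_1 power_le_one)
    then show "ennreal ((u \<bullet> sgn y) ^ (2 * k)) * indicator (ball 0 1) y \<le> indicator (ball 0 1) y"
      by (simp add: indicator_def)
  qed
  then have fin: "c < \<infinity>" by (simp add: emeasure_unit_ball3 le_less_trans)
  have "ennreal (pi * sqrt pi * (fact (2 * k) / (2 ^ (2 * k) * fact k))) =
      (\<integral>\<^sup>+y. ennreal ((u \<bullet> y) ^ (2 * k) * exp (- (norm y)\<^sup>2)) \<partial>lborel)"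
    by (rule nn_integral_gaussian_moment_unit[OF u, symmetric])
  also have "\<dots> = (\<integral>\<^sup>+y. ennreal (norm y ^ (2 * k) * exp (- (norm y)\<^sup>2)) * ennreal ((u \<bullet> sgn y) ^ (2 * k)) \<partial>lborel)"
  proof (rule nn_integral_cong)
    fix y :: "real^3"
    have "u \<bullet> y = norm y * (u \<bullet> sgn y)"
      by (cases "y = 0") (simp_all add: sgn_div_norm)
    then show "ennreal ((u \<bullet> y) ^ (2 * k) * exp (- (norm y)\<^sup>2)) =
        ennreal (norm y ^ (2 * k) * exp (- (norm y)\<^sup>2)) * ennreal ((u \<bullet> sgn y) ^ (2 * k))"
      by (simp add: ennreal_mult[symmetric] power_mult_distrib mult_ac zero_le_even_power)
  qed
  also have "\<dots> = c * (\<integral>\<^sup>+r. ennreal (r ^ (2 * k) * exp (- r\<^sup>2)) * ennreal (3 * r\<^sup>2) * indicator {0<..} r \<partial>lborel)"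
    unfolding c_def
    by (rule nn_integral_polar[where f="\<lambda>r. ennreal (r ^ (2 * k) * exp (- r\<^sup>2))" and g="\<lambda>y. ennreal ((u \<bullet> y) ^ (2 * k))"])
      (use fin in \<open>simp_all add: c_def\<close>)
  \<comment> \<open>The polar weight 3 r^2 raises the degree from 2k to 2k + 2.\<close>
  also have "(\<integral>\<^sup>+r. ennreal (r ^ (2 * k) * exp (- r\<^sup>2)) * ennreal (3 * r\<^sup>2) * indicator {0<..} r \<partial>lborel) =
      (\<integral>\<^sup>+r. 3 * (ennreal (r ^ (2 * Suc k) * exp (- r\<^sup>2)) * indicator {0<..} r) \<partial>lborel)"
    by (intro nn_integral_cong)
      (auto simp: ennreal_mult[symmetric] zero_le_even_power power2_eq_square mult_ac split: split_indicator
        simp flip: ennreal_numeral)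
  also have "\<dots> = 3 * ennreal (sqrt pi / 2 * (fact (2 * Suc k) / (2 ^ (2 * Suc k) * fact (Suc k))))"
    by (subst nn_integral_cmult, measurable) (simp only: nn_integral_gaussian_even_moment)
  finally have eq: "ennreal (pi * sqrt pi * (fact (2 * k) / (2 ^ (2 * k) * fact k))) =
      c * ennreal (3 * (sqrt pi / 2 * (fact (2 * Suc k) / (2 ^ (2 * Suc k) * fact (Suc k)))))"
    by (subst ennreal_mult) (simp_all only: ennreal_numeral, simp_all)
  obtain r where r: "c = ennreal r" "r \<ge> 0" using fin by (cases c) auto
  have "pi * sqrt pi * (fact (2 * k) / (2 ^ (2 * k) * fact k)) =
      r * (3 * (sqrt pi / 2 * (fact (2 * Suc k) / (2 ^ (2 * Suc k) * fact (Suc k)))))"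
    using eq r by (simp add: ennreal_mult[symmetric])
  \<comment> \<open>The factorial quotient reduces to (2k+2)(2k+1) / (4(k+1)) = (2k+1)/2, the only
    dependence on k that survives.\<close>
  moreover have "(fact (2 * Suc k) :: real) = (2 * real k + 2) * (2 * real k + 1) * fact (2 * k)"
    by (simp add: algebra_simps)
  moreover have "(fact (Suc k) :: real) = (real k + 1) * fact k" by simp
  moreover have "(2::real) ^ (2 * Suc k) = 4 * 2 ^ (2 * k)" by simp
  ultimately have "pi * sqrt pi * (fact (2 * k) / (2 ^ (2 * k) * fact k)) =
      r * (3 * (sqrt pi / 2 * ((2 * real k + 2) * (2 * real k + 1) * fact (2 * k) / (4 * 2 ^ (2 * k) * ((real k + 1) * fact k)))))"
    by (simp only:)
  also have "\<dots> = (r * (3 * (2 * real k + 1)) / 4) * sqrt pi * (fact (2 * k) / (2 ^ (2 * k) * fact k))"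
    by (simp add: divide_simps del: fact_Suc) (simp add: algebra_simps)
  finally have "pi * (sqrt pi * (fact (2 * k) / (2 ^ (2 * k) * fact k))) =
      r * (3 * (2 * real k + 1)) / 4 * (sqrt pi * (fact (2 * k) / (2 ^ (2 * k) * fact k)))"
    by (simp only: mult.assoc)
  then have "pi = r * (3 * (2 * real k + 1)) / 4"
    by (subst (asm) mult_right_cancel) simp_all
  then have "r = 4 * pi / (3 * (2 * real k + 1))" by (simp add: field_simps)
  then show ?thesis using r by (simp add: c_def)
qed

section \<open>Characteristic function of a uniform direction\<close>

abbreviation unit_ball_law :: "(real^3) measure" where
  "unit_ball_law \<equiv> uniform_measure lborel (ball 0 1)"

lemma prob_space_unit_ball_law: "prob_space unit_ball_law"
  by (rule prob_space_uniform_measure) (simp_all add: emeasure_unit_ball3)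

lemma sgn_inner_le: "\<bar>u \<bullet> sgn y\<bar> \<le> norm u" for u y :: "'a::real_inner"
  using Cauchy_Schwarz_ineq2[of u "sgn y"] by (simp add: norm_sgn split: if_splits)

lemma integral_sgn_moment_even:
  fixes u :: "real^3"
  assumes u: "norm u = 1"
  shows "(LINT y|unit_ball_law. (u \<bullet> sgn y) ^ (2 * k)) = 1 / (2 * real k + 1)"
proof -
  have "(\<integral>\<^sup>+y. ennreal ((u \<bullet> sgn y) ^ (2 * k)) \<partial>unit_ball_law) =
     ennreal (4 * pi / (3 * (2 * real k + 1))) / ennreal (4 * pi / 3)"
    by (subst nn_integral_uniform_measure) (simp_all add: emeasure_unit_ball3 nn_integral_ball_sgn_moment[OF u])
  also have "\<dots> = ennreal (1 / (2 * real k + 1))"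
  proof -
    have "4 * pi / (3 * (2 * real k + 1)) / (4 * pi / 3) = 1 / (2 * real k + 1)"
      by (simp add: divide_simps del: mult_numeral_left_semiring_numeral)
    then show ?thesis by (subst divide_ennreal) simp_all
  qed
  finally show ?thesis
    by (subst integral_eq_nn_integral) (simp_all add: zero_le_even_power)
qed

text \<open>One formula covers both parities because \<open>cos_coeff\<close> vanishes at odd
  indices; for even n = 2k the moment 1/(2k+1) is 1/(n+1).\<close>

lemma integral_sgn_cos_term:
  fixes u :: "real^3"
  assumes u: "norm u = 1"
  shows "(LINT y|unit_ball_law. cos_coeff n * (a * (u \<bullet> sgn y)) ^ n) = cos_coeff n * a ^ n / real (Suc n)"
proof (cases "even n")
  case True
  then obtain k where n: "n = 2 * k" by blast
  have "(LINT y|unit_ball_law. cos_coeff n * (a * (u \<bullet> sgn y)) ^ n) =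
     (LINT y|unit_ball_law. cos_coeff n * a ^ n * (u \<bullet> sgn y) ^ (2 * k))"
    by (simp add: power_mult_distrib n mult_ac)
  also have "\<dots> = cos_coeff n * a ^ n * (1 / (2 * real k + 1))"
    by (simp only: integral_mult_right_zero integral_sgn_moment_even[OF u])
  finally show ?thesis by (simp add: n add.commute)
qed (simp add: cos_coeff_def)

text \<open>Termwise integration of the cosine series: the factor 1/(n+1) from the moments turns the
  cosine coefficients into the sine coefficients shifted by one. The inner product with
  \<open>sgn y\<close> is at most 1 in modulus, so the series is dominated by that of cosh
  |a|.\<close>

lemma integral_sgn_cos:
  fixes u :: "real^3"
  assumes u: "norm u = 1" and a: "a \<noteq> 0"
  shows "(LINT y|unit_ball_law. cos (a * (u \<bullet> sgn y))) = sin a / a"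
proof -
  interpret prob_space unit_ball_law by (rule prob_space_unit_ball_law)
  let ?f = "\<lambda>n y. cos_coeff n * (a * (u \<bullet> sgn y)) ^ n"
  have bd: "\<bar>?f n y\<bar> \<le> \<bar>cos_coeff n\<bar> * \<bar>a\<bar> ^ n" for n y
    using power_mono[OF sgn_inner_le[of u y], of n] u
    by (simp add: abs_mult power_abs power_mult_distrib mult_left_le mult_nonneg_nonneg flip: mult.assoc)
  have int: "integrable unit_ball_law (?f n)" for n
    by (rule integrable_const_bound[where B="\<bar>cos_coeff n\<bar> * \<bar>a\<bar> ^ n"]) (use bd in \<open>simp_all\<close>)
  have s1: "summable (\<lambda>n. \<bar>cos_coeff n\<bar> * \<bar>a\<bar> ^ n)"
    using summable_norm_cos[of "\<bar>a\<bar>"] by (simp add: abs_mult power_abs)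
  have "(LINT y|unit_ball_law. (\<Sum>n. ?f n y)) = (\<Sum>n. LINT y|unit_ball_law. ?f n y)"
  proof (rule integral_suminf[OF int])
    show "AE y in unit_ball_law. summable (\<lambda>n. norm (?f n y))"
      by (intro AE_I2 summable_comparison_test'[OF s1, of 0]) (use bd in simp)
    show "summable (\<lambda>n. LINT y|unit_ball_law. norm (?f n y))"
    proof (rule summable_comparison_test'[OF s1, of 0])
      fix n
      have "(LINT y|unit_ball_law. norm (?f n y)) \<le> (LINT y|unit_ball_law. \<bar>cos_coeff n\<bar> * \<bar>a\<bar> ^ n)"
        by (rule integral_mono[OF integrable_norm[OF int]]) (use bd in simp_all)
      also have "\<dots> = \<bar>cos_coeff n\<bar> * \<bar>a\<bar> ^ n"
        using prob_space by simp
      finally show "norm (LINT y|unit_ball_law. norm (?f n y)) \<le> \<bar>cos_coeff n\<bar> * \<bar>a\<bar> ^ n"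
        by simp
    qed
  qed
  also have "\<dots> = (\<Sum>n. cos_coeff n * a ^ n / real (Suc n))"
    by (simp only: integral_sgn_cos_term[OF u])
  also have "\<dots> = sin a / a"
  proof (rule sums_unique[symmetric])
    have "(\<lambda>n. sin_coeff n * a ^ n) sums sin a"
      using sin_converges[of a] by simp
    then have "(\<lambda>n. sin_coeff (Suc n) * a ^ Suc n) sums (sin a - sin_coeff 0 * a ^ 0)"
      by (subst sums_Suc_iff) simp
    then have "(\<lambda>n. (sin_coeff (Suc n) * a ^ Suc n) / a) sums (sin a / a)"
      by (intro sums_divide) simp
    then show "(\<lambda>n. cos_coeff n * a ^ n / real (Suc n)) sums (sin a / a)"
      using a by (simp add: sin_coeff_Suc)
  qed
  also have "(\<lambda>y. \<Sum>n. ?f n y) = (\<lambda>y. cos (a * (u \<bullet> sgn y)))"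
    by (simp add: cos_def)
  finally show ?thesis .
qed

text \<open>The uniform law on the ball is symmetric under y -> -y and the integrand is odd.\<close>

lemma integral_sgn_sin:
  fixes u :: "real^3"
  shows "(LINT y|unit_ball_law. sin (a * (u \<bullet> sgn y))) = 0"
proof -
  have d: "distr unit_ball_law borel uminus = unit_ball_law"
  proof (rule measure_eqI)
    fix A :: "(real^3) set" assume "A \<in> sets (distr unit_ball_law borel uminus)"
    then have [measurable]: "A \<in> sets borel" by simp
    have "(\<integral>\<^sup>+x. indicator (ball 0 1 \<inter> A) (0 - x) \<partial>lborel) = (\<integral>\<^sup>+x. indicator (ball 0 1 \<inter> A) x \<partial>lborel)"
      by (rule nn_integral_lborel_reflect) (intro borel_measurable_indicator, simp)
    also have "(\<lambda>x. indicator (ball 0 1 \<inter> A) (0 - x) :: ennreal) = indicator (ball 0 1 \<inter> (uminus -` A))"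
      by (auto simp: indicator_def)
    finally have "emeasure lborel (ball 0 1 \<inter> (uminus -` A)) = emeasure lborel (ball 0 1 \<inter> A)"
      using measurable_sets[of uminus borel borel A] by (simp add: nn_integral_indicator)
    then show "emeasure (distr unit_ball_law borel uminus) A = emeasure unit_ball_law A"
      using measurable_sets[of uminus borel borel A] by (simp add: emeasure_distr)
  qed simp
  have "(LINT y|unit_ball_law. sin (a * (u \<bullet> sgn y))) = (LINT y|distr unit_ball_law borel uminus. sin (a * (u \<bullet> sgn y)))"
    by (simp only: d)
  also have "\<dots> = (LINT y|unit_ball_law. sin (a * (u \<bullet> sgn (- y))))"
    by (rule integral_distr) simp_all
  also have "\<dots> = - (LINT y|unit_ball_law. sin (a * (u \<bullet> sgn y)))"
    by (simp add: sgn_minus)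
  finally show ?thesis by simp
qed

lemma borel_measurable_cis [measurable (raw)]:
  "f \<in> borel_measurable M \<Longrightarrow> (\<lambda>x. cis (f x)) \<in> borel_measurable M"
  by (rule measurable_compose[where g=cis])
    (auto intro!: borel_measurable_continuous_onI continuous_intros)

lemma integral_scale_measure:
  fixes f :: "'a \<Rightarrow> 'b::{banach, second_countable_topology}"
  assumes [measurable]: "f \<in> borel_measurable M" and "0 \<le> c"
  shows "integral\<^sup>L (scale_measure (ennreal c) M) f = c *\<^sub>R integral\<^sup>L M f"
proof -
  have "scale_measure (ennreal c) M = density M (\<lambda>_. ennreal c)"
    by (rule measure_eqI) (simp_all add: emeasure_density nn_integral_cmult_indicator)
  then show ?thesis using assms by (simp add: integral_density)
qed

text \<open>The mass 4 pi t^2 times 1/(4 pi t) leaves a factor t, which cancels the t in the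
  denominator of sin (t|\<xi>|) / (t|\<xi>|). The origin is excluded because division by zero makes
  the right side 0 there, whereas the transform has the value t.\<close>

lemma fourier_measure_wave_green:
  assumes t: "t > 0" and xi: "\<xi> \<noteq> 0"
  shows "fourier_measure (wave_green t) \<xi> = complex_of_real (sin (t * norm \<xi>) / norm \<xi>)"
proof -
  interpret prob_space unit_ball_law by (rule prob_space_unit_ball_law)
  define u where "u = \<xi> /\<^sub>R norm \<xi>"
  have u: "norm u = 1" using xi by (simp add: u_def)
  define a where "a = t * norm \<xi>"
  have a: "a \<noteq> 0" using t xi by (simp add: a_def)
  have "fourier_measure (wave_green t) \<xi> =
      (1 / (4 * pi * t)) *\<^sub>R ((4 * pi * t\<^sup>2) *\<^sub>R (LINT y|distr unit_ball_law borel (\<lambda>y. t *\<^sub>R sgn y). cis (- (\<xi> \<bullet> y))))"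
    unfolding fourier_measure_def wave_green_def sphere_measure_def
    using t by (subst integral_scale_measure, simp, simp, subst integral_scale_measure) simp_all
  also have "\<dots> = t *\<^sub>R (LINT y|unit_ball_law. cis (- (\<xi> \<bullet> (t *\<^sub>R sgn y))))"
    using t by (subst integral_distr) (simp_all add: power2_eq_square)
  also have "(\<lambda>y. cis (- (\<xi> \<bullet> (t *\<^sub>R sgn y)))) = (\<lambda>y. complex_of_real (cos (a * (u \<bullet> sgn y))) - \<i> * complex_of_real (sin (a * (u \<bullet> sgn y))))"
  proof
    fix y :: "real^3"
    have "\<xi> \<bullet> (t *\<^sub>R sgn y) = a * (u \<bullet> sgn y)"
      using xi by (simp add: a_def u_def)
    then show "cis (- (\<xi> \<bullet> (t *\<^sub>R sgn y))) =
        complex_of_real (cos (a * (u \<bullet> sgn y))) - \<i> * complex_of_real (sin (a * (u \<bullet> sgn y)))"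
      by (simp only: complex_eq_iff) simp
  qed
  also have "(LINT y|unit_ball_law. complex_of_real (cos (a * (u \<bullet> sgn y))) - \<i> * complex_of_real (sin (a * (u \<bullet> sgn y)))) =
      complex_of_real (sin a / a)"
  proof (subst Bochner_Integration.integral_diff)
    show "integrable unit_ball_law (\<lambda>y. complex_of_real (cos (a * (u \<bullet> sgn y))))"
      by (rule integrable_const_bound[where B=1]) (simp_all add: norm_of_real abs_cos_le_one)
    show "integrable unit_ball_law (\<lambda>y. \<i> * complex_of_real (sin (a * (u \<bullet> sgn y))))"
      by (rule integrable_const_bound[where B=1]) (simp_all add: norm_mult abs_sin_le_one)
    show "(LINT y|unit_ball_law. complex_of_real (cos (a * (u \<bullet> sgn y)))) -
      (LINT y|unit_ball_law. \<i> * complex_of_real (sin (a * (u \<bullet> sgn y)))) = complex_of_real (sin a / a)"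
      using integral_sgn_cos[OF u a] integral_sgn_sin[of a u] by (simp del: of_real_divide)
  qed
  finally show ?thesis using t by (simp add: a_def scaleR_conv_of_real)
qed

text \<open>The map z -> x - z contributes the phase and replaces \<xi> by -\<xi>, which the radial
  transform does not notice. Outside [0,t) the null measure produces the value 0.\<close>

lemma fourier_measure_wave_kernel:
  assumes xi: "\<xi> \<noteq> 0"
  shows "fourier_measure (wave_kernel t x s) \<xi> =
    (if 0 \<le> s \<and> s < t then cis (- (\<xi> \<bullet> x)) * complex_of_real (sin ((t - s) * norm \<xi>) / norm \<xi>) else 0)"
proof (cases "0 \<le> s \<and> s < t")
  case True
  have [measurable_cong]: "sets (wave_green (t - s)) = sets borel"
    by (simp add: wave_green_def sphere_measure_def)
  have "fourier_measure (wave_kernel t x s) \<xi> = (LINT y|wave_green (t - s). cis (- (\<xi> \<bullet> (x - y))))"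
    using True unfolding fourier_measure_def wave_kernel_def by (simp add: integral_distr)
  also have "(\<lambda>y. cis (- (\<xi> \<bullet> (x - y)))) = (\<lambda>y. cis (- (\<xi> \<bullet> x)) * cis (- ((- \<xi>) \<bullet> y)))"
    by (simp add: cis_mult inner_diff_right)
  also have "(LINT y|wave_green (t - s). cis (- (\<xi> \<bullet> x)) * cis (- ((- \<xi>) \<bullet> y))) =
      cis (- (\<xi> \<bullet> x)) * fourier_measure (wave_green (t - s)) (- \<xi>)"
    unfolding fourier_measure_def by simp
  finally show ?thesis using True xi by (simp add: fourier_measure_wave_green)
next
  case False
  then show ?thesis by (auto simp: wave_kernel_def fourier_measure_def)
qed

section \<open>Parseval identity for the Riesz kernel\<close>

lemma nn_integral_powr_near_0:
  fixes a c :: real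
  assumes "a > -1" "c \<ge> 0"
  shows "(\<integral>\<^sup>+x. ennreal (x powr a) * indicator {0..c} x \<partial>lborel) < \<infinity>"
  using nn_integral_has_integral_lebesgue'[OF _ has_integral_powr_from_0[OF assms]] by simp

lemma nn_integral_powr_to_inf:
  fixes a c :: real
  assumes "a < -1" "c > 0"
  shows "(\<integral>\<^sup>+x. ennreal (x powr a) * indicator {c..} x \<partial>lborel) < \<infinity>"
  using nn_integral_has_integral_lebesgue'[OF _ has_integral_powr_to_inf[OF assms]] by simp

lemma nn_integral_radial:
  fixes f :: "real \<Rightarrow> ennreal"
  assumes [measurable]: "f \<in> borel_measurable borel"
  shows "(\<integral>\<^sup>+y. f (norm (y::real^3)) \<partial>lborel) =
    ennreal (4 * pi / 3) * (\<integral>\<^sup>+r. f r * ennreal (3 * r\<^sup>2) * indicator {0<..} r \<partial>lborel)"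
  using nn_integral_polar[of f "\<lambda>_. 1"] by (simp add: emeasure_unit_ball3)

text \<open>In dimension 3 the radial density adds 2 to the exponent, so integrability at the origin
  means a + 2 > -1.\<close>

lemma nn_integral_norm_powr_ball:
  fixes a R :: real
  assumes "a > -3" "R \<ge> 0"
  shows "(\<integral>\<^sup>+y. ennreal (norm (y::real^3) powr a) * indicator {0..R} (norm y) \<partial>lborel) < \<infinity>"
proof -
  have "(\<integral>\<^sup>+r. ennreal (r powr a) * indicator {0..R} r * ennreal (3 * r\<^sup>2) * indicator {0<..} r \<partial>lborel) \<le>
    (\<integral>\<^sup>+r. 3 * (ennreal (r powr (a + 2)) * indicator {0..R} r) \<partial>lborel)"
  proof (rule nn_integral_mono)
    fix r :: real
    have "ennreal (r powr a) * ennreal (3 * r\<^sup>2) = 3 * ennreal (r powr (a + 2))" if "r > 0"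
      using that by (simp add: ennreal_mult[symmetric] powr_add mult_ac flip: ennreal_numeral)
    then show "ennreal (r powr a) * indicator {0..R} r * ennreal (3 * r\<^sup>2) * indicator {0<..} r
        \<le> 3 * (ennreal (r powr (a + 2)) * indicator {0..R} r)"
      by (simp add: indicator_def)
  qed
  also have "\<dots> < \<infinity>"
    using nn_integral_powr_near_0[of "a + 2" R] assms
    by (subst nn_integral_cmult) (simp_all add: ennreal_mult_less_top)
  finally show ?thesis
    by (subst nn_integral_radial[of "\<lambda>r. ennreal (r powr a) * indicator {0..R} r"])
      (simp_all add: ennreal_mult_less_top)
qed

section \<open>Fourier transform of Gaussian kernels and exchange of integrals\<close>

lemma integral_gaussian_cis_real:
  fixes a x :: real
  assumes a: "a > 0"
  shows "integrable lborel (\<lambda>y. complex_of_real (exp (- a * y\<^sup>2)) * cis (y * x))"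
    and "(LINT y|lborel. complex_of_real (exp (- a * y\<^sup>2)) * cis (y * x)) =
      complex_of_real (sqrt (pi / a) * exp (- x\<^sup>2 / (4 * a)))"
proof -
  \<comment> \<open>The substitution z = c y turns exp (-a y^2) into the standard normal density up
    to a constant, so that the known characteristic function applies.\<close>
  define c where "c = sqrt (2 * a)"
  have c: "c > 0" "c\<^sup>2 = 2 * a" using a by (simp_all add: c_def)
  let ?f = "\<lambda>z. complex_of_real (std_normal_density z) * cis (x / c * z)"
  have i0: "integrable lborel ?f"
  proof (rule Bochner_Integration.integrable_bound)
    show "integrable lborel std_normal_density" by simp
  qed (simp_all add: norm_mult)
  have e0: "(LINT z|lborel. ?f z) = complex_of_real (exp (- ((x / c)\<^sup>2) / 2))"
  proof -
    have "(LINT z|lborel. ?f z) = (LINT z|lborel. std_normal_density z *\<^sub>R cis (x / c * z))"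
      by (simp add: scaleR_conv_of_real)
    also have "\<dots> = (LINT z|std_normal_distribution. cis (x / c * z))"
      by (rule integral_density[symmetric]) simp_all
    also have "\<dots> = char std_normal_distribution (x / c)"
      by (simp add: char_def cis_conv_exp)
    finally show ?thesis by (simp add: char_std_normal_distribution)
  qed
  have eq: "?f (0 + c * y) = complex_of_real (1 / sqrt (2 * pi)) * (complex_of_real (exp (- a * y\<^sup>2)) * cis (y * x))" for y
    using c by (simp add: std_normal_density_def power_mult_distrib mult_ac)
  have i1: "integrable lborel (\<lambda>y. complex_of_real (1 / sqrt (2 * pi)) * (complex_of_real (exp (- a * y\<^sup>2)) * cis (y * x)))"
    using lborel_integrable_real_affine[OF i0, of c 0] c unfolding eq by simp
  have "integrable lborel (\<lambda>y. complex_of_real (sqrt (2 * pi)) * (complex_of_real (1 / sqrt (2 * pi)) * (complex_of_real (exp (- a * y\<^sup>2)) * cis (y * x))))"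
    by (rule integrable_mult_right) (rule i1)
  then show "integrable lborel (\<lambda>y. complex_of_real (exp (- a * y\<^sup>2)) * cis (y * x))"
    by (simp add: field_simps)
  have "complex_of_real (exp (- ((x / c)\<^sup>2) / 2)) = c *\<^sub>R (LINT y|lborel. ?f (0 + c * y))"
    unfolding e0[symmetric] using lborel_integral_real_affine[of c ?f 0] c by simp
  also have "\<dots> = complex_of_real (c / sqrt (2 * pi)) * (LINT y|lborel. complex_of_real (exp (- a * y\<^sup>2)) * cis (y * x))"
    unfolding eq by (simp only: integral_mult_right_zero) (simp add: scaleR_conv_of_real)
  finally have "(LINT y|lborel. complex_of_real (exp (- a * y\<^sup>2)) * cis (y * x)) =
      complex_of_real (sqrt (2 * pi) / c * exp (- ((x / c)\<^sup>2) / 2))"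
    using c by (simp add: field_simps)
  also have "sqrt (2 * pi) / c = sqrt (pi / a)"
    using a by (simp add: c_def real_sqrt_divide[symmetric])
  also have "- ((x / c)\<^sup>2) / 2 = - x\<^sup>2 / (4 * a)"
    using c by (simp add: power_divide)
  finally show "(LINT y|lborel. complex_of_real (exp (- a * y\<^sup>2)) * cis (y * x)) =
      complex_of_real (sqrt (pi / a) * exp (- x\<^sup>2 / (4 * a)))" .
qed

lemma prod_cis: "finite A \<Longrightarrow> (\<Prod>i\<in>A. cis (f i)) = cis (\<Sum>i\<in>A. f i)"
  by (induction A rule: finite_induct) (simp_all add: cis_mult)

lemma exp_norm_prod:
  fixes y :: "'a::euclidean_space"
  shows "(\<Prod>b\<in>Basis. exp (- a * (y \<bullet> b)\<^sup>2)) = exp (- a * (norm y)\<^sup>2)"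
proof -
  have "(\<Sum>b\<in>Basis. - a * (y \<bullet> b)\<^sup>2) = - a * (norm y)\<^sup>2"
    unfolding power2_norm_eq_inner euclidean_inner[of y y]
    by (simp add: sum_distrib_left power2_eq_square flip: sum_negf)
  then show ?thesis by (simp only: exp_sum[symmetric] finite_Basis)
qed

lemma integral_gaussian_cis:
  fixes x :: "real^3"
  assumes a: "a > 0"
  shows "(LINT y|lborel. complex_of_real (exp (- a * (norm y)\<^sup>2)) * cis (y \<bullet> x)) =
      complex_of_real (sqrt (pi / a) ^ 3 * exp (- (norm x)\<^sup>2 / (4 * a)))"
proof -
  interpret product_sigma_finite "\<lambda>_::real^3. lborel :: real measure" ..
  let ?f = "\<lambda>b y. complex_of_real (exp (- a * y\<^sup>2)) * cis (y * (x \<bullet> b))"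
  have split: "complex_of_real (exp (- a * (norm y)\<^sup>2)) * cis (y \<bullet> x) = (\<Prod>b\<in>Basis. ?f b (y \<bullet> b))" for y
    by (simp only: prod.distrib prod_cis[OF finite_Basis] of_real_prod[symmetric] exp_norm_prod euclidean_inner[of y x])
  have "(LINT y|lborel. complex_of_real (exp (- a * (norm y)\<^sup>2)) * cis (y \<bullet> x)) =
     (LINT y|distr (\<Pi>\<^sub>M b\<in>Basis. lborel) borel (\<lambda>f. \<Sum>b\<in>Basis. f b *\<^sub>R b). (\<Prod>b\<in>Basis. ?f b (y \<bullet> b)))"
    unfolding split by (subst lborel_eq) (rule refl)
  also have "\<dots> = (LINT y|(\<Pi>\<^sub>M b\<in>Basis. lborel). (\<Prod>b\<in>Basis. ?f b ((\<Sum>b\<in>Basis. y b *\<^sub>R b) \<bullet> b)))"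
    by (rule integral_distr) simp_all
  also have "\<dots> = (LINT y|(\<Pi>\<^sub>M b\<in>(Basis::(real^3) set). lborel). (\<Prod>b\<in>Basis. ?f b (y b)))"
    by (intro Bochner_Integration.integral_cong prod.cong refl) simp
  also have "\<dots> = (\<Prod>b\<in>Basis. LINT y|lborel. ?f b y)"
    by (rule product_integral_prod) (simp_all only: finite_Basis integral_gaussian_cis_real[OF a])
  also have "\<dots> = (\<Prod>b\<in>Basis. complex_of_real (sqrt (pi / a) * exp (- (x \<bullet> b)\<^sup>2 / (4 * a))))"
    by (simp only: integral_gaussian_cis_real[OF a])
  also have "\<dots> = complex_of_real (\<Prod>b\<in>(Basis::(real^3) set). sqrt (pi / a) * exp (- (1 / (4 * a)) * (x \<bullet> b)\<^sup>2))"
    by simp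
  also have "(\<Prod>b\<in>(Basis::(real^3) set). sqrt (pi / a) * exp (- (1 / (4 * a)) * (x \<bullet> b)\<^sup>2)) =
      sqrt (pi / a) ^ 3 * exp (- (1 / (4 * a)) * (norm x)\<^sup>2)"
    by (simp only: prod.distrib exp_norm_prod) simp
  finally show ?thesis by simp
qed

text \<open>A non-integrable function has Bochner integral 0, but the Gaussian formula at frequency
  0 gives a positive value.\<close>

lemma integrable_gaussian_norm:
  assumes a: "a > 0"
  shows "integrable lborel (\<lambda>y::real^3. exp (- a * (norm y)\<^sup>2))"
proof (rule ccontr)
  assume n: "\<not> ?thesis"
  have "(\<lambda>y::real^3. complex_of_real (exp (- a * (norm y)\<^sup>2)) * cis (y \<bullet> 0)) = (\<lambda>y. complex_of_real (exp (- a * (norm y)\<^sup>2)))"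
    by simp
  then have "(LINT y|lborel. complex_of_real (exp (- a * (norm (y::real^3))\<^sup>2)) * cis (y \<bullet> 0)) = 0"
    using n by (simp only: integral_complex_of_real) (simp add: not_integrable_integral_eq)
  then show False using integral_gaussian_cis[OF a, of 0] a by simp
qed

text \<open>A bounded kernel against a tensor product of integrable functions: in this form every
  exchange of integrals in the Gaussian Parseval identity is justified.\<close>

lemma integrable_pair_bounded:
  fixes f :: "'a::euclidean_space \<Rightarrow> 'c::{real_normed_field,banach,second_countable_topology}"
    and g :: "'b::euclidean_space \<Rightarrow> 'c" and k :: "'a \<Rightarrow> 'b \<Rightarrow> 'c"
  assumes f: "integrable lborel f" and g: "integrable lborel g"
    and [measurable]: "(\<lambda>(x, y). k x y) \<in> borel_measurable (borel \<Otimes>\<^sub>M borel)"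
    and k: "\<And>x y. norm (k x y) \<le> B"
  shows "integrable (lborel \<Otimes>\<^sub>M lborel) (\<lambda>(x, y). f x * g y * k x y)"
proof (rule integrableI_bounded)
  have [measurable]: "f \<in> borel_measurable borel" "g \<in> borel_measurable borel"
    using f g by auto
  show "(\<lambda>(x, y). f x * g y * k x y) \<in> borel_measurable (lborel \<Otimes>\<^sub>M lborel)" by measurable
  have "(\<integral>\<^sup>+z. ennreal (norm ((\<lambda>(x, y). f x * g y * k x y) z)) \<partial>(lborel \<Otimes>\<^sub>M lborel)) \<le>
     (\<integral>\<^sup>+z. ennreal (norm (f (fst z))) * (ennreal (norm (g (snd z))) * ennreal B) \<partial>(lborel \<Otimes>\<^sub>M lborel))"
  proof (rule nn_integral_mono)
    fix z :: "'a \<times> 'b"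
    have "B \<ge> 0" using k[of undefined undefined] norm_ge_zero order_trans by blast
    then show "ennreal (norm ((\<lambda>(x, y). f x * g y * k x y) z)) \<le>
       ennreal (norm (f (fst z))) * (ennreal (norm (g (snd z))) * ennreal B)"
      using k by (auto simp: split_beta norm_mult ennreal_mult[symmetric] mult.assoc intro!: ennreal_leI mult_left_mono)
  qed
  also have "\<dots> = (\<integral>\<^sup>+x. \<integral>\<^sup>+y. ennreal (norm (f x)) * (ennreal (norm (g y)) * ennreal B) \<partial>lborel \<partial>lborel)"
    by (subst lborel.nn_integral_fst[symmetric]) simp_all
  also have "\<dots> = (\<integral>\<^sup>+x. ennreal (norm (f x)) \<partial>lborel) * ((\<integral>\<^sup>+y. ennreal (norm (g y)) \<partial>lborel) * ennreal B)"
    by (simp add: nn_integral_cmult nn_integral_multc)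
  also have "\<dots> < \<infinity>"
    using f g by (auto simp: integrable_iff_bounded ennreal_mult_less_top)
  finally show "(\<integral>\<^sup>+z. ennreal (norm ((\<lambda>(x, y). f x * g y * k x y) z)) \<partial>(lborel \<Otimes>\<^sub>M lborel)) < \<infinity>" .
qed

lemma integral_swap_bounded:
  fixes f :: "'a::euclidean_space \<Rightarrow> 'c::{real_normed_field,banach,second_countable_topology}"
    and g :: "'b::euclidean_space \<Rightarrow> 'c" and k :: "'a \<Rightarrow> 'b \<Rightarrow> 'c"
  assumes f: "integrable lborel f" and g: "integrable lborel g"
    and k: "(\<lambda>(x, y). k x y) \<in> borel_measurable (borel \<Otimes>\<^sub>M borel)" "\<And>x y. norm (k x y) \<le> B"
  shows "(LINT x|lborel. f x * (LINT y|lborel. g y * k x y)) = (LINT y|lborel. g y * (LINT x|lborel. f x * k x y))"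
proof -
  have "(LINT x|lborel. f x * (LINT y|lborel. g y * k x y)) = (LINT x|lborel. LINT y|lborel. f x * g y * k x y)"
    by (simp add: mult.assoc)
  also have "\<dots> = (LINT y|lborel. LINT x|lborel. f x * g y * k x y)"
    by (rule lborel_pair.Fubini_integral[symmetric]) (rule integrable_pair_bounded[OF f g k])
  also have "(\<lambda>y. LINT x|lborel. f x * g y * k x y) = (\<lambda>y. g y * (LINT x|lborel. f x * k x y))"
    by (simp add: mult_ac flip: integral_mult_right_zero)
  finally show ?thesis .
qed

section \<open>The Riesz form on bounded functions of bounded support\<close>

definition riesz_form :: "real \<Rightarrow> (real^3 \<Rightarrow> real) \<Rightarrow> (real^3 \<Rightarrow> real) \<Rightarrow> real" where
  "riesz_form \<beta> f g = (LINT x|lborel. norm x powr (- \<beta>) * (LINT y|lborel. f y * g (y - x)))"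

text \<open>The bound and the radius are explicit parameters so that time slices and finite families
  can share the same constants in dominating functions.\<close>

definition bounded_supp :: "(real^3 \<Rightarrow> real) \<Rightarrow> real \<Rightarrow> real \<Rightarrow> bool" where
  "bounded_supp f B R \<longleftrightarrow> f \<in> borel_measurable borel \<and> 0 \<le> B \<and> 0 \<le> R \<and>
     (\<forall>y. \<bar>f y\<bar> \<le> B * indicator (cball 0 R) y)"

lemma bounded_suppD:
  assumes "bounded_supp f B R"
  shows "f \<in> borel_measurable borel" "0 \<le> B" "0 \<le> R" "\<bar>f y\<bar> \<le> B" "norm y > R \<Longrightarrow> f y = 0"
proof -
  have a: "\<bar>f y\<bar> \<le> B * indicator (cball 0 R) y" for y using assms by (simp add: bounded_supp_def)
  show "f \<in> borel_measurable borel" "0 \<le> B" "0 \<le> R" using assms by (simp_all add: bounded_supp_def)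
  then show "\<bar>f y\<bar> \<le> B" using a[of y] by (cases "norm y \<le> R") simp_all
  show "norm y > R \<Longrightarrow> f y = 0" using a[of y] by (simp add: indicator_def)
qed

lemma integrable_cball_indicator: "integrable lborel (\<lambda>y::real^3. B * indicator (cball 0 R) y :: real)"
  using emeasure_bounded_finite[of "cball (0::real^3) R"] by (intro integrable_mult_right integrable_real_indicator) simp_all

lemma bounded_supp_integrable:
  assumes "bounded_supp f B R"
  shows "integrable lborel f"
proof (rule Bochner_Integration.integrable_bound[OF integrable_cball_indicator[of B R]])
  show "AE y in lborel. norm (f y) \<le> norm (B * indicator (cball 0 R) y)"
    using assms by (intro AE_I2) (auto simp: bounded_supp_def abs_mult)
qed (use assms in \<open>simp add: bounded_supp_def\<close>)

text \<open>A nonzero product f(y) g(y - x) forces |y| \<le> R and |y - x| \<le> R, hence |x| \<le>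
  2R.\<close>

lemma bounded_supp_autocorrelation:
  assumes f: "bounded_supp f B R" and g: "bounded_supp g B' R"
  shows "(\<lambda>x. LINT y|lborel. f y * g (y - x)) \<in> borel_measurable borel"
    and "integrable lborel (\<lambda>y. f y * g (y - x))"
    and "\<bar>LINT y|lborel. f y * g (y - x)\<bar> \<le> B * B' * measure lborel (cball (0::real^3) R) * indicator (cball 0 (2 * R)) x"
proof -
  note [measurable] = bounded_suppD(1)[OF f] bounded_suppD(1)[OF g]
  show "(\<lambda>x. LINT y|lborel. f y * g (y - x)) \<in> borel_measurable borel" by measurable
  have bd: "\<bar>f y * g (y - x)\<bar> \<le> B * B' * indicator (cball 0 R) y" for x y
  proof -
    have "\<bar>f y\<bar> * \<bar>g (y - x)\<bar> \<le> B * indicator (cball 0 R) y * B'"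
      using f bounded_suppD(2)[OF f] bounded_suppD(4)[OF g]
      by (intro mult_mono) (simp_all add: bounded_supp_def)
    then show ?thesis by (simp add: abs_mult mult_ac)
  qed
  show i: "integrable lborel (\<lambda>y. f y * g (y - x))"
    by (rule Bochner_Integration.integrable_bound[OF integrable_cball_indicator[of "B * B'" R]])
      (use bd bounded_suppD(2)[OF f] bounded_suppD(2)[OF g] in \<open>auto simp: abs_mult\<close>)
  show "\<bar>LINT y|lborel. f y * g (y - x)\<bar> \<le> B * B' * measure lborel (cball (0::real^3) R) * indicator (cball 0 (2 * R)) x"
  proof (cases "norm x \<le> 2 * R")
    case True
    have "\<bar>LINT y|lborel. f y * g (y - x)\<bar> \<le> (LINT y|lborel. \<bar>f y * g (y - x)\<bar>)"
      by (rule integral_abs_bound)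
    also have "\<dots> \<le> (LINT y|lborel. B * B' * indicator (cball (0::real^3) R) y)"
      by (rule integral_mono[OF integrable_abs[OF i] integrable_cball_indicator]) (use bd in simp)
    also have "\<dots> = B * B' * measure lborel (cball (0::real^3) R)" by simp
    finally show ?thesis using True by simp
  next
    case False
    have z: "f y * g (y - x) = 0" for y
    proof (cases "norm y \<le> R")
      case True
      then have "norm (y - x) > R" using False norm_triangle_ineq2[of x y] by (simp add: norm_minus_commute)
      then show ?thesis using bounded_suppD(5)[OF g] by simp
    qed (use bounded_suppD(5)[OF f] in simp)
    show ?thesis unfolding z using False by simp
  qed
qed

lemma integrable_riesz_kernel:
  assumes b: "\<beta> < 3" and [measurable]: "D \<in> borel_measurable borel"
    and D: "\<And>x::real^3. \<bar>D x\<bar> \<le> K * indicator (cball 0 R) x" and "R \<ge> 0"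
  shows "integrable lborel (\<lambda>x. norm x powr (- \<beta>) * D x)"
proof (rule integrableI_bounded)
  have K: "K \<ge> 0" using D[of 0] \<open>R \<ge> 0\<close> by simp
  have "(\<integral>\<^sup>+x. ennreal (norm (norm x powr (- \<beta>) * D x)) \<partial>lborel) \<le>
      (\<integral>\<^sup>+x. ennreal K * (ennreal (norm (x::real^3) powr (- \<beta>)) * indicator {0..R} (norm x)) \<partial>lborel)"
  proof (rule nn_integral_mono)
    fix x :: "real^3"
    show "ennreal (norm (norm x powr (- \<beta>) * D x)) \<le> ennreal K * (ennreal (norm x powr (- \<beta>)) * indicator {0..R} (norm x))"
      using D[of x] K by (auto simp: indicator_def ennreal_mult[symmetric] abs_mult mult.commute intro!: ennreal_leI mult_right_mono)
  qed
  also have "\<dots> = ennreal K * (\<integral>\<^sup>+x. (ennreal (norm (x::real^3) powr (- \<beta>)) * indicator {0..R} (norm x)) \<partial>lborel)"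
    by (rule nn_integral_cmult) measurable
  also have "\<dots> < \<infinity>"
    using nn_integral_norm_powr_ball[of "-\<beta>" R] b \<open>R \<ge> 0\<close> by (simp add: ennreal_mult_less_top)
  finally show "(\<integral>\<^sup>+x. ennreal (norm (norm x powr (- \<beta>) * D x)) \<partial>lborel) < \<infinity>" .
qed simp

lemma lborel_distr_reflect: "distr lborel borel (\<lambda>x. a - x) = (lborel :: 'a::euclidean_space measure)"
proof (rule measure_eqI)
  fix A :: "'a set" assume "A \<in> sets (distr lborel borel (\<lambda>x. a - x))"
  then have A: "A \<in> sets borel" by simp
  have "(\<integral>\<^sup>+x. indicator A (a - x) \<partial>lborel) = emeasure lborel A"
    using A by (subst nn_integral_lborel_reflect) (auto intro: borel_measurable_indicator)
  moreover have "(\<lambda>x. indicator A (a - x) :: ennreal) = indicator ((\<lambda>x. a - x) -` A)"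
    by (auto simp: indicator_def)
  ultimately show "emeasure (distr lborel borel (\<lambda>x. a - x)) A = emeasure lborel A"
    using A measurable_sets[of "\<lambda>x. a - x" borel borel A] by (simp add: emeasure_distr nn_integral_indicator)
qed simp

lemma integral_lborel_reflect:
  fixes f :: "'a::euclidean_space \<Rightarrow> 'b::{banach,second_countable_topology}"
  assumes [measurable]: "f \<in> borel_measurable borel"
  shows "(LINT x|lborel. f (a - x)) = (LINT x|lborel. f x)"
  by (subst (2) lborel_distr_reflect[of a, symmetric]) (simp add: integral_distr)

lemma fourier_eq: "fourier f \<xi> = (LINT y|lborel. complex_of_real (f y) * cis (- (\<xi> \<bullet> y)))"
  by (simp add: fourier_def mult.commute)

lemma fourier_measurable_param:
  assumes [measurable]: "(\<lambda>(x, y). f x y) \<in> borel_measurable (M \<Otimes>\<^sub>M borel)"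
  shows "(\<lambda>(x, \<xi>). fourier (f x) \<xi>) \<in> borel_measurable (M \<Otimes>\<^sub>M borel)"
  unfolding fourier_def by measurable

lemma fourier_measurable [measurable]:
  assumes [measurable]: "f \<in> borel_measurable borel"
  shows "fourier f \<in> borel_measurable borel"
  unfolding fourier_def[abs_def] by measurable

lemma fourier_bound:
  assumes "integrable lborel f"
  shows "cmod (fourier f \<xi>) \<le> (LINT y|lborel. \<bar>f y\<bar>)"
proof -
  have "cmod (fourier f \<xi>) \<le> (LINT y|lborel. cmod (cis (- (\<xi> \<bullet> y)) * complex_of_real (f y)))"
    unfolding fourier_def by (rule integral_norm_bound)
  then show ?thesis by (simp add: norm_mult)
qed

text \<open>The squared modulus is the transform times its conjugate, and exchanges of integrals
  move the Gaussian weight onto its own Fourier transform, again a Gaussian. What remains is the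
  autocorrelation of f integrated against that Gaussian.\<close>

lemma gaussian_parseval:
  assumes f: "bounded_supp f B R" and r: "r > 0"
  shows "(LINT \<xi>|lborel. exp (- (1 / (4 * r)) * (norm \<xi>)\<^sup>2) * (cmod (fourier f \<xi>))\<^sup>2) =
    sqrt (4 * pi * r) ^ 3 * (LINT x|lborel. exp (- r * (norm x)\<^sup>2) * (LINT y|lborel. f y * f (y - x)))"
proof -
  \<comment> \<open>With this choice the transform of the weight has the profile exp (-|x|^2 / (4a))
    = exp (-r|x|^2), and the constant sqrt (pi / a) equals sqrt (4 pi r).\<close>
  define a where "a = 1 / (4 * r)"
  have a: "a > 0" using r by (simp add: a_def)
  note [measurable] = bounded_suppD(1)[OF f]
  define E where "E \<xi> = complex_of_real (exp (- a * (norm \<xi>)\<^sup>2))" for \<xi> :: "real^3"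
  define g where "g y = complex_of_real (f y)" for y
  define G where "G x = complex_of_real (sqrt (4 * pi * r) ^ 3 * exp (- r * (norm x)\<^sup>2))" for x :: "real^3"
  have [measurable]: "E \<in> borel_measurable borel" "g \<in> borel_measurable borel" "G \<in> borel_measurable borel"
    unfolding E_def[abs_def] g_def[abs_def] G_def[abs_def] by measurable
  have iE: "integrable lborel E" unfolding E_def using integrable_gaussian_norm[OF a] by simp
  have ig: "integrable lborel g" unfolding g_def using bounded_supp_integrable[OF f] by simp
  have iG: "integrable lborel G"
    unfolding G_def using integrable_gaussian_norm[OF r] by (simp del: of_real_mult)
  have F: "fourier f \<xi> = (LINT y|lborel. g y * cis (- (\<xi> \<bullet> y)))" for \<xi>
    by (simp add: fourier_eq g_def)
  have cF: "cnj (fourier f \<xi>) = (LINT y|lborel. g y * cis (\<xi> \<bullet> y))" for \<xi>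
  proof -
    have "cnj (fourier f \<xi>) = (LINT y|lborel. cnj (g y * cis (- (\<xi> \<bullet> y))))"
      unfolding F by (rule Bochner_Integration.integral_cnj[symmetric])
    also have "(\<lambda>y. cnj (g y * cis (- (\<xi> \<bullet> y)))) = (\<lambda>y. g y * cis (\<xi> \<bullet> y))"
      by (simp only: complex_cnj_mult cis_cnj) (simp add: g_def)
    finally show ?thesis .
  qed
  have iEF: "integrable lborel (\<lambda>\<xi>. E \<xi> * cnj (fourier f \<xi>))"
  proof (rule Bochner_Integration.integrable_bound[OF integrable_mult_right[of "complex_of_real (LINT y|lborel. \<bar>f y\<bar>)" lborel E]])
    have m: "(\<lambda>\<xi>. cnj (fourier f \<xi>)) \<in> borel_measurable borel"
      unfolding cF by measurable
    show "(\<lambda>\<xi>. E \<xi> * cnj (fourier f \<xi>)) \<in> borel_measurable lborel" using m by simp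
    show "AE \<xi> in lborel. norm (E \<xi> * cnj (fourier f \<xi>)) \<le> norm (complex_of_real (LINT y|lborel. \<bar>f y\<bar>) * E \<xi>)"
    proof (rule AE_I2)
      fix \<xi>
      have "norm (E \<xi>) * norm (fourier f \<xi>) \<le> norm (E \<xi>) * (LINT y|lborel. \<bar>f y\<bar>)"
        by (rule mult_left_mono[OF fourier_bound[OF bounded_supp_integrable[OF f]] norm_ge_zero])
      then show "norm (E \<xi> * cnj (fourier f \<xi>)) \<le> norm (complex_of_real (LINT y|lborel. \<bar>f y\<bar>) * E \<xi>)"
        by (simp add: norm_mult mult.commute)
    qed
  qed (use iE in simp)
  have inner: "(LINT \<xi>|lborel. E \<xi> * cnj (fourier f \<xi>) * cis (- (\<xi> \<bullet> y))) = (LINT x|lborel. G x * g (y - x))" for y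
  proof -
    have "(LINT \<xi>|lborel. E \<xi> * cnj (fourier f \<xi>) * cis (- (\<xi> \<bullet> y))) =
       (LINT \<xi>|lborel. (E \<xi> * cis (- (\<xi> \<bullet> y))) * (LINT z|lborel. g z * cis (\<xi> \<bullet> z)))"
      unfolding cF by (simp add: mult_ac)
    also have "\<dots> = (LINT z|lborel. g z * (LINT \<xi>|lborel. (E \<xi> * cis (- (\<xi> \<bullet> y))) * cis (\<xi> \<bullet> z)))"
    proof (rule integral_swap_bounded[where B=1])
      show "integrable lborel (\<lambda>\<xi>. E \<xi> * cis (- (\<xi> \<bullet> y)))"
        by (rule Bochner_Integration.integrable_bound[OF iE]) (simp_all add: norm_mult)
    qed (use ig in simp_all)
    also have "(\<lambda>z. LINT \<xi>|lborel. (E \<xi> * cis (- (\<xi> \<bullet> y))) * cis (\<xi> \<bullet> z)) = (\<lambda>z. G (z - y))"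
    proof
      fix z
      have "(LINT \<xi>|lborel. (E \<xi> * cis (- (\<xi> \<bullet> y))) * cis (\<xi> \<bullet> z)) = (LINT \<xi>|lborel. E \<xi> * cis (\<xi> \<bullet> (z - y)))"
        by (simp add: mult.assoc cis_mult inner_diff_right)
      then show "(LINT \<xi>|lborel. (E \<xi> * cis (- (\<xi> \<bullet> y))) * cis (\<xi> \<bullet> z)) = G (z - y)"
        using r unfolding E_def integral_gaussian_cis[OF a] G_def by (simp add: a_def mult_ac)
    qed
    \<comment> \<open>The reflection z = y - x, together with evenness of \<open>G\<close>, brings
      the convolution into the form that leads to the autocorrelation.\<close>
    also have "(LINT z|lborel. g z * G (z - y)) = (LINT x|lborel. g (y - x) * G (y - x - y))"
      by (rule integral_lborel_reflect[symmetric, where a=y]) measurable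
    finally show ?thesis by (simp add: G_def mult.commute)
  qed
  have "complex_of_real (LINT \<xi>|lborel. exp (- a * (norm \<xi>)\<^sup>2) * (cmod (fourier f \<xi>))\<^sup>2) =
      (LINT \<xi>|lborel. (E \<xi> * cnj (fourier f \<xi>)) * (LINT y|lborel. g y * cis (- (\<xi> \<bullet> y))))"
    unfolding integral_complex_of_real[symmetric] F[symmetric]
    by (intro Bochner_Integration.integral_cong refl)
      (simp add: E_def complex_norm_square[unfolded of_real_power] mult_ac)
  also have "\<dots> = (LINT y|lborel. g y * (LINT \<xi>|lborel. (E \<xi> * cnj (fourier f \<xi>)) * cis (- (\<xi> \<bullet> y))))"
    by (rule integral_swap_bounded[OF iEF ig, where B=1]) simp_all
  also have "\<dots> = (LINT y|lborel. g y * (LINT x|lborel. G x * g (y - x)))"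
    unfolding inner ..
  also have "\<dots> = (LINT x|lborel. G x * (LINT y|lborel. g y * g (y - x)))"
    by (rule integral_swap_bounded[OF ig iG, where B=B]) (use bounded_suppD(4)[OF f] in \<open>simp_all add: g_def\<close>)
  also have "\<dots> = complex_of_real (LINT x|lborel. sqrt (4 * pi * r) ^ 3 * exp (- r * (norm x)\<^sup>2) * (LINT y|lborel. f y * f (y - x)))"
    unfolding integral_complex_of_real[symmetric] G_def g_def by (simp only: of_real_mult[symmetric] integral_complex_of_real)
  finally show ?thesis unfolding of_real_eq_iff a_def by (simp only: mult.assoc integral_mult_right_zero)
qed

section \<open>Gamma-type mixing integrals\<close>

lemma nn_integral_gamma_scale:
  fixes b l :: real
  assumes l: "l > 0"
  shows "(\<integral>\<^sup>+r. ennreal (r powr (b - 1) * exp (- r * l)) * indicator {0<..} r \<partial>lborel) =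
    ennreal (l powr (- b)) * (\<integral>\<^sup>+r. ennreal (r powr (b - 1) * exp (- r)) * indicator {0<..} r \<partial>lborel)"
proof -
  have "(\<integral>\<^sup>+r. ennreal (r powr (b - 1) * exp (- r * l)) * indicator {0<..} r \<partial>lborel) =
    \<bar>1 / l\<bar> * (\<integral>\<^sup>+r. ennreal ((0 + 1 / l * r) powr (b - 1) * exp (- (0 + 1 / l * r) * l)) * indicator {0<..} (0 + 1 / l * r) \<partial>lborel)"
    using l by (intro nn_integral_real_affine) simp_all
  also have "\<dots> = \<bar>1 / l\<bar> * (\<integral>\<^sup>+r. ennreal (l powr (1 - b)) * (ennreal (r powr (b - 1) * exp (- r)) * indicator {0<..} r) \<partial>lborel)"
  proof (intro arg_cong[where f="(*) _"] nn_integral_cong)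
    fix r :: real
    have "(r / l) powr (b - 1) = l powr (1 - b) * r powr (b - 1)" if "r > 0"
      using that l powr_minus_divide[of l "b - 1"] by (simp add: powr_divide)
    then show "ennreal ((0 + 1 / l * r) powr (b - 1) * exp (- (0 + 1 / l * r) * l)) * indicator {0<..} (0 + 1 / l * r) =
       ennreal (l powr (1 - b)) * (ennreal (r powr (b - 1) * exp (- r)) * indicator {0<..} r)"
      using l by (auto simp: indicator_def ennreal_mult[symmetric] mult_ac zero_less_divide_iff)
  qed
  also have "\<dots> = \<bar>1 / l\<bar> * (ennreal (l powr (1 - b)) * (\<integral>\<^sup>+r. (ennreal (r powr (b - 1) * exp (- r)) * indicator {0<..} r) \<partial>lborel))"
    by (subst nn_integral_cmult) simp_all
  also have "\<dots> = ennreal (l powr (- b)) * (\<integral>\<^sup>+r. ennreal (r powr (b - 1) * exp (- r)) * indicator {0<..} r \<partial>lborel)"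
    using l powr_add[of l "-1" "1 - b"] by (simp add: mult.assoc[symmetric] ennreal_mult[symmetric] powr_minus_divide)
  finally show ?thesis .
qed

text \<open>The exponent b - 5/2 is b - 1 lowered by the 3/2 that the Gaussian Parseval constant
  contributes. Substituting l r for r yields l^(b-3/2), which is |\<xi>|^(\<beta>-3) for l =
  |\<xi>|^2 and b = \<beta>/2.\<close>

lemma nn_integral_inverse_gamma_scale:
  fixes b l :: real
  assumes l: "l > 0"
  shows "(\<integral>\<^sup>+r. ennreal (r powr (b - 5/2) * exp (- l / (4 * r))) * indicator {0<..} r \<partial>lborel) =
    ennreal (l powr (b - 3/2)) * (\<integral>\<^sup>+r. ennreal (r powr (b - 5/2) * exp (- 1 / (4 * r))) * indicator {0<..} r \<partial>lborel)"
proof -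
  have "(\<integral>\<^sup>+r. ennreal (r powr (b - 5/2) * exp (- l / (4 * r))) * indicator {0<..} r \<partial>lborel) =
    \<bar>l\<bar> * (\<integral>\<^sup>+r. ennreal ((0 + l * r) powr (b - 5/2) * exp (- l / (4 * (0 + l * r)))) * indicator {0<..} (0 + l * r) \<partial>lborel)"
    using l by (intro nn_integral_real_affine) simp_all
  also have "\<dots> = \<bar>l\<bar> * (\<integral>\<^sup>+r. ennreal (l powr (b - 5/2)) * (ennreal (r powr (b - 5/2) * exp (- 1 / (4 * r))) * indicator {0<..} r) \<partial>lborel)"
  proof (intro arg_cong[where f="(*) _"] nn_integral_cong)
    fix r :: real
    have "(l * r) powr (b - 5/2) = l powr (b - 5/2) * r powr (b - 5/2)" if "r > 0"
      using that l by (simp add: powr_mult)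
    then show "ennreal ((0 + l * r) powr (b - 5/2) * exp (- l / (4 * (0 + l * r)))) * indicator {0<..} (0 + l * r) =
       ennreal (l powr (b - 5/2)) * (ennreal (r powr (b - 5/2) * exp (- 1 / (4 * r))) * indicator {0<..} r)"
      using l by (auto simp: indicator_def ennreal_mult[symmetric] mult_ac zero_less_mult_iff)
  qed
  also have "\<dots> = \<bar>l\<bar> * (ennreal (l powr (b - 5/2)) * (\<integral>\<^sup>+r. (ennreal (r powr (b - 5/2) * exp (- 1 / (4 * r))) * indicator {0<..} r) \<partial>lborel))"
    by (subst nn_integral_cmult) simp_all
  also have "\<dots> = ennreal (l powr (b - 3/2)) * (\<integral>\<^sup>+r. ennreal (r powr (b - 5/2) * exp (- 1 / (4 * r))) * indicator {0<..} r \<partial>lborel)"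
  proof -
    have "l * l powr (b - 5/2) = l powr (b - 3/2)"
      using l powr_add[of l 1 "b - 5/2"] by simp
    then show ?thesis using l by (simp add: mult.assoc[symmetric] ennreal_mult[symmetric])
  qed
  finally show ?thesis .
qed

text \<open>Gives strict positivity of the mixing constants, hence of the constant in the Riesz
  Parseval identity: a vanishing integral would make the interval (0,1) a null set.\<close>

lemma nn_integral_pos_half_line:
  fixes f :: "real \<Rightarrow> real"
  assumes [measurable]: "f \<in> borel_measurable borel" and "\<And>r. r > 0 \<Longrightarrow> f r > 0"
  shows "0 < (\<integral>\<^sup>+r. ennreal (f r) * indicator {0<..} r \<partial>lborel)"
proof (rule ccontr)
  assume "\<not> ?thesis"
  then have "(\<integral>\<^sup>+r. ennreal (f r) * indicator {0<..} r \<partial>lborel) = 0" by simp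
  then have "AE r in lborel. ennreal (f r) * indicator {0<..} r = 0"
    by (subst (asm) nn_integral_0_iff_AE) simp_all
  then have "AE r in lborel. r \<notin> {0<..<1::real}"
    by (rule eventually_mono) (use assms(2) in \<open>fastforce simp: indicator_def split: if_splits\<close>)
  then have "emeasure lborel {0<..<1::real} = 0"
    by (subst (asm) AE_iff_measurable[where N="{0<..<1}"]) auto
  then show False by simp
qed

lemma gamma_nn_integral_finite:
  assumes b: "b > 0"
  shows "(\<integral>\<^sup>+r. ennreal (r powr (b - 1) * exp (- r)) * indicator {0<..} r \<partial>lborel) < \<infinity>"
proof -
  have "((\<lambda>t. t powr (b - 1) / exp t) has_integral Gamma b) {0..}"
    by (rule Gamma_integral_real[OF b])
  from nn_integral_has_integral_lebesgue'[OF _ this]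
  have "(\<integral>\<^sup>+x. ennreal (x powr (b - 1) / exp x) * indicator {0..} x \<partial>lborel) < \<infinity>" by simp
  moreover have "(\<integral>\<^sup>+r. ennreal (r powr (b - 1) * exp (- r)) * indicator {0<..} r \<partial>lborel) \<le>
     (\<integral>\<^sup>+x. ennreal (x powr (b - 1) / exp x) * indicator {0..} x \<partial>lborel)"
    by (intro nn_integral_mono) (auto simp: indicator_def exp_minus field_simps)
  ultimately show ?thesis by (rule le_less_trans[rotated])
qed

text \<open>At infinity the power b - 5/2 lies below -1. At the origin the exponential is traded for
  a power: exp (-v) \<le> 2 / v^2 with v = 1 / (4r) gives 32 r^2, which lifts the exponent to b -
  1/2 > -1.\<close>

lemma inverse_gamma_nn_integral_finite:
  assumes b: "0 < b" "b < 1"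
  shows "(\<integral>\<^sup>+r. ennreal (r powr (b - 5/2) * exp (- 1 / (4 * r))) * indicator {0<..} r \<partial>lborel) < \<infinity>"
proof -
  have "(\<integral>\<^sup>+r. ennreal (r powr (b - 5/2) * exp (- 1 / (4 * r))) * indicator {0<..} r \<partial>lborel) \<le>
    (\<integral>\<^sup>+r. 32 * (ennreal (r powr (b - 1/2)) * indicator {0..1} r) + ennreal (r powr (b - 5/2)) * indicator {1..} r \<partial>lborel)"
  proof (rule nn_integral_mono)
    fix r :: real
    consider "r \<le> 0" | "0 < r" "r < 1" | "r \<ge> 1" by linarith
    then show "ennreal (r powr (b - 5/2) * exp (- 1 / (4 * r))) * indicator {0<..} r \<le>
        32 * (ennreal (r powr (b - 1/2)) * indicator {0..1} r) + ennreal (r powr (b - 5/2)) * indicator {1..} r"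
    proof cases
      case 2
      define v where "v = 1 / (4 * r)"
      have v: "v > 0" using 2 by (simp add: v_def)
      have "v\<^sup>2 / 2 \<le> exp v"
        using exp_lower_Taylor_quadratic[of v] v by simp
      then have "exp (- v) \<le> 2 / v\<^sup>2"
        using v by (simp add: exp_minus field_simps)
      also have "2 / v\<^sup>2 = 32 * r powr 2"
        using 2 by (simp add: v_def field_simps)
      finally have "r powr (b - 5/2) * exp (- v) \<le> r powr (b - 5/2) * (32 * r powr 2)"
        by (intro mult_left_mono) simp_all
      also have "\<dots> = 32 * r powr (b - 1/2)"
        by (simp flip: powr_add)
      finally have "ennreal (r powr (b - 5/2) * exp (- 1 / (4 * r))) \<le> 32 * ennreal (r powr (b - 1/2))"
        by (simp add: v_def ennreal_mult'[symmetric] ennreal_leI flip: ennreal_numeral)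
      then show ?thesis using 2 by simp
    next
      case 3
      then have "ennreal (r powr (b - 5/2) * exp (- 1 / (4 * r))) \<le> ennreal (r powr (b - 5/2))"
        by (intro ennreal_leI mult_left_le) simp_all
      then show ?thesis using 3 by (intro add_increasing) simp_all
    qed simp
  qed
  also have "\<dots> = 32 * (\<integral>\<^sup>+r. (ennreal (r powr (b - 1/2)) * indicator {0..1} r) \<partial>lborel) +
     (\<integral>\<^sup>+r. ennreal (r powr (b - 5/2)) * indicator {1..} r \<partial>lborel)"
    by (subst nn_integral_add) (simp_all add: nn_integral_cmult)
  also have "\<dots> < \<infinity>"
    using nn_integral_powr_near_0[of "b - 1/2" 1] nn_integral_powr_to_inf[of "b - 5/2" 1] b
    by (simp add: ennreal_mult_less_top)
  finally show ?thesis .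
qed

lemma spectral_const_pos: "0 < \<beta> \<Longrightarrow> \<beta> < 3 \<Longrightarrow> spectral_const \<beta> > 0"
  unfolding spectral_const_def by (simp add: Gamma_real_pos)

lemma nn_integral_spectral_measure:
  assumes [measurable]: "f \<in> borel_measurable borel" and b: "0 < \<beta>" "\<beta> < 3"
  shows "(\<integral>\<^sup>+\<xi>. f \<xi> \<partial>spectral_measure \<beta>) =
    ennreal (spectral_const \<beta>) * (\<integral>\<^sup>+\<xi>. ennreal (norm \<xi> powr (\<beta> - 3)) * f \<xi> \<partial>lborel)"
proof -
  have "(\<integral>\<^sup>+\<xi>. f \<xi> \<partial>spectral_measure \<beta>) = (\<integral>\<^sup>+\<xi>. ennreal (spectral_const \<beta> * norm \<xi> powr (\<beta> - 3)) * f \<xi> \<partial>lborel)"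
    unfolding spectral_measure_def by (rule nn_integral_density) simp_all
  also have "\<dots> = (\<integral>\<^sup>+\<xi>. ennreal (spectral_const \<beta>) * (ennreal (norm \<xi> powr (\<beta> - 3)) * f \<xi>) \<partial>lborel)"
    using spectral_const_pos[OF b] by (simp add: ennreal_mult mult.assoc)
  also have "\<dots> = ennreal (spectral_const \<beta>) * (\<integral>\<^sup>+\<xi>. ennreal (norm \<xi> powr (\<beta> - 3)) * f \<xi> \<partial>lborel)"
    by (rule nn_integral_cmult) simp
  finally show ?thesis .
qed

text \<open>
  The Riesz kernel is a mixture of Gaussians, \<open>|x| powr (-\<beta>) = c \<integral> r powr (\<beta>/2-1) exp (-r|x|\<^sup>2) dr\<close>,
  so Parseval's identity for it is integrated from the Gaussian one. The constant is left
  unidentified: only its existence and positivity matter.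
\<close>

lemma riesz_parseval:
  assumes b: "0 < \<beta>" "\<beta> < 2"
  obtains C where "C > 0"
    "\<And>f B R. bounded_supp f B R \<Longrightarrow> 0 \<le> riesz_form \<beta> f f"
    "\<And>f B R. bounded_supp f B R \<Longrightarrow> ennreal (riesz_form \<beta> f f) =
       ennreal C * (\<integral>\<^sup>+\<xi>. ennreal ((cmod (fourier f \<xi>))\<^sup>2) \<partial>spectral_measure \<beta>)"
proof -
  define c where "c = \<beta> / 2"
  have c: "0 < c" "c < 1" using b by (simp_all add: c_def)
  define k1 where "k1 = enn2real (\<integral>\<^sup>+r. ennreal (r powr (c - 1) * exp (- r)) * indicator {0<..} r \<partial>lborel)"
  define k2 where "k2 = enn2real (\<integral>\<^sup>+r. ennreal (r powr (c - 5/2) * exp (- 1 / (4 * r))) * indicator {0<..} r \<partial>lborel)"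
  have K1: "(\<integral>\<^sup>+r. ennreal (r powr (c - 1) * exp (- r)) * indicator {0<..} r \<partial>lborel) = ennreal k1" "k1 > 0"
    using gamma_nn_integral_finite[OF c(1)] nn_integral_pos_half_line[of "\<lambda>r. r powr (c - 1) * exp (- r)"]
    by (simp_all add: k1_def enn2real_positive_iff)
  have K2: "(\<integral>\<^sup>+r. ennreal (r powr (c - 5/2) * exp (- 1 / (4 * r))) * indicator {0<..} r \<partial>lborel) = ennreal k2" "k2 > 0"
    using inverse_gamma_nn_integral_finite[OF c] nn_integral_pos_half_line[of "\<lambda>r. r powr (c - 5/2) * exp (- 1 / (4 * r))"]
    by (simp_all add: k2_def enn2real_positive_iff)
  \<comment> \<open>This normalises the Gaussian factor: sqrt (4 pi r)^3 = r^(3/2) / q.\<close>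
  define q where "q = 1 / sqrt (4 * pi) ^ 3"
  have q: "q > 0" by (simp add: q_def)
  define s where "s = spectral_const \<beta>"
  have s: "s > 0" unfolding s_def using spectral_const_pos b by simp
  have main: "0 \<le> riesz_form \<beta> f f \<and> ennreal (k1 * riesz_form \<beta> f f) =
      ennreal (q * k2) * (\<integral>\<^sup>+\<xi>. ennreal (norm \<xi> powr (\<beta> - 3)) * ennreal ((cmod (fourier f \<xi>))\<^sup>2) \<partial>lborel)"
    if f: "bounded_supp f B R" for f B R
  proof -
    note [measurable] = bounded_suppD(1)[OF f]
    define D where "D x = (LINT y|lborel. f y * f (y - x))" for x
    have [measurable]: "D \<in> borel_measurable borel"
      unfolding D_def[abs_def] by (rule bounded_supp_autocorrelation(1)[OF f f])
    have iD: "integrable lborel (\<lambda>x. norm x powr (- \<beta>) * D x)"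
      by (rule integrable_riesz_kernel[where K="B * B * measure lborel (cball (0::real^3) R)" and R="2 * R"])
        (use b bounded_suppD(3)[OF f] bounded_supp_autocorrelation(3)[OF f f] in \<open>simp_all add: D_def\<close>)
    \<comment> \<open>The mixing density is extended by 0 to the whole line, so that Fubini's
      theorem applies to \<open>lborel\<close> in both variables.\<close>
    define w where "w r = indicator {0<..} r * r powr (c - 1)" for r :: real
    have w0: "w r \<ge> 0" for r by (simp add: w_def)
    have [measurable]: "w \<in> borel_measurable borel" unfolding w_def[abs_def] by measurable
    have sub: "(\<integral>\<^sup>+r. ennreal (w r * exp (- r * (norm x)\<^sup>2)) \<partial>lborel) = ennreal (k1 * norm x powr (- \<beta>))" if "x \<noteq> 0" for x :: "real^3"
    proof -
      have "(\<integral>\<^sup>+r. ennreal (w r * exp (- r * (norm x)\<^sup>2)) \<partial>lborel) =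
        (\<integral>\<^sup>+r. ennreal (r powr (c - 1) * exp (- r * (norm x)\<^sup>2)) * indicator {0<..} r \<partial>lborel)"
        by (intro nn_integral_cong) (simp add: w_def indicator_def)
      also have "\<dots> = ennreal (((norm x)\<^sup>2) powr (- c)) * ennreal k1"
        using that by (subst nn_integral_gamma_scale) (simp_all add: K1)
      also have "((norm x)\<^sup>2) powr (- c) = norm x powr (- \<beta>)"
        using that by (simp add: c_def powr_powr flip: powr_numeral)
      finally show ?thesis using K1(2) by (simp add: ennreal_mult[symmetric] mult.commute)
    qed
    \<comment> \<open>The autocorrelation \<open>D\<close> may change sign, so absolute
      integrability on the product has to precede the exchange of integrals.\<close>
    have int2: "integrable (lborel \<Otimes>\<^sub>M lborel) (\<lambda>(x, r). w r * exp (- r * (norm x)\<^sup>2) * D x)"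
    proof (rule integrableI_bounded)
      have "(\<integral>\<^sup>+z. ennreal (norm ((\<lambda>(x, r). w r * exp (- r * (norm x)\<^sup>2) * D x) z)) \<partial>(lborel \<Otimes>\<^sub>M lborel)) =
        (\<integral>\<^sup>+x. \<integral>\<^sup>+r. ennreal \<bar>D x\<bar> * ennreal (w r * exp (- r * (norm x)\<^sup>2)) \<partial>lborel \<partial>lborel)"
        by (subst lborel.nn_integral_fst[symmetric])
          (auto intro!: nn_integral_cong simp: abs_mult ennreal_mult[symmetric] w0 mult_ac)
      also have "\<dots> = (\<integral>\<^sup>+x. ennreal k1 * ennreal (norm (norm x powr (- \<beta>) * D x)) \<partial>lborel)"
      proof (rule nn_integral_cong_AE, rule eventually_mono[OF AE_lborel_singleton[of 0]])
        fix x :: "real^3" assume "x \<noteq> 0"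
        then show "(\<integral>\<^sup>+r. ennreal \<bar>D x\<bar> * ennreal (w r * exp (- r * (norm x)\<^sup>2)) \<partial>lborel) =
            ennreal k1 * ennreal (norm (norm x powr (- \<beta>) * D x))"
          using K1(2) by (subst nn_integral_cmult, measurable, subst sub)
            (simp_all add: ennreal_mult[symmetric] abs_mult mult_ac)
      qed
      also have "\<dots> = ennreal k1 * (\<integral>\<^sup>+x. ennreal (norm (norm x powr (- \<beta>) * D x)) \<partial>lborel)"
        by (rule nn_integral_cmult) simp
      also have "\<dots> < \<infinity>"
        using iD by (simp add: integrable_iff_bounded ennreal_mult_less_top)
      finally show "(\<integral>\<^sup>+z. ennreal (norm ((\<lambda>(x, r). w r * exp (- r * (norm x)\<^sup>2) * D x) z)) \<partial>(lborel \<Otimes>\<^sub>M lborel)) < \<infinity>" .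
    qed measurable
    define J where "J r = (LINT x|lborel. exp (- r * (norm x)\<^sup>2) * D x)" for r
    have [measurable]: "J \<in> borel_measurable borel" unfolding J_def[abs_def] by measurable
    have eq1: "k1 * riesz_form \<beta> f f = (LINT r|lborel. w r * J r)"
    proof -
      have "k1 * riesz_form \<beta> f f = (LINT x|lborel. k1 * norm x powr (- \<beta>) * D x)"
        by (simp add: riesz_form_def D_def mult.assoc)
      also have "\<dots> = (LINT x|lborel. LINT r|lborel. w r * exp (- r * (norm x)\<^sup>2) * D x)"
      proof (rule integral_cong_AE)
        show "AE x in lborel. k1 * norm x powr (- \<beta>) * D x = (LINT r|lborel. w r * exp (- r * (norm x)\<^sup>2) * D x)"
        proof (rule eventually_mono[OF AE_lborel_singleton[of 0]])
          fix x :: "real^3" assume x: "x \<noteq> 0"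
          have "(LINT r|lborel. w r * exp (- r * (norm x)\<^sup>2)) = k1 * norm x powr (- \<beta>)"
            using sub[OF x] K1(2) w0 by (subst integral_eq_nn_integral) simp_all
          then show "k1 * norm x powr (- \<beta>) * D x = (LINT r|lborel. w r * exp (- r * (norm x)\<^sup>2) * D x)"
            by simp
        qed
      qed measurable
      also have "\<dots> = (LINT r|lborel. LINT x|lborel. w r * exp (- r * (norm x)\<^sup>2) * D x)"
        by (rule lborel_pair.Fubini_integral[OF int2, symmetric])
      also have "\<dots> = (LINT r|lborel. w r * J r)"
        by (simp add: J_def mult.assoc)
      finally show ?thesis .
    qed
    have iwJ: "integrable lborel (\<lambda>r. w r * J r)"
      using lborel_pair.integrable_snd[OF int2] by (simp add: J_def mult.assoc)
    define A where "A r = (LINT \<xi>|lborel. exp (- (1 / (4 * r)) * (norm \<xi>)\<^sup>2) * (cmod (fourier f \<xi>))\<^sup>2)" for r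
    \<comment> \<open>The exponent is c - 1 from the mixing density minus 3/2 from the Gaussian
      constant.\<close>
    have J: "w r * J r = indicator {0<..} r * (q * r powr (c - 5/2) * A r)" for r
    proof (cases "r > 0")
      case True
      have "A r = sqrt (4 * pi * r) ^ 3 * J r"
        unfolding A_def J_def D_def by (rule gaussian_parseval[OF f True])
      moreover have "sqrt (4 * pi * r) ^ 3 = r powr (3/2) / q"
      proof -
        have "sqrt r ^ 3 = r powr (3/2)"
          using True by (simp add: powr_powr flip: powr_half_sqrt powr_numeral)
        then show ?thesis by (simp add: q_def real_sqrt_mult power_mult_distrib)
      qed
      moreover have "r powr (c - 5/2) * r powr (3/2) = r powr (c - 1)"
        by (simp flip: powr_add)
      ultimately show ?thesis using True q by (simp add: w_def mult.assoc[symmetric])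
    qed (simp add: w_def)
    have A0: "A r \<ge> 0" for r unfolding A_def by (intro integral_nonneg_AE AE_I2) simp
    \<comment> \<open>This is the positive definiteness of the Riesz kernel: although
      \<open>D\<close> may change sign, Parseval's identity makes each Gaussian slice a positive
      multiple of a spectral integral.\<close>
    have wJ0: "w r * J r \<ge> 0" for r
      unfolding J using A0[of r] q by (simp add: indicator_def)
    have "k1 * riesz_form \<beta> f f \<ge> 0" unfolding eq1 by (intro integral_nonneg_AE AE_I2 wJ0)
    then have pos: "riesz_form \<beta> f f \<ge> 0" using K1(2) by (simp add: zero_le_mult_iff)
    have Aenn: "ennreal (A r) = (\<integral>\<^sup>+\<xi>. ennreal (exp (- (norm \<xi>)\<^sup>2 / (4 * r)) * (cmod (fourier f \<xi>))\<^sup>2) \<partial>lborel)" if "r > 0" for r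
    proof -
      have bd: "(cmod (fourier f \<xi>))\<^sup>2 \<le> (LINT y|lborel. \<bar>f y\<bar>)\<^sup>2" for \<xi>
        using fourier_bound[OF bounded_supp_integrable[OF f]] by (intro power_mono) simp_all
      have g: "integrable lborel (\<lambda>\<xi>::real^3. exp (- (1 / (4 * r)) * (norm \<xi>)\<^sup>2))"
        using that by (intro integrable_gaussian_norm) simp
      have "integrable lborel (\<lambda>\<xi>. exp (- (1 / (4 * r)) * (norm \<xi>)\<^sup>2) * (cmod (fourier f \<xi>))\<^sup>2)"
      proof (rule Bochner_Integration.integrable_bound[OF integrable_mult_right[OF g, of "(LINT y|lborel. \<bar>f y\<bar>)\<^sup>2"]])
        show "AE \<xi> in lborel. norm (exp (- (1 / (4 * r)) * (norm \<xi>)\<^sup>2) * (cmod (fourier f \<xi>))\<^sup>2) \<le>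
            norm ((LINT y|lborel. \<bar>f y\<bar>)\<^sup>2 * exp (- (1 / (4 * r)) * (norm \<xi>)\<^sup>2))"
        proof (rule AE_I2)
          fix \<xi> :: "real^3"
          show "norm (exp (- (1 / (4 * r)) * (norm \<xi>)\<^sup>2) * (cmod (fourier f \<xi>))\<^sup>2) \<le>
            norm ((LINT y|lborel. \<bar>f y\<bar>)\<^sup>2 * exp (- (1 / (4 * r)) * (norm \<xi>)\<^sup>2))"
            using mult_left_mono[OF bd[of \<xi>], of "exp (- (1 / (4 * r)) * (norm \<xi>)\<^sup>2)"]
            by (simp only: norm_mult real_norm_def abs_power2 abs_exp_cancel mult.commute) (simp add: mult.commute)
        qed
      qed simp
      then show ?thesis unfolding A_def by (subst nn_integral_eq_integral[symmetric]) simp_all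
    qed
    \<comment> \<open>From here on all integrands are nonnegative and \<open>ennreal\<close>-valued,
      so the order can be exchanged before the spectral side is known to be finite.\<close>
    have "ennreal (k1 * riesz_form \<beta> f f) = (\<integral>\<^sup>+r. ennreal (w r * J r) \<partial>lborel)"
      unfolding eq1 by (rule nn_integral_eq_integral[OF iwJ, symmetric]) (intro AE_I2 wJ0)
    also have "\<dots> = (\<integral>\<^sup>+r. \<integral>\<^sup>+\<xi>. ennreal q * (ennreal ((cmod (fourier f \<xi>))\<^sup>2) * (ennreal (r powr (c - 5/2) * exp (- (norm \<xi>)\<^sup>2 / (4 * r))) * indicator {0<..} r)) \<partial>lborel \<partial>lborel)"
    proof (rule nn_integral_cong)
      fix r :: real
      show "ennreal (w r * J r) = (\<integral>\<^sup>+\<xi>. ennreal q * (ennreal ((cmod (fourier f \<xi>))\<^sup>2) * (ennreal (r powr (c - 5/2) * exp (- (norm \<xi>)\<^sup>2 / (4 * r))) * indicator {0<..} r)) \<partial>lborel)"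
      proof (cases "r > 0")
        case True
        have "ennreal (w r * J r) = ennreal (q * r powr (c - 5/2)) * ennreal (A r)"
          unfolding J using True q A0[of r] by (simp add: ennreal_mult)
        also have "\<dots> = (\<integral>\<^sup>+\<xi>. ennreal (q * r powr (c - 5/2)) * ennreal (exp (- (norm \<xi>)\<^sup>2 / (4 * r)) * (cmod (fourier f \<xi>))\<^sup>2) \<partial>lborel)"
          unfolding Aenn[OF True] by (rule nn_integral_cmult[symmetric]) measurable
        finally show ?thesis using True q by (simp add: ennreal_mult[symmetric] mult_ac)
      qed (simp add: w_def)
    qed
    also have "\<dots> = (\<integral>\<^sup>+\<xi>. \<integral>\<^sup>+r. ennreal q * (ennreal ((cmod (fourier f \<xi>))\<^sup>2) * (ennreal (r powr (c - 5/2) * exp (- (norm \<xi>)\<^sup>2 / (4 * r))) * indicator {0<..} r)) \<partial>lborel \<partial>lborel)"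
      by (rule lborel_pair.Fubini') measurable
    also have "\<dots> = (\<integral>\<^sup>+\<xi>. ennreal (q * k2) * (ennreal (norm \<xi> powr (\<beta> - 3)) * ennreal ((cmod (fourier f \<xi>))\<^sup>2)) \<partial>lborel)"
    proof (rule nn_integral_cong_AE, rule eventually_mono[OF AE_lborel_singleton[of 0]])
      fix \<xi> :: "real^3" assume "\<xi> \<noteq> 0"
      then have "(\<integral>\<^sup>+r. ennreal (r powr (c - 5/2) * exp (- (norm \<xi>)\<^sup>2 / (4 * r))) * indicator {0<..} r \<partial>lborel) =
          ennreal (((norm \<xi>)\<^sup>2) powr (c - 3/2)) * ennreal k2"
        by (subst nn_integral_inverse_gamma_scale, simp) (simp only: K2)
      moreover have "((norm \<xi>)\<^sup>2) powr (c - 3/2) = norm \<xi> powr (\<beta> - 3)"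
        using \<open>\<xi> \<noteq> 0\<close> by (simp add: c_def powr_powr right_diff_distrib flip: powr_numeral)
      ultimately show "(\<integral>\<^sup>+r. ennreal q * (ennreal ((cmod (fourier f \<xi>))\<^sup>2) * (ennreal (r powr (c - 5/2) * exp (- (norm \<xi>)\<^sup>2 / (4 * r))) * indicator {0<..} r)) \<partial>lborel) =
        ennreal (q * k2) * (ennreal (norm \<xi> powr (\<beta> - 3)) * ennreal ((cmod (fourier f \<xi>))\<^sup>2))"
        using q K2(2) by (subst nn_integral_cmult, measurable, subst nn_integral_cmult, measurable)
          (simp add: ennreal_mult mult_ac)
    qed
    also have "\<dots> = ennreal (q * k2) * (\<integral>\<^sup>+\<xi>. ennreal (norm \<xi> powr (\<beta> - 3)) * ennreal ((cmod (fourier f \<xi>))\<^sup>2) \<partial>lborel)"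
      by (rule nn_integral_cmult) measurable
    finally show ?thesis using pos by simp
  qed
  show thesis
  proof
    \<comment> \<open>The witness for \<open>C\<close>: \<open>k1\<close> normalises the Gaussian
      mixture, \<open>q * k2\<close> comes from integrating the spectral side over the mixing
      parameter, and \<open>s\<close> is divided out because \<open>spectral_measure\<close> already
      contains \<open>spectral_const\<close>.\<close>
    show "q * k2 / (s * k1) > 0" using q K1 K2 s by simp
    show "0 \<le> riesz_form \<beta> f f" if "bounded_supp f B R" for f B R using main[OF that] by simp
    show "ennreal (riesz_form \<beta> f f) =
       ennreal (q * k2 / (s * k1)) * (\<integral>\<^sup>+\<xi>. ennreal ((cmod (fourier f \<xi>))\<^sup>2) \<partial>spectral_measure \<beta>)"
      if f: "bounded_supp f B R" for f B R
    proof -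
      note [measurable] = bounded_suppD(1)[OF f]
      have "ennreal (riesz_form \<beta> f f) = ennreal (1 / k1) * ennreal (k1 * riesz_form \<beta> f f)"
        using K1(2) by (simp flip: ennreal_mult')
      also have "\<dots> = ennreal (1 / k1) * ennreal (q * k2) * (\<integral>\<^sup>+\<xi>. ennreal (norm \<xi> powr (\<beta> - 3)) * ennreal ((cmod (fourier f \<xi>))\<^sup>2) \<partial>lborel)"
        using main[OF f] by (simp add: mult.assoc)
      also have "ennreal (1 / k1) * ennreal (q * k2) = ennreal (q * k2 / (s * k1)) * ennreal s"
        using K1(2) K2(2) q s by (simp flip: ennreal_mult')
      finally show ?thesis
        using b by (simp add: nn_integral_spectral_measure s_def mult.assoc)
    qed
  qed
qed

section \<open>Limits of Gaussian variables\<close>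

lemma centred_gaussian_moment:
  assumes "prob_space P" and X: "centred_gaussian P X"
  shows "integrable P (\<lambda>\<omega>. X \<omega> ^ (2 * k))"
    and "(LINT \<omega>|P. X \<omega> ^ (2 * k)) = fact (2 * k) / (2 ^ k * fact k) * (LINT \<omega>|P. (X \<omega>)\<^sup>2) ^ k"
proof -
  interpret prob_space P by fact
  have [measurable]: "X \<in> borel_measurable P" using X by (simp add: centred_gaussian_def)
  have "integrable P (\<lambda>\<omega>. X \<omega> ^ (2 * k)) \<and>
    (LINT \<omega>|P. X \<omega> ^ (2 * k)) = fact (2 * k) / (2 ^ k * fact k) * (LINT \<omega>|P. (X \<omega>)\<^sup>2) ^ k"
  proof (cases "AE \<omega> in P. X \<omega> = 0")
    case True
    \<comment> \<open>Written as \<open>0 ^ (2 * k)\<close> and not as 0, since the power is 1 for k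
      = 0.\<close>
    have a: "AE \<omega> in P. X \<omega> ^ (2 * k) = 0 ^ (2 * k)" for k
      using True by (rule eventually_mono) simp
    have "integrable P (\<lambda>\<omega>. X \<omega> ^ (2 * k)) \<longleftrightarrow> integrable P (\<lambda>\<omega>. 0 ^ (2 * k) :: real)"
      by (rule integrable_cong_AE) (use a in simp_all)
    moreover have e: "(LINT \<omega>|P. X \<omega> ^ (2 * k)) = (LINT \<omega>|P. 0 ^ (2 * k))" for k
      by (rule integral_cong_AE) (use a in simp_all)
    moreover have "(LINT \<omega>|P. (X \<omega>)\<^sup>2) = 0" using e[of 1] by simp
    ultimately show ?thesis
      unfolding e[of k] by (cases k) (simp_all add: prob_space)
  next
    case False
    then obtain \<sigma> where s: "\<sigma> > 0" and d: "distributed P lborel X (\<lambda>r. ennreal (normal_density 0 \<sigma> r))"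
      using X by (auto simp: centred_gaussian_def)
    have i: "integrable P (\<lambda>\<omega>. X \<omega> ^ (2 * k))" for k
      using integrable_normal_moment[OF s, of 0 "2 * k"] distributed_integrable[OF d, of "\<lambda>x. x ^ (2 * k)"] s
      by (simp add: normal_density_nonneg)
    have m: "(LINT \<omega>|P. X \<omega> ^ (2 * k)) = fact (2 * k) / ((2 / \<sigma>\<^sup>2) ^ k * fact k)" for k
      using integral_normal_moment_even[OF s, of 0 k] distributed_integral[OF d, of "\<lambda>x. x ^ (2 * k)"] s
      by (simp add: normal_density_nonneg)
    have "(LINT \<omega>|P. (X \<omega>)\<^sup>2) = \<sigma>\<^sup>2" using m[of 1] by simp
    then show ?thesis using i m[of k] s by (simp add: power_divide field_simps)
  qed
  then show "integrable P (\<lambda>\<omega>. X \<omega> ^ (2 * k))"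
    "(LINT \<omega>|P. X \<omega> ^ (2 * k)) = fact (2 * k) / (2 ^ k * fact k) * (LINT \<omega>|P. (X \<omega>)\<^sup>2) ^ k" by blast+
qed

text \<open>Markov's inequality for the power 2k. As k is free, the tail decays faster than any
  power of l, which pays for the crude union bound in the chaining argument.\<close>

lemma centred_gaussian_tail:
  assumes "prob_space P" and X: "centred_gaussian P X" and l: "l > 0"
  shows "measure P {\<omega> \<in> space P. \<bar>X \<omega>\<bar> \<ge> l} \<le>
    fact (2 * k) / (2 ^ k * fact k) * ((LINT \<omega>|P. (X \<omega>)\<^sup>2) / l\<^sup>2) ^ k"
proof -
  interpret prob_space P by fact
  have [measurable]: "X \<in> borel_measurable P" using X by (simp add: centred_gaussian_def)
  have "{\<omega> \<in> space P. \<bar>X \<omega>\<bar> \<ge> l} \<subseteq> {\<omega> \<in> space P. X \<omega> ^ (2 * k) \<ge> l ^ (2 * k)}"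
  proof safe
    fix \<omega> assume "l \<le> \<bar>X \<omega>\<bar>"
    then have "l ^ (2 * k) \<le> \<bar>X \<omega>\<bar> ^ (2 * k)" using l by (intro power_mono) simp_all
    then show "l ^ (2 * k) \<le> X \<omega> ^ (2 * k)" by (simp only: power_even_abs[of "2 * k"] dvd_triv_left)
  qed
  then have "measure P {\<omega> \<in> space P. \<bar>X \<omega>\<bar> \<ge> l} \<le> measure P {\<omega> \<in> space P. X \<omega> ^ (2 * k) \<ge> l ^ (2 * k)}"
    by (intro finite_measure_mono) simp_all
  also have "\<dots> \<le> (LINT \<omega>|P. X \<omega> ^ (2 * k)) / l ^ (2 * k)"
    by (rule integral_Markov_inequality_measure[where A="{}"])
      (use l centred_gaussian_moment(1)[OF assms(1) X, of k] in \<open>simp_all add: zero_le_even_power\<close>)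
  also have "\<dots> = fact (2 * k) / (2 ^ k * fact k) * (LINT \<omega>|P. (X \<omega>)\<^sup>2) ^ k / (l\<^sup>2) ^ k"
    by (simp only: centred_gaussian_moment(2)[OF assms(1) X] power_mult[of l])
  finally show ?thesis by (simp only: power_divide times_divide_eq_right)
qed

text \<open>The normal density is at most 1 / sqrt (2 pi \<sigma>^2) and the interval has length 2e;
  the estimate 2 \<le> sqrt (2 pi) gives the clean constant.\<close>

lemma centred_gaussian_small_ball:
  assumes "prob_space P" and X: "centred_gaussian P X" and v: "(LINT \<omega>|P. (X \<omega>)\<^sup>2) > 0" and e: "e \<ge> 0"
  shows "measure P {\<omega> \<in> space P. \<bar>X \<omega>\<bar> \<le> e} \<le> e / sqrt (LINT \<omega>|P. (X \<omega>)\<^sup>2)"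
proof -
  interpret prob_space P by fact
  have [measurable]: "X \<in> borel_measurable P" using X by (simp add: centred_gaussian_def)
  have "\<not> (AE \<omega> in P. X \<omega> = 0)"
  proof
    assume "AE \<omega> in P. X \<omega> = 0"
    then have "(LINT \<omega>|P. (X \<omega>)\<^sup>2) = (LINT \<omega>|P. 0)"
      by (intro integral_cong_AE) (auto elim: eventually_mono)
    then show False using v by simp
  qed
  then obtain \<sigma> where s: "\<sigma> > 0" and d: "distributed P lborel X (\<lambda>r. ennreal (normal_density 0 \<sigma> r))"
    using X by (auto simp: centred_gaussian_def)
  have "(LINT \<omega>|P. (X \<omega>)\<^sup>2) = \<sigma>\<^sup>2"
    using integral_normal_moment_even[OF s, of 0 1] distributed_integral[OF d, of "\<lambda>x. x\<^sup>2"] s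
    by (simp add: normal_density_nonneg)
  then have sv: "sqrt (LINT \<omega>|P. (X \<omega>)\<^sup>2) = \<sigma>" using s by simp
  have "emeasure P (X -` {-e..e} \<inter> space P) = (\<integral>\<^sup>+r. ennreal (normal_density 0 \<sigma> r) * indicator {-e..e} r \<partial>lborel)"
    by (rule distributed_emeasure[OF d]) simp
  also have "\<dots> \<le> (\<integral>\<^sup>+r. ennreal (1 / sqrt (2 * pi * \<sigma>\<^sup>2)) * indicator {-e..e} r \<partial>lborel)"
    by (intro nn_integral_mono mult_right_mono ennreal_leI)
      (simp_all add: normal_density_def divide_right_mono)
  also have "\<dots> = ennreal (2 * e / sqrt (2 * pi * \<sigma>\<^sup>2))"
    using e by (simp add: nn_integral_cmult ennreal_mult[symmetric])
  also have "\<dots> \<le> ennreal (e / \<sigma>)"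
  proof (rule ennreal_leI)
    have "2 * \<sigma> \<le> sqrt (2 * pi * \<sigma>\<^sup>2)"
      using s pi_gt3 by (intro real_le_rsqrt) (simp add: power_mult_distrib)
    then have "2 * e / sqrt (2 * pi * \<sigma>\<^sup>2) \<le> 2 * e / (2 * \<sigma>)"
      using e s by (intro divide_left_mono) simp_all
    then show "2 * e / sqrt (2 * pi * \<sigma>\<^sup>2) \<le> e / \<sigma>" by simp
  qed
  also have "X -` {-e..e} \<inter> space P = {\<omega> \<in> space P. \<bar>X \<omega>\<bar> \<le> e}" by (auto simp: abs_le_iff)
  finally show ?thesis unfolding sv using e s by (simp add: emeasure_eq_measure)
qed

text \<open>Limits in probability inherit Gaussian tail and small-ball estimates; their laws are not identified.\<close>

definition gaussian_limit :: "'w measure \<Rightarrow> ('w \<Rightarrow> real) \<Rightarrow> bool" where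
  "gaussian_limit P X \<longleftrightarrow> X \<in> borel_measurable P \<and>
     (\<forall>\<epsilon>>0. \<exists>G. centred_gaussian P G \<and> L2_dist2 P G X < ennreal \<epsilon>)"

text \<open>Collects the properties of one approximant within \<epsilon>: the second moments of
  \<open>G\<close> and \<open>X\<close> are comparable by (a+b)^2 \<le> 2 a^2 + 2 b^2, and
  Chebyshev's inequality bounds the probability that the two are far apart.\<close>

lemma gaussian_limit_approx:
  assumes "prob_space P" and X: "gaussian_limit P X" and eps: "\<epsilon> > 0"
  obtains G where "centred_gaussian P G" "integrable P (\<lambda>\<omega>. (G \<omega> - X \<omega>)\<^sup>2)"
    "(LINT \<omega>|P. (G \<omega> - X \<omega>)\<^sup>2) \<le> \<epsilon>" "integrable P (\<lambda>\<omega>. (X \<omega>)\<^sup>2)"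
    "(LINT \<omega>|P. (G \<omega>)\<^sup>2) \<le> 2 * (LINT \<omega>|P. (X \<omega>)\<^sup>2) + 2 * \<epsilon>"
    "(LINT \<omega>|P. (X \<omega>)\<^sup>2) \<le> 2 * (LINT \<omega>|P. (G \<omega>)\<^sup>2) + 2 * \<epsilon>"
    "\<And>l. l > 0 \<Longrightarrow> measure P {\<omega> \<in> space P. \<bar>G \<omega> - X \<omega>\<bar> \<ge> l} \<le> \<epsilon> / l\<^sup>2"
proof -
  interpret prob_space P by fact
  obtain G where G: "centred_gaussian P G" "L2_dist2 P G X < ennreal \<epsilon>"
    using X eps by (auto simp: gaussian_limit_def)
  have [measurable]: "X \<in> borel_measurable P" "G \<in> borel_measurable P"
    using X G by (simp_all add: gaussian_limit_def centred_gaussian_def)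
  have iD: "integrable P (\<lambda>\<omega>. (G \<omega> - X \<omega>)\<^sup>2)"
    using G(2) by (intro integrableI_bounded) (auto simp: L2_dist2_def intro: less_trans)
  have D: "(LINT \<omega>|P. (G \<omega> - X \<omega>)\<^sup>2) \<le> \<epsilon>"
    using G(2) eps by (subst integral_eq_nn_integral) (auto simp: L2_dist2_def less_imp_le intro!: enn2real_leI)
  have iG: "integrable P (\<lambda>\<omega>. (G \<omega>)\<^sup>2)"
    using centred_gaussian_moment(1)[OF assms(1) G(1), of 1] by simp
  have ineq: "x\<^sup>2 \<le> 2 * y\<^sup>2 + 2 * (y - x)\<^sup>2" for x y :: real
  proof -
    have "0 \<le> (2 * y - x)\<^sup>2" by simp
    then show ?thesis by (simp add: power2_eq_square algebra_simps)
  qed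
  have iX: "integrable P (\<lambda>\<omega>. (X \<omega>)\<^sup>2)"
  proof (rule Bochner_Integration.integrable_bound[of P "\<lambda>\<omega>. 2 * (G \<omega>)\<^sup>2 + 2 * (G \<omega> - X \<omega>)\<^sup>2"])
    show "integrable P (\<lambda>\<omega>. 2 * (G \<omega>)\<^sup>2 + 2 * (G \<omega> - X \<omega>)\<^sup>2)" using iG iD by simp
    show "AE \<omega> in P. norm ((X \<omega>)\<^sup>2) \<le> norm (2 * (G \<omega>)\<^sup>2 + 2 * (G \<omega> - X \<omega>)\<^sup>2)"
      using ineq by (intro AE_I2) simp
  qed simp
  have ineq': "y\<^sup>2 \<le> 2 * x\<^sup>2 + 2 * (y - x)\<^sup>2" for x y :: real
    using ineq[of y x] by (simp only: power2_commute[of y x])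
  have "(LINT \<omega>|P. (G \<omega>)\<^sup>2) \<le> (LINT \<omega>|P. 2 * (X \<omega>)\<^sup>2 + 2 * (G \<omega> - X \<omega>)\<^sup>2)"
    using ineq' iG iX iD by (intro integral_mono) simp_all
  then have 1: "(LINT \<omega>|P. (G \<omega>)\<^sup>2) \<le> 2 * (LINT \<omega>|P. (X \<omega>)\<^sup>2) + 2 * \<epsilon>"
    using iX iD D by simp
  have "(LINT \<omega>|P. (X \<omega>)\<^sup>2) \<le> (LINT \<omega>|P. 2 * (G \<omega>)\<^sup>2 + 2 * (G \<omega> - X \<omega>)\<^sup>2)"
    using ineq iG iX iD by (intro integral_mono) simp_all
  then have 2: "(LINT \<omega>|P. (X \<omega>)\<^sup>2) \<le> 2 * (LINT \<omega>|P. (G \<omega>)\<^sup>2) + 2 * \<epsilon>"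
    using iG iD D by simp
  have 3: "measure P {\<omega> \<in> space P. \<bar>G \<omega> - X \<omega>\<bar> \<ge> l} \<le> \<epsilon> / l\<^sup>2" if "l > 0" for l
  proof -
    have "measure P {\<omega> \<in> space P. \<bar>G \<omega> - X \<omega>\<bar> \<ge> l} \<le> measure P {\<omega> \<in> space P. (G \<omega> - X \<omega>)\<^sup>2 \<ge> l\<^sup>2}"
      using that by (intro finite_measure_mono) (auto simp: abs_le_square_iff[symmetric])
    also have "\<dots> \<le> (LINT \<omega>|P. (G \<omega> - X \<omega>)\<^sup>2) / l\<^sup>2"
      using that by (intro integral_Markov_inequality_measure[where A="{}"] iD) simp_all
    also have "\<dots> \<le> \<epsilon> / l\<^sup>2" using D by (simp add: divide_right_mono)
    finally show ?thesis .
  qed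
  show thesis by (rule that[OF G(1) iD D iX 1 2 3])
qed

lemma le_limit_at_0:
  fixes f :: "real \<Rightarrow> real"
  assumes "\<And>\<epsilon>. \<epsilon> > 0 \<Longrightarrow> \<epsilon> < d \<Longrightarrow> a \<le> f \<epsilon>" "(f \<longlongrightarrow> b) (at_right 0)" "d > 0"
  shows "a \<le> b"
proof (rule tendsto_lowerbound[OF assms(2)])
  show "\<forall>\<^sub>F \<epsilon> in at_right 0. a \<le> f \<epsilon>"
    unfolding eventually_at_right_field using assms(1,3) by (intro exI[of _ d]) auto
qed simp

lemma gaussian_limit_integrable:
  assumes "prob_space P" and X: "gaussian_limit P X"
  shows "integrable P (\<lambda>\<omega>. (X \<omega>)\<^sup>2)"
  using gaussian_limit_approx[OF assms, of 1] by (meson zero_less_one)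

text \<open>If |X| \<ge> l, then |G| \<ge> l/2 or |G - X| \<ge> l/2. The factor 8 in each power is 2
  from comparing second moments times 4 from halving l; the Chebyshev term disappears as \<epsilon>
  tends to 0.\<close>

lemma gaussian_limit_tail:
  assumes "prob_space P" and X: "gaussian_limit P X" and l: "l > 0"
  shows "measure P {\<omega> \<in> space P. \<bar>X \<omega>\<bar> \<ge> l} \<le>
    fact (2 * k) / (2 ^ k * fact k) * 8 ^ k * ((LINT \<omega>|P. (X \<omega>)\<^sup>2) / l\<^sup>2) ^ k"
proof -
  interpret prob_space P by fact
  define v where "v = (LINT \<omega>|P. (X \<omega>)\<^sup>2)"
  define c where "c = (fact (2 * k) / (2 ^ k * fact k) :: real)"
  have c: "c \<ge> 0" by (simp add: c_def)
  have [measurable]: "X \<in> borel_measurable P" using X by (simp add: gaussian_limit_def)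
  have "measure P {\<omega> \<in> space P. \<bar>X \<omega>\<bar> \<ge> l} \<le> c * ((2 * v + 2 * 0) / (l / 2)\<^sup>2) ^ k + 0 / (l / 2)\<^sup>2"
  proof (rule le_limit_at_0[where d=1 and f="\<lambda>\<epsilon>. c * ((2 * v + 2 * \<epsilon>) / (l / 2)\<^sup>2) ^ k + \<epsilon> / (l / 2)\<^sup>2"])
    fix \<epsilon> :: real assume e: "\<epsilon> > 0"
    obtain G where G: "centred_gaussian P G"
      "(LINT \<omega>|P. (G \<omega>)\<^sup>2) \<le> 2 * v + 2 * \<epsilon>"
      "measure P {\<omega> \<in> space P. \<bar>G \<omega> - X \<omega>\<bar> \<ge> l / 2} \<le> \<epsilon> / (l / 2)\<^sup>2"
    proof (rule gaussian_limit_approx[OF assms(1) X e])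
      fix G assume *: "centred_gaussian P G" "(LINT \<omega>|P. (G \<omega>)\<^sup>2) \<le> 2 * (LINT \<omega>|P. (X \<omega>)\<^sup>2) + 2 * \<epsilon>"
        "\<And>l. l > 0 \<Longrightarrow> measure P {\<omega> \<in> space P. \<bar>G \<omega> - X \<omega>\<bar> \<ge> l} \<le> \<epsilon> / l\<^sup>2"
      show thesis by (rule that[OF *(1) _ *(3)]) (use * l in \<open>simp_all add: v_def\<close>)
    qed
    have [measurable]: "G \<in> borel_measurable P" using G(1) by (simp add: centred_gaussian_def)
    have "measure P {\<omega> \<in> space P. \<bar>X \<omega>\<bar> \<ge> l} \<le>
      measure P ({\<omega> \<in> space P. \<bar>G \<omega>\<bar> \<ge> l / 2} \<union> {\<omega> \<in> space P. \<bar>G \<omega> - X \<omega>\<bar> \<ge> l / 2})"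
    proof (rule finite_measure_mono)
      have "\<bar>G \<omega>\<bar> \<ge> l / 2 \<or> \<bar>G \<omega> - X \<omega>\<bar> \<ge> l / 2" if "\<bar>X \<omega>\<bar> \<ge> l" for \<omega>
        using that by arith
      then show "{\<omega> \<in> space P. \<bar>X \<omega>\<bar> \<ge> l} \<subseteq> {\<omega> \<in> space P. \<bar>G \<omega>\<bar> \<ge> l / 2} \<union> {\<omega> \<in> space P. \<bar>G \<omega> - X \<omega>\<bar> \<ge> l / 2}"
        by blast
    qed measurable
    also have "\<dots> \<le> measure P {\<omega> \<in> space P. \<bar>G \<omega>\<bar> \<ge> l / 2} + measure P {\<omega> \<in> space P. \<bar>G \<omega> - X \<omega>\<bar> \<ge> l / 2}"
      by (intro measure_Un_le) measurable
    also have "measure P {\<omega> \<in> space P. \<bar>G \<omega>\<bar> \<ge> l / 2} \<le> c * ((LINT \<omega>|P. (G \<omega>)\<^sup>2) / (l / 2)\<^sup>2) ^ k"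
      unfolding c_def using l by (intro centred_gaussian_tail[OF assms(1) G(1)]) simp
    also have "\<dots> \<le> c * ((2 * v + 2 * \<epsilon>) / (l / 2)\<^sup>2) ^ k"
      using G(2) c by (intro mult_left_mono power_mono divide_right_mono) simp_all
    finally show "measure P {\<omega> \<in> space P. \<bar>X \<omega>\<bar> \<ge> l} \<le> c * ((2 * v + 2 * \<epsilon>) / (l / 2)\<^sup>2) ^ k + \<epsilon> / (l / 2)\<^sup>2"
      using G(3) by simp
  next
    show "((\<lambda>\<epsilon>. c * ((2 * v + 2 * \<epsilon>) / (l / 2)\<^sup>2) ^ k + \<epsilon> / (l / 2)\<^sup>2) \<longlongrightarrow>
        c * ((2 * v + 2 * 0) / (l / 2)\<^sup>2) ^ k + 0 / (l / 2)\<^sup>2) (at_right 0)"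
      using l by (auto intro!: tendsto_eq_intros)
  qed simp
  also have "(2 * v + 2 * 0) / (l / 2)\<^sup>2 = 8 * (v / l\<^sup>2)" by (simp add: power_divide)
  finally show ?thesis by (simp only: c_def v_def power_mult_distrib mult.assoc div_0 add_0_right)
qed

text \<open>If |X| \<le> e, then |G| \<le> 2e or |G - X| \<ge> e, and the second moment of
  \<open>G\<close> is at least v/2 - \<epsilon>. The level e stays fixed while \<epsilon> tends to
  0, so the Chebyshev term vanishes.\<close>

lemma gaussian_limit_small_ball:
  assumes "prob_space P" and X: "gaussian_limit P X" and v: "(LINT \<omega>|P. (X \<omega>)\<^sup>2) > 0" and e: "e > 0"
  shows "measure P {\<omega> \<in> space P. \<bar>X \<omega>\<bar> \<le> e} \<le> 2 * e / sqrt ((LINT \<omega>|P. (X \<omega>)\<^sup>2) / 2)"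
proof -
  interpret prob_space P by fact
  define v where "v = (LINT \<omega>|P. (X \<omega>)\<^sup>2)"
  have v: "v > 0" using v by (simp add: v_def)
  have [measurable]: "X \<in> borel_measurable P" using X by (simp add: gaussian_limit_def)
  have "measure P {\<omega> \<in> space P. \<bar>X \<omega>\<bar> \<le> e} \<le> 2 * e / sqrt (v / 2 - 0) + 0 / e\<^sup>2"
  proof (rule le_limit_at_0[where d="v / 2" and f="\<lambda>\<epsilon>. 2 * e / sqrt (v / 2 - \<epsilon>) + \<epsilon> / e\<^sup>2"])
    fix \<epsilon> :: real assume ep: "\<epsilon> > 0" "\<epsilon> < v / 2"
    obtain G where G: "centred_gaussian P G"
      "v \<le> 2 * (LINT \<omega>|P. (G \<omega>)\<^sup>2) + 2 * \<epsilon>"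
      "measure P {\<omega> \<in> space P. \<bar>G \<omega> - X \<omega>\<bar> \<ge> e} \<le> \<epsilon> / e\<^sup>2"
    proof (rule gaussian_limit_approx[OF assms(1) X ep(1)])
      fix G assume *: "centred_gaussian P G" "(LINT \<omega>|P. (X \<omega>)\<^sup>2) \<le> 2 * (LINT \<omega>|P. (G \<omega>)\<^sup>2) + 2 * \<epsilon>"
        "\<And>l. l > 0 \<Longrightarrow> measure P {\<omega> \<in> space P. \<bar>G \<omega> - X \<omega>\<bar> \<ge> l} \<le> \<epsilon> / l\<^sup>2"
      show thesis by (rule that[OF *(1) _ *(3)]) (use * e in \<open>simp_all add: v_def\<close>)
    qed
    have [measurable]: "G \<in> borel_measurable P" using G(1) by (simp add: centred_gaussian_def)
    have "measure P {\<omega> \<in> space P. \<bar>X \<omega>\<bar> \<le> e} \<le>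
      measure P ({\<omega> \<in> space P. \<bar>G \<omega>\<bar> \<le> 2 * e} \<union> {\<omega> \<in> space P. \<bar>G \<omega> - X \<omega>\<bar> \<ge> e})"
      by (intro finite_measure_mono) auto
    also have "\<dots> \<le> measure P {\<omega> \<in> space P. \<bar>G \<omega>\<bar> \<le> 2 * e} + measure P {\<omega> \<in> space P. \<bar>G \<omega> - X \<omega>\<bar> \<ge> e}"
      by (intro measure_Un_le) measurable
    also have "measure P {\<omega> \<in> space P. \<bar>G \<omega>\<bar> \<le> 2 * e} \<le> 2 * e / sqrt (LINT \<omega>|P. (G \<omega>)\<^sup>2)"
      using G(2) ep e by (intro centred_gaussian_small_ball[OF assms(1) G(1)]) simp_all
    also have "\<dots> \<le> 2 * e / sqrt (v / 2 - \<epsilon>)"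
      using G(2) e ep by (intro divide_left_mono) simp_all
    finally show "measure P {\<omega> \<in> space P. \<bar>X \<omega>\<bar> \<le> e} \<le> 2 * e / sqrt (v / 2 - \<epsilon>) + \<epsilon> / e\<^sup>2"
      using G(3) by simp
  next
    show "((\<lambda>\<epsilon>. 2 * e / sqrt (v / 2 - \<epsilon>) + \<epsilon> / e\<^sup>2) \<longlongrightarrow> 2 * e / sqrt (v / 2 - 0) + 0 / e\<^sup>2) (at_right 0)"
      using v e by (auto intro!: tendsto_eq_intros)
  qed (use v in simp)
  then show ?thesis by (simp only: v_def diff_zero div_0 add_0_right)
qed

section \<open>Isometry between noise and spectral integrands\<close>

definition bounded_supp2 :: "(real \<times> (real^3) \<Rightarrow> real) \<Rightarrow> real \<Rightarrow> real \<Rightarrow> bool" where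
  "bounded_supp2 \<phi> B R \<longleftrightarrow> \<phi> \<in> borel_measurable borel \<and> 0 \<le> B \<and> 0 \<le> R \<and>
     (\<forall>s y. \<bar>\<phi> (s, y)\<bar> \<le> B * indicator {-R..R} s * indicator (cball 0 R) y)"

lemma bounded_supp2_mono:
  assumes "bounded_supp2 \<phi> B R" "B \<le> B'" "R \<le> R'"
  shows "bounded_supp2 \<phi> B' R'"
  unfolding bounded_supp2_def
proof (intro conjI allI)
  fix s :: real and y :: "real^3"
  have "B \<ge> 0" using assms by (simp add: bounded_supp2_def)
  have "\<bar>\<phi> (s, y)\<bar> \<le> B * indicator {-R..R} s * indicator (cball 0 R) y"
    using assms by (simp add: bounded_supp2_def)
  also have "B * indicator {-R..R} s * indicator (cball 0 R) y \<le> B' * indicator {-R'..R'} s * indicator (cball 0 R') y"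
    using assms \<open>B \<ge> 0\<close> by (auto simp: indicator_def)
  finally show "\<bar>\<phi> (s, y)\<bar> \<le> B' * indicator {-R'..R'} s * indicator (cball 0 R') y" .
qed (use assms in \<open>auto simp: bounded_supp2_def\<close>)

lemma test_function_bounded_supp2:
  assumes "\<phi> \<in> test_functions"
  obtains B R where "bounded_supp2 \<phi> B R"
proof -
  have c: "continuous_on UNIV \<phi>" using assms by (auto simp: test_functions_def dest: spec[of _ 0])
  let ?S = "closure {z. \<phi> z \<noteq> 0}"
  have K: "compact ?S" using assms by (simp add: test_functions_def)
  then obtain R where R: "\<And>z. z \<in> ?S \<Longrightarrow> norm z \<le> R" "R > 0"
    using compact_imp_bounded bounded_pos by metis
  have "compact (\<phi> ` ?S)" using c K continuous_on_subset by (intro compact_continuous_image) blast+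
  then obtain B where B: "\<And>z. z \<in> ?S \<Longrightarrow> \<bar>\<phi> z\<bar> \<le> B" "B > 0"
    using compact_imp_bounded[of "\<phi> ` ?S"] bounded_pos[of "\<phi> ` ?S"] by auto
  have "\<bar>\<phi> (s, y)\<bar> \<le> B * indicator {-R..R} s * indicator (cball 0 R) y" for s y
  proof (cases "\<phi> (s, y) = 0")
    case False
    then have z: "(s, y) \<in> ?S" by (intro subsetD[OF closure_subset]) simp
    from R(1)[OF z] have "\<bar>s\<bar> \<le> R" "norm y \<le> R"
      using norm_fst_le[of s y] norm_snd_le[of y s] by simp_all
    then show ?thesis using B(1)[OF z] by (simp add: abs_le_iff minus_le_iff)
  qed (use B in simp)
  then have "bounded_supp2 \<phi> B R"
    using c B R by (auto simp: bounded_supp2_def borel_measurable_continuous_onI)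
  then show thesis by (rule that)
qed

lemma test_functions_common_support:
  assumes "finite J" "J \<subseteq> test_functions"
  shows "\<exists>B R. 0 \<le> B \<and> 0 \<le> R \<and> (\<forall>\<phi>\<in>J. bounded_supp2 \<phi> B R)"
  using assms
proof (induction J rule: finite_induct)
  case (insert \<phi> J)
  then obtain B R where "0 \<le> B" "0 \<le> R" "\<forall>\<phi>\<in>J. bounded_supp2 \<phi> B R" by auto
  moreover obtain B' R' where "bounded_supp2 \<phi> B' R'"
    using insert.prems test_function_bounded_supp2 by blast
  ultimately show ?case
    by (intro exI[of _ "max B B'"] exI[of _ "max R R'"])
      (auto intro: bounded_supp2_mono simp: max.coboundedI1)
qed auto

lemma bounded_supp2_slice:
  assumes "bounded_supp2 \<phi> B R"
  shows "bounded_supp (\<lambda>y. \<phi> (s, y)) (B * indicator {-R..R} s) R"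
proof -
  have [measurable]: "\<phi> \<in> borel_measurable (borel \<Otimes>\<^sub>M borel)"
    using assms by (simp add: bounded_supp2_def borel_prod)
  show ?thesis using assms by (auto simp: bounded_supp_def bounded_supp2_def)
qed

lemma bounded_supp_mono:
  "bounded_supp f B R \<Longrightarrow> B \<le> B' \<Longrightarrow> bounded_supp f B' R"
proof (unfold bounded_supp_def, safe)
  fix y :: "real^3"
  assume B: "B \<le> B'" and "\<forall>y. \<bar>f y\<bar> \<le> B * indicator (cball 0 R) y"
  then have "\<bar>f y\<bar> \<le> B * indicator (cball 0 R) y" by blast
  also have "\<dots> \<le> B' * indicator (cball 0 R) y" using B by (simp add: indicator_def)
  finally show "\<bar>f y\<bar> \<le> B' * indicator (cball 0 R) y" .
qed simp

lemma noise_covariance_eq: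
  "noise_covariance \<beta> \<phi> \<psi> = (LINT s|lborel. indicator {0..} s * riesz_form \<beta> (\<lambda>y. \<phi> (s, y)) (\<lambda>y. \<psi> (s, y)))"
  unfolding noise_covariance_def set_lebesgue_integral_def riesz_form_def convolution_def by simp

text \<open>The slices vanish for |s| > R and are bounded uniformly by the Riesz integral
  \<open>L\<close> of a multiple of a ball indicator. This permits the exchange of finite sums with
  the time integral.\<close>

lemma integrable_riesz_form_slices:
  assumes b: "\<beta> < 3" and f: "bounded_supp2 \<phi> B R" and g: "bounded_supp2 \<psi> B R"
  shows "integrable lborel (\<lambda>s. indicator {0..} s * riesz_form \<beta> (\<lambda>y. \<phi> (s, y)) (\<lambda>y. \<psi> (s, y)))"
proof -
  have [measurable]: "\<phi> \<in> borel_measurable (borel \<Otimes>\<^sub>M borel)" "\<psi> \<in> borel_measurable (borel \<Otimes>\<^sub>M borel)"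
    using f g by (simp_all add: bounded_supp2_def borel_prod)
  have BR: "0 \<le> B" "0 \<le> R" using f by (simp_all add: bounded_supp2_def)
  define K where "K = B * B * measure lborel (cball (0::real^3) R)"
  have K: "K \<ge> 0" using BR by (simp add: K_def)
  define L where "L = (LINT x|lborel. norm x powr (- \<beta>) * (K * indicator (cball (0::real^3) (2 * R)) x))"
  have iL: "integrable lborel (\<lambda>x. norm x powr (- \<beta>) * (K * indicator (cball (0::real^3) (2 * R)) x))"
    by (rule integrable_riesz_kernel[where K=K and R="2 * R"]) (use b BR K in \<open>auto simp: abs_mult intro!: borel_measurable_times borel_measurable_indicator\<close>)
  have bd: "\<bar>riesz_form \<beta> (\<lambda>y. \<phi> (s, y)) (\<lambda>y. \<psi> (s, y))\<bar> \<le> L * indicator {-R..R} s" for s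
  proof (cases "s \<in> {-R..R}")
    case True
    have f': "bounded_supp (\<lambda>y. \<phi> (s, y)) B R" and g': "bounded_supp (\<lambda>y. \<psi> (s, y)) B R"
      using bounded_supp2_slice[OF f, of s] bounded_supp2_slice[OF g, of s] True by simp_all
    let ?D = "\<lambda>x. LINT y|lborel. \<phi> (s, y) * \<psi> (s, y - x)"
    have D: "\<bar>?D x\<bar> \<le> K * indicator (cball 0 (2 * R)) x" for x
      unfolding K_def by (rule bounded_supp_autocorrelation(3)[OF f' g'])
    have "\<bar>riesz_form \<beta> (\<lambda>y. \<phi> (s, y)) (\<lambda>y. \<psi> (s, y))\<bar> \<le> (LINT x|lborel. \<bar>norm x powr (- \<beta>) * ?D x\<bar>)"
      unfolding riesz_form_def by (rule integral_abs_bound)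
    also have "\<dots> \<le> L"
      unfolding L_def
    proof (rule integral_mono[OF _ iL])
      show "integrable lborel (\<lambda>x. \<bar>norm x powr (- \<beta>) * ?D x\<bar>)"
        by (intro integrable_abs integrable_riesz_kernel[where K=K and R="2 * R"]) (use b BR D in simp_all)
      show "\<bar>norm x powr (- \<beta>) * ?D x\<bar> \<le> norm x powr (- \<beta>) * (K * indicator (cball 0 (2 * R)) x)" for x
        using mult_left_mono[OF D, of "norm x powr (- \<beta>)" x] by (simp add: abs_mult)
    qed
    finally show ?thesis using True by simp
  next
    case False
    then have "\<phi> (s, y) = 0" for y using f by (auto simp: bounded_supp2_def dest: spec[of _ s])
    then show ?thesis using False by (simp add: riesz_form_def)
  qed
  have L0: "L \<ge> 0" using bd[of 0] BR by simp
  show ?thesis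
  proof (rule Bochner_Integration.integrable_bound[of lborel "\<lambda>s. L * indicator {-R..R} s"])
    show "integrable lborel (\<lambda>s::real. L * indicator {-R..R} s :: real)"
      by (intro integrable_mult_right integrable_real_indicator) (simp_all add: emeasure_lborel_Icc_eq)
    show "(\<lambda>s. indicator {0..} s * riesz_form \<beta> (\<lambda>y. \<phi> (s, y)) (\<lambda>y. \<psi> (s, y))) \<in> borel_measurable lborel"
      unfolding riesz_form_def by measurable
    show "AE s in lborel. norm (indicator {0..} s * riesz_form \<beta> (\<lambda>y. \<phi> (s, y)) (\<lambda>y. \<psi> (s, y))) \<le> norm (L * indicator {-R..R} s)"
    proof (rule AE_I2)
      fix s :: real
      have "\<bar>indicator {0..} s\<bar> * \<bar>riesz_form \<beta> (\<lambda>y. \<phi> (s, y)) (\<lambda>y. \<psi> (s, y))\<bar> \<le> 1 * (L * indicator {-R..R} s)"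
        by (intro mult_mono bd) (simp_all add: indicator_def L0)
      then show "norm (indicator {0..} s * riesz_form \<beta> (\<lambda>y. \<phi> (s, y)) (\<lambda>y. \<psi> (s, y))) \<le> norm (L * indicator {-R..R} s)"
        using L0 by (simp add: abs_mult)
    qed
  qed
qed

lemma riesz_form_sum:
  assumes J: "finite J" and b: "\<beta> < 3" and f: "\<And>j. j \<in> J \<Longrightarrow> bounded_supp (f j) B R"
  shows "riesz_form \<beta> (\<lambda>y. \<Sum>j\<in>J. a j * f j y) (\<lambda>y. \<Sum>j\<in>J. a j * f j y) =
    (\<Sum>i\<in>J. \<Sum>j\<in>J. a i * a j * riesz_form \<beta> (f i) (f j))"
proof -
  let ?D = "\<lambda>i j x. LINT y|lborel. f i y * f j (y - x)"
  have "(LINT y|lborel. (\<Sum>j\<in>J. a j * f j y) * (\<Sum>j\<in>J. a j * f j (y - x))) = (\<Sum>i\<in>J. \<Sum>j\<in>J. a i * a j * ?D i j x)" for x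
  proof -
    have "(LINT y|lborel. (\<Sum>j\<in>J. a j * f j y) * (\<Sum>j\<in>J. a j * f j (y - x))) =
       (LINT y|lborel. (\<Sum>i\<in>J. \<Sum>j\<in>J. a i * a j * (f i y * f j (y - x))))"
      by (simp add: sum_product mult_ac)
    also have "\<dots> = (\<Sum>i\<in>J. LINT y|lborel. (\<Sum>j\<in>J. a i * a j * (f i y * f j (y - x))))"
      by (rule Bochner_Integration.integral_sum)
        (intro Bochner_Integration.integrable_sum integrable_mult_right bounded_supp_autocorrelation(2)[OF f f])
    also have "\<dots> = (\<Sum>i\<in>J. \<Sum>j\<in>J. LINT y|lborel. a i * a j * (f i y * f j (y - x)))"
      by (intro sum.cong refl Bochner_Integration.integral_sum integrable_mult_right bounded_supp_autocorrelation(2)[OF f f])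
    finally show ?thesis by simp
  qed
  then have "riesz_form \<beta> (\<lambda>y. \<Sum>j\<in>J. a j * f j y) (\<lambda>y. \<Sum>j\<in>J. a j * f j y) =
     (LINT x|lborel. (\<Sum>i\<in>J. \<Sum>j\<in>J. a i * a j * (norm x powr (- \<beta>) * ?D i j x)))"
    unfolding riesz_form_def by (simp add: sum_distrib_left mult_ac)
  also have "\<dots> = (\<Sum>i\<in>J. \<Sum>j\<in>J. a i * a j * (LINT x|lborel. norm x powr (- \<beta>) * ?D i j x))"
  proof -
    have i: "integrable lborel (\<lambda>x. norm x powr (- \<beta>) * ?D i j x)" if "i \<in> J" "j \<in> J" for i j
      by (rule integrable_riesz_kernel[OF b bounded_supp_autocorrelation(1)[OF f f] bounded_supp_autocorrelation(3)[OF f f]])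
        (use that f bounded_suppD(3) in fastforce)+
    have "(LINT x|lborel. (\<Sum>i\<in>J. \<Sum>j\<in>J. a i * a j * (norm x powr (- \<beta>) * ?D i j x))) =
      (\<Sum>i\<in>J. LINT x|lborel. (\<Sum>j\<in>J. a i * a j * (norm x powr (- \<beta>) * ?D i j x)))"
      by (rule Bochner_Integration.integral_sum) (intro Bochner_Integration.integrable_sum integrable_mult_right i)
    also have "\<dots> = (\<Sum>i\<in>J. \<Sum>j\<in>J. LINT x|lborel. a i * a j * (norm x powr (- \<beta>) * ?D i j x))"
      by (intro sum.cong refl Bochner_Integration.integral_sum integrable_mult_right i)
    finally show ?thesis by simp
  qed
  finally show ?thesis by (simp add: riesz_form_def)
qed

text \<open>\<open>F\<close> is given as a family with prescribed covariances and not as a linear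
  map. A formal combination, paired with its symbol \<open>fourier_comb\<close>, takes the place of
  the noise tested against the sum.\<close>

definition noise_comb :: "('i \<Rightarrow> 'w \<Rightarrow> real) \<Rightarrow> 'i set \<Rightarrow> ('i \<Rightarrow> real) \<Rightarrow> 'w \<Rightarrow> real" where
  "noise_comb F J a \<omega> = (\<Sum>\<phi>\<in>J. a \<phi> * F \<phi> \<omega>)"

definition fourier_comb ::
    "(real \<times> (real^3) \<Rightarrow> real) set \<Rightarrow> ((real \<times> (real^3) \<Rightarrow> real) \<Rightarrow> real) \<Rightarrow> real \<Rightarrow> real^3 \<Rightarrow> complex" where
  "fourier_comb J a s \<xi> = (\<Sum>\<phi>\<in>J. complex_of_real (a \<phi>) * fourier (\<lambda>y. \<phi> (s, y)) \<xi>)"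

lemma fourier_sum:
  assumes "finite J" "\<And>j. j \<in> J \<Longrightarrow> integrable lborel (f j)"
  shows "fourier (\<lambda>y. \<Sum>j\<in>J. a j * f j y) \<xi> = (\<Sum>j\<in>J. complex_of_real (a j) * fourier (f j) \<xi>)"
proof -
  have i: "integrable lborel (\<lambda>y. cis (- (\<xi> \<bullet> y)) * complex_of_real (f j y))" if "j \<in> J" for j
    by (rule Bochner_Integration.integrable_bound[of lborel "f j"]) (use assms that in \<open>auto simp: norm_mult\<close>)
  have "fourier (\<lambda>y. \<Sum>j\<in>J. a j * f j y) \<xi> =
     (LINT y|lborel. (\<Sum>j\<in>J. complex_of_real (a j) * (cis (- (\<xi> \<bullet> y)) * complex_of_real (f j y))))"
    unfolding fourier_def by (simp add: sum_distrib_left mult_ac)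
  also have "\<dots> = (\<Sum>j\<in>J. LINT y|lborel. complex_of_real (a j) * (cis (- (\<xi> \<bullet> y)) * complex_of_real (f j y)))"
    by (intro Bochner_Integration.integral_sum integrable_mult_right i)
  finally show ?thesis by (simp add: fourier_def)
qed

lemma noise_comb_second_moment:
  assumes "prob_space P" and F: "riesz_noise P \<beta> F" and J: "finite J" "J \<subseteq> test_functions"
  shows "centred_gaussian P (noise_comb F J a)"
    and "(LINT \<omega>|P. (noise_comb F J a \<omega>)\<^sup>2) = (\<Sum>\<phi>\<in>J. \<Sum>\<psi>\<in>J. a \<phi> * a \<psi> * noise_covariance \<beta> \<phi> \<psi>)"
proof -
  have g: "centred_gaussian P (\<lambda>\<omega>. \<Sum>j\<in>J. a j * F j \<omega>)" if "finite J" "J \<subseteq> test_functions" for J a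
    using F that by (simp add: riesz_noise_def centred_gaussian_process_def)
  show "centred_gaussian P (noise_comb F J a)"
    using g[OF J] by (simp add: noise_comb_def[abs_def])
  have g1: "centred_gaussian P (F \<phi>)" if "\<phi> \<in> test_functions" for \<phi>
    using g[of "{\<phi>}" "\<lambda>_. 1"] that by simp
  have i: "integrable P (\<lambda>\<omega>. F \<phi> \<omega> * F \<psi> \<omega>)" if "\<phi> \<in> J" "\<psi> \<in> J" for \<phi> \<psi>
  proof -
    have c: "centred_gaussian P (F \<phi>)" "centred_gaussian P (F \<psi>)" using that J g1 by auto
    then have [measurable]: "F \<phi> \<in> borel_measurable P" "F \<psi> \<in> borel_measurable P"
      by (simp_all add: centred_gaussian_def)
    show ?thesis
    proof (rule Bochner_Integration.integrable_bound[of P "\<lambda>\<omega>. (F \<phi> \<omega>)\<^sup>2 + (F \<psi> \<omega>)\<^sup>2"])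
      show "integrable P (\<lambda>\<omega>. (F \<phi> \<omega>)\<^sup>2 + (F \<psi> \<omega>)\<^sup>2)"
        using centred_gaussian_moment(1)[OF assms(1) c(1), of 1] centred_gaussian_moment(1)[OF assms(1) c(2), of 1] by simp
      have "\<bar>x * y\<bar> \<le> x\<^sup>2 + y\<^sup>2" for x y :: real
      proof -
        have "0 \<le> (\<bar>x\<bar> - \<bar>y\<bar>)\<^sup>2" "0 \<le> \<bar>x\<bar> * \<bar>y\<bar>" by simp_all
        then show ?thesis unfolding power2_diff abs_mult power2_abs by linarith
      qed
      then show "AE \<omega> in P. norm (F \<phi> \<omega> * F \<psi> \<omega>) \<le> norm ((F \<phi> \<omega>)\<^sup>2 + (F \<psi> \<omega>)\<^sup>2)"
        by (intro AE_I2) simp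
    qed measurable
  qed
  have "(LINT \<omega>|P. (noise_comb F J a \<omega>)\<^sup>2) = (LINT \<omega>|P. (\<Sum>\<phi>\<in>J. \<Sum>\<psi>\<in>J. a \<phi> * a \<psi> * (F \<phi> \<omega> * F \<psi> \<omega>)))"
    unfolding noise_comb_def power2_eq_square by (simp add: sum_product mult_ac)
  also have "\<dots> = (\<Sum>\<phi>\<in>J. LINT \<omega>|P. (\<Sum>\<psi>\<in>J. a \<phi> * a \<psi> * (F \<phi> \<omega> * F \<psi> \<omega>)))"
    by (rule Bochner_Integration.integral_sum) (intro Bochner_Integration.integrable_sum integrable_mult_right i)
  also have "\<dots> = (\<Sum>\<phi>\<in>J. \<Sum>\<psi>\<in>J. LINT \<omega>|P. a \<phi> * a \<psi> * (F \<phi> \<omega> * F \<psi> \<omega>))"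
    by (intro sum.cong refl Bochner_Integration.integral_sum integrable_mult_right i)
  also have "\<dots> = (\<Sum>\<phi>\<in>J. \<Sum>\<psi>\<in>J. a \<phi> * a \<psi> * noise_covariance \<beta> \<phi> \<psi>)"
    using F J by (intro sum.cong refl) (auto simp: riesz_noise_def)
  finally show "(LINT \<omega>|P. (noise_comb F J a \<omega>)\<^sup>2) = (\<Sum>\<phi>\<in>J. \<Sum>\<psi>\<in>J. a \<phi> * a \<psi> * noise_covariance \<beta> \<phi> \<psi>)" .
qed

text \<open>At each time the Riesz form of the combined slice is evaluated by the spatial Parseval
  identity, and the result is integrated over s \<ge> 0. The constant is fixed before the
  probability space and the combination, so it serves all approximants alike.\<close>

lemma noise_comb_isometry:
  assumes b: "0 < \<beta>" "\<beta> < 2"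
  obtains C where "C > 0"
    "\<And>P F J a. prob_space P \<Longrightarrow> riesz_noise P \<beta> F \<Longrightarrow> finite J \<Longrightarrow> J \<subseteq> test_functions \<Longrightarrow>
       ennreal (LINT \<omega>|P. (noise_comb F J a \<omega>)\<^sup>2) = ennreal C * spectral_dist2 \<beta> (fourier_comb J a) (\<lambda>_ _. 0)"
proof -
  from riesz_parseval[OF b] obtain C where C: "C > 0"
    "\<And>f B R. bounded_supp f B R \<Longrightarrow> 0 \<le> riesz_form \<beta> f f"
    "\<And>f B R. bounded_supp f B R \<Longrightarrow> ennreal (riesz_form \<beta> f f) =
       ennreal C * (\<integral>\<^sup>+\<xi>. ennreal ((cmod (fourier f \<xi>))\<^sup>2) \<partial>spectral_measure \<beta>)" by metis
  have "ennreal (LINT \<omega>|P. (noise_comb F J a \<omega>)\<^sup>2) = ennreal C * spectral_dist2 \<beta> (fourier_comb J a) (\<lambda>_ _. 0)"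
    if *: "prob_space P" "riesz_noise P \<beta> F" and J: "finite J" "J \<subseteq> test_functions" for P F J a
  proof -
    obtain B R where BR: "0 \<le> B" "0 \<le> R" "\<And>\<phi>. \<phi> \<in> J \<Longrightarrow> bounded_supp2 \<phi> B R"
      using test_functions_common_support[OF J] by blast
    have sl: "bounded_supp (\<lambda>y. \<phi> (s, y)) B R" if "\<phi> \<in> J" for \<phi> s
      by (rule bounded_supp_mono[OF bounded_supp2_slice[OF BR(3)[OF that]]]) (use BR(1) in \<open>simp add: indicator_def\<close>)
    have sl2: "bounded_supp (\<lambda>y. \<Sum>\<phi>\<in>J. a \<phi> * \<phi> (s, y)) (\<Sum>\<phi>\<in>J. \<bar>a \<phi>\<bar> * B) R" for s
      unfolding bounded_supp_def
    proof (intro conjI allI)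
      show "(\<lambda>y. \<Sum>\<phi>\<in>J. a \<phi> * \<phi> (s, y)) \<in> borel_measurable borel"
        by (intro borel_measurable_sum borel_measurable_times borel_measurable_const bounded_suppD(1)[OF sl])
      show "\<bar>\<Sum>\<phi>\<in>J. a \<phi> * \<phi> (s, y)\<bar> \<le> (\<Sum>\<phi>\<in>J. \<bar>a \<phi>\<bar> * B) * indicator (cball 0 R) y" for y
        unfolding sum_distrib_right
      proof (rule order_trans[OF sum_abs sum_mono])
        fix \<phi> assume "\<phi> \<in> J"
        then have "\<bar>\<phi> (s, y)\<bar> \<le> B * indicator (cball 0 R) y" using sl by (simp add: bounded_supp_def)
        then show "\<bar>a \<phi> * \<phi> (s, y)\<bar> \<le> \<bar>a \<phi>\<bar> * B * indicator (cball 0 R) y"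
          by (simp add: abs_mult mult.assoc mult_left_mono)
      qed
    qed (use BR in \<open>auto intro: sum_nonneg\<close>)
    let ?\<Phi> = "\<lambda>s y. \<Sum>\<phi>\<in>J. a \<phi> * \<phi> (s, y)"
    let ?q = "\<lambda>\<phi> \<psi> s. indicator {0..} s * riesz_form \<beta> (\<lambda>y. \<phi> (s, y)) (\<lambda>y. \<psi> (s, y))"
    have i: "integrable lborel (?q \<phi> \<psi>)" if "\<phi> \<in> J" "\<psi> \<in> J" for \<phi> \<psi>
      by (rule integrable_riesz_form_slices) (use b BR(3) that in auto)
    have sum: "indicator {0..} s * riesz_form \<beta> (?\<Phi> s) (?\<Phi> s) = (\<Sum>\<phi>\<in>J. \<Sum>\<psi>\<in>J. a \<phi> * a \<psi> * ?q \<phi> \<psi> s)" for s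
      using b by (subst riesz_form_sum[OF J(1) _ sl]) (simp_all add: sum_distrib_left mult_ac)
    have slice: "ennreal (indicator {0..} s * riesz_form \<beta> (?\<Phi> s) (?\<Phi> s)) =
        ennreal C * ((\<integral>\<^sup>+\<xi>. ennreal ((cmod (fourier_comb J a s \<xi> - 0))\<^sup>2) \<partial>spectral_measure \<beta>) * indicator {0..} s)" for s
    proof -
      have "fourier (?\<Phi> s) \<xi> = fourier_comb J a s \<xi>" for \<xi>
        unfolding fourier_comb_def by (rule fourier_sum[OF J(1) bounded_supp_integrable[OF sl]])
      then show ?thesis
        using C(3)[OF sl2[of s]] by (simp add: indicator_def)
    qed
    have ii: "integrable lborel (\<lambda>s. indicator {0..} s * riesz_form \<beta> (?\<Phi> s) (?\<Phi> s))"
      unfolding sum by (intro Bochner_Integration.integrable_sum integrable_mult_right i)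
    have "(LINT \<omega>|P. (noise_comb F J a \<omega>)\<^sup>2) = (\<Sum>\<phi>\<in>J. \<Sum>\<psi>\<in>J. LINT s|lborel. a \<phi> * a \<psi> * ?q \<phi> \<psi> s)"
      unfolding noise_comb_second_moment(2)[OF * J] noise_covariance_eq by simp
    also have "\<dots> = (\<Sum>\<phi>\<in>J. LINT s|lborel. (\<Sum>\<psi>\<in>J. a \<phi> * a \<psi> * ?q \<phi> \<psi> s))"
      by (intro sum.cong refl Bochner_Integration.integral_sum[symmetric] integrable_mult_right i)
    also have "\<dots> = (LINT s|lborel. (\<Sum>\<phi>\<in>J. \<Sum>\<psi>\<in>J. a \<phi> * a \<psi> * ?q \<phi> \<psi> s))"
      by (rule Bochner_Integration.integral_sum[symmetric]) (intro Bochner_Integration.integrable_sum integrable_mult_right i)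
    also have "\<dots> = (LINT s|lborel. indicator {0..} s * riesz_form \<beta> (?\<Phi> s) (?\<Phi> s))"
      unfolding sum ..
    finally have "ennreal (LINT \<omega>|P. (noise_comb F J a \<omega>)\<^sup>2) =
        (\<integral>\<^sup>+s. ennreal (indicator {0..} s * riesz_form \<beta> (?\<Phi> s) (?\<Phi> s)) \<partial>lborel)"
      using C(2)[OF sl2] by (simp add: nn_integral_eq_integral[OF ii])
    also have "\<dots> = (\<integral>\<^sup>+s. ennreal C * ((\<integral>\<^sup>+\<xi>. ennreal ((cmod (fourier_comb J a s \<xi> - 0))\<^sup>2) \<partial>spectral_measure \<beta>) * indicator {0..} s) \<partial>lborel)"
      by (simp only: slice)
    also have "\<dots> = ennreal C * spectral_dist2 \<beta> (fourier_comb J a) (\<lambda>_ _. 0)"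
      unfolding spectral_dist2_def
    proof (rule nn_integral_cmult)
      \<comment> \<open>Measurability in \<open>s\<close> of the inner spectral integral is read off
        from the Riesz form, after division by \<open>C\<close>.\<close>
      have "(\<lambda>s. ennreal (1 / C) * (ennreal C * ((\<integral>\<^sup>+\<xi>. ennreal ((cmod (fourier_comb J a s \<xi> - 0))\<^sup>2) \<partial>spectral_measure \<beta>) * indicator {0..} s)))
         \<in> borel_measurable lborel"
        unfolding slice[symmetric]
        by (intro borel_measurable_times_ennreal borel_measurable_const
            measurable_compose[OF borel_measurable_integrable[OF ii] measurable_ennreal])
      then show "(\<lambda>s. (\<integral>\<^sup>+\<xi>. ennreal ((cmod (fourier_comb J a s \<xi> - 0))\<^sup>2) \<partial>spectral_measure \<beta>) * indicator {0..} s) \<in> borel_measurable lborel"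
        using C(1) by (simp add: mult.assoc[symmetric] ennreal_mult[symmetric])
    qed
    finally show ?thesis .
  qed
  then show thesis using that[OF C(1)] by blast
qed

section \<open>Squared distances and the closure of the noise map\<close>

lemma ennreal_norm_add_power2_le:
  fixes x y :: "'a::real_normed_vector"
  shows "ennreal ((norm (x + y))\<^sup>2) \<le> 2 * ennreal ((norm x)\<^sup>2) + 2 * ennreal ((norm y)\<^sup>2)"
proof -
  have "(norm (x + y))\<^sup>2 \<le> (norm x + norm y)\<^sup>2"
    by (intro power_mono norm_triangle_ineq) simp
  also have "\<dots> \<le> 2 * (norm x)\<^sup>2 + 2 * (norm y)\<^sup>2"
    using sum_squares_bound[of "norm x" "norm y"] by (simp add: power2_sum)
  finally show ?thesis
    by (simp add: ennreal_plus[symmetric] ennreal_mult'[symmetric] ennreal_leI flip: ennreal_numeral del: ennreal_plus)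
qed

lemma nn_integral_norm_add_power2_le:
  fixes f g :: "'z \<Rightarrow> 'a::{real_normed_vector,second_countable_topology}"
  assumes [measurable]: "f \<in> borel_measurable M" "g \<in> borel_measurable M"
  shows "(\<integral>\<^sup>+x. ennreal ((norm (f x + g x))\<^sup>2) \<partial>M) \<le>
    2 * (\<integral>\<^sup>+x. ennreal ((norm (f x))\<^sup>2) \<partial>M) + 2 * (\<integral>\<^sup>+x. ennreal ((norm (g x))\<^sup>2) \<partial>M)"
proof -
  have "(\<integral>\<^sup>+x. ennreal ((norm (f x + g x))\<^sup>2) \<partial>M) \<le>
     (\<integral>\<^sup>+x. 2 * ennreal ((norm (f x))\<^sup>2) + 2 * ennreal ((norm (g x))\<^sup>2) \<partial>M)"
    by (intro nn_integral_mono ennreal_norm_add_power2_le)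
  also have "\<dots> = 2 * (\<integral>\<^sup>+x. ennreal ((norm (f x))\<^sup>2) \<partial>M) + 2 * (\<integral>\<^sup>+x. ennreal ((norm (g x))\<^sup>2) \<partial>M)"
    by (simp add: nn_integral_add nn_integral_cmult)
  finally show ?thesis .
qed

text \<open>Young's inequality with a free parameter. The coefficient of the leading term tends to 1
  with e, which yields equality of norms in a limit; the fixed factor 2 would give mere
  comparability.\<close>

lemma nn_integral_norm_power2_weighted:
  fixes f g :: "'z \<Rightarrow> 'a::{real_normed_vector,second_countable_topology}"
  assumes [measurable]: "f \<in> borel_measurable M" "g \<in> borel_measurable M" and e: "e > 0"
  shows "(\<integral>\<^sup>+x. ennreal ((norm (f x))\<^sup>2) \<partial>M) \<le>
    ennreal (1 + e) * (\<integral>\<^sup>+x. ennreal ((norm (g x))\<^sup>2) \<partial>M) + ennreal (1 + 1 / e) * (\<integral>\<^sup>+x. ennreal ((norm (f x - g x))\<^sup>2) \<partial>M)"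
proof -
  have "(norm (f x))\<^sup>2 \<le> (1 + e) * (norm (g x))\<^sup>2 + (1 + 1 / e) * (norm (f x - g x))\<^sup>2" for x
  proof -
    have "norm (f x) \<le> norm (g x) + norm (f x - g x)"
      using norm_triangle_ineq[of "g x" "f x - g x"] by simp
    then have "(norm (f x))\<^sup>2 \<le> (norm (g x) + norm (f x - g x))\<^sup>2"
      by (intro power_mono) simp_all
    also have "\<dots> \<le> (1 + e) * (norm (g x))\<^sup>2 + (1 + 1 / e) * (norm (f x - g x))\<^sup>2"
    proof -
      have "0 \<le> (e * norm (g x) - norm (f x - g x))\<^sup>2 / e" using e by simp
      then show ?thesis using e by (simp add: field_simps power2_eq_square)
    qed
    finally show ?thesis .
  qed
  then have "(\<integral>\<^sup>+x. ennreal ((norm (f x))\<^sup>2) \<partial>M) \<le>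
     (\<integral>\<^sup>+x. ennreal (1 + e) * ennreal ((norm (g x))\<^sup>2) + ennreal (1 + 1 / e) * ennreal ((norm (f x - g x))\<^sup>2) \<partial>M)"
    using e by (intro nn_integral_mono) (simp add: ennreal_mult[symmetric] ennreal_plus[symmetric] ennreal_leI del: ennreal_plus)
  also have "\<dots> = ennreal (1 + e) * (\<integral>\<^sup>+x. ennreal ((norm (g x))\<^sup>2) \<partial>M) + ennreal (1 + 1 / e) * (\<integral>\<^sup>+x. ennreal ((norm (f x - g x))\<^sup>2) \<partial>M)"
    by (simp add: nn_integral_add nn_integral_cmult)
  finally show ?thesis .
qed

text \<open>A single measure on space-time turns the iterated integral of
  \<open>spectral_dist2\<close> into one squared L2 norm, to which the inequalities for functions
  apply directly.\<close>

definition space_time_spectral :: "real \<Rightarrow> (real \<times> (real^3)) measure" where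
  "space_time_spectral \<beta> = density (lborel \<Otimes>\<^sub>M lborel)
     (\<lambda>(s, \<xi>). indicator {0..} s * ennreal (spectral_const \<beta> * norm \<xi> powr (\<beta> - 3)))"

abbreviation joint_measurable :: "(real \<Rightarrow> real^3 \<Rightarrow> complex) \<Rightarrow> bool" where
  "joint_measurable h \<equiv> (\<lambda>(s, \<xi>). h s \<xi>) \<in> borel_measurable (borel \<Otimes>\<^sub>M borel)"

lemma joint_measurable_space_time:
  "joint_measurable h \<Longrightarrow> (\<lambda>z. h (fst z) (snd z)) \<in> borel_measurable (space_time_spectral \<beta>)"
  unfolding space_time_spectral_def by (simp add: split_beta')

lemma spectral_dist2_eq:
  assumes [measurable]: "joint_measurable g" "joint_measurable h"
  shows "spectral_dist2 \<beta> g h =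
    (\<integral>\<^sup>+z. ennreal ((norm (g (fst z) (snd z) - h (fst z) (snd z)))\<^sup>2) \<partial>space_time_spectral \<beta>)"
proof -
  have "(\<integral>\<^sup>+z. ennreal ((norm (g (fst z) (snd z) - h (fst z) (snd z)))\<^sup>2) \<partial>space_time_spectral \<beta>) =
     (\<integral>\<^sup>+(s, \<xi>). (indicator {0..} s * ennreal (spectral_const \<beta> * norm \<xi> powr (\<beta> - 3))) * ennreal ((norm (g s \<xi> - h s \<xi>))\<^sup>2) \<partial>(lborel \<Otimes>\<^sub>M lborel))"
    unfolding space_time_spectral_def
    by (subst nn_integral_density) (simp_all add: split_beta')
  also have "\<dots> = (\<integral>\<^sup>+s. \<integral>\<^sup>+\<xi>. (indicator {0..} s * ennreal (spectral_const \<beta> * norm \<xi> powr (\<beta> - 3))) * ennreal ((norm (g s \<xi> - h s \<xi>))\<^sup>2) \<partial>lborel \<partial>lborel)"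
    by (subst lborel.nn_integral_fst[symmetric]) simp_all
  also have "\<dots> = spectral_dist2 \<beta> g h"
    unfolding spectral_dist2_def
  proof (rule nn_integral_cong)
    fix s :: real
    have m: "(\<lambda>\<xi>. g s \<xi>) \<in> borel_measurable borel" "(\<lambda>\<xi>. h s \<xi>) \<in> borel_measurable borel"
      by measurable
    have "(\<integral>\<^sup>+\<xi>. ennreal ((cmod (g s \<xi> - h s \<xi>))\<^sup>2) \<partial>spectral_measure \<beta>) =
        (\<integral>\<^sup>+\<xi>. ennreal (spectral_const \<beta> * norm \<xi> powr (\<beta> - 3)) * ennreal ((norm (g s \<xi> - h s \<xi>))\<^sup>2) \<partial>lborel)"
      unfolding spectral_measure_def using m by (subst nn_integral_density) simp_all
    then show "(\<integral>\<^sup>+\<xi>. (indicator {0..} s * ennreal (spectral_const \<beta> * norm \<xi> powr (\<beta> - 3))) * ennreal ((norm (g s \<xi> - h s \<xi>))\<^sup>2) \<partial>lborel) =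
        (\<integral>\<^sup>+\<xi>. ennreal ((cmod (g s \<xi> - h s \<xi>))\<^sup>2) \<partial>spectral_measure \<beta>) * indicator {0..} s"
      by (simp add: indicator_def)
  qed
  finally show ?thesis ..
qed

lemma spectral_dist2_triangle:
  assumes "joint_measurable f" "joint_measurable g" "joint_measurable h"
  shows "spectral_dist2 \<beta> f h \<le> 2 * spectral_dist2 \<beta> f g + 2 * spectral_dist2 \<beta> g h"
  unfolding spectral_dist2_eq[OF assms(1,3)] spectral_dist2_eq[OF assms(1,2)] spectral_dist2_eq[OF assms(2,3)]
  using nn_integral_norm_add_power2_le[of "\<lambda>z. f (fst z) (snd z) - g (fst z) (snd z)" "space_time_spectral \<beta>"
      "\<lambda>z. g (fst z) (snd z) - h (fst z) (snd z)"] assms[THEN joint_measurable_space_time]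
  by simp

lemma L2_dist2_triangle:
  assumes "X \<in> borel_measurable P" "Y \<in> borel_measurable P" "Z \<in> borel_measurable P"
  shows "L2_dist2 P X Z \<le> 2 * L2_dist2 P X Y + 2 * L2_dist2 P Y Z"
  unfolding L2_dist2_def
  using nn_integral_norm_add_power2_le[of "\<lambda>z. X z - Y z" P "\<lambda>z. Y z - Z z"] assms by simp

lemma fourier_comb_joint_measurable:
  assumes "J \<subseteq> test_functions"
  shows "joint_measurable (fourier_comb J a)"
proof -
  have "(\<lambda>(s, \<xi>). fourier (\<lambda>y. \<phi> (s, y)) \<xi>) \<in> borel_measurable (borel \<Otimes>\<^sub>M borel)" if "\<phi> \<in> J" for \<phi>
  proof (rule fourier_measurable_param)
    have "\<phi> \<in> borel_measurable borel" using that assms test_function_bounded_supp2[of \<phi>]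
      by (auto simp: bounded_supp2_def)
    then show "(\<lambda>(s, y). \<phi> (s, y)) \<in> borel_measurable (borel \<Otimes>\<^sub>M borel)" by (simp add: borel_prod)
  qed
  then show ?thesis unfolding fourier_comb_def by (auto simp: split_beta')
qed

lemma noise_comb_measurable:
  assumes "riesz_noise P \<beta> F" "finite J" "J \<subseteq> test_functions"
  shows "noise_comb F J a \<in> borel_measurable P"
  using assms unfolding riesz_noise_def centred_gaussian_process_def centred_gaussian_def noise_comb_def[abs_def] by blast

text \<open>
  \<open>X\<close> is the image of the integrand with spatial Fourier transform \<open>h\<close> under the closure of
  \<open>\<phi> \<mapsto> F \<phi>\<close>.
\<close>

definition noise_image :: "'w measure \<Rightarrow> real \<Rightarrow> ((real \<times> (real^3) \<Rightarrow> real) \<Rightarrow> 'w \<Rightarrow> real) \<Rightarrow>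
    ('w \<Rightarrow> real) \<Rightarrow> (real \<Rightarrow> real^3 \<Rightarrow> complex) \<Rightarrow> bool" where
  "noise_image P \<beta> F X h \<longleftrightarrow> X \<in> borel_measurable P \<and> joint_measurable h \<and>
     (\<forall>\<epsilon>>0. \<exists>J a. finite J \<and> J \<subseteq> test_functions \<and>
        L2_dist2 P (noise_comb F J a) X < ennreal \<epsilon> \<and> spectral_dist2 \<beta> (fourier_comb J a) h < ennreal \<epsilon>)"

text \<open>Diagonal argument: two approximations within \<epsilon>/4 combine, through the
  inequality with two factors 2, to an error below \<epsilon>.\<close>

lemma noise_image_limit:
  assumes F: "riesz_noise P \<beta> F" and m: "X \<in> borel_measurable P" "joint_measurable h"
    and lim: "\<And>\<epsilon>. \<epsilon> > 0 \<Longrightarrow> \<exists>Y k. noise_image P \<beta> F Y k \<and> L2_dist2 P Y X < ennreal \<epsilon> \<and> spectral_dist2 \<beta> k h < ennreal \<epsilon>"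
  shows "noise_image P \<beta> F X h"
  unfolding noise_image_def
proof (intro conjI m allI impI)
  fix \<epsilon> :: real assume e: "\<epsilon> > 0"
  then obtain Y k where Y: "noise_image P \<beta> F Y k" "L2_dist2 P Y X < ennreal (\<epsilon> / 4)" "spectral_dist2 \<beta> k h < ennreal (\<epsilon> / 4)"
    using lim[of "\<epsilon> / 4"] by auto
  have Ym: "Y \<in> borel_measurable P" "joint_measurable k" using Y(1) by (simp_all add: noise_image_def)
  obtain J a where J: "finite J" "J \<subseteq> test_functions" "L2_dist2 P (noise_comb F J a) Y < ennreal (\<epsilon> / 4)"
    "spectral_dist2 \<beta> (fourier_comb J a) k < ennreal (\<epsilon> / 4)"
    using Y(1) e by (auto simp: noise_image_def dest: spec[of _ "\<epsilon> / 4"])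
  have four: "2 * x + 2 * y < ennreal \<epsilon>" if lt: "x < ennreal (\<epsilon> / 4)" "y < ennreal (\<epsilon> / 4)" for x y
  proof -
    obtain p q where "x = ennreal p" "y = ennreal q" "p \<ge> 0" "q \<ge> 0"
      using lt by (cases x; cases y) auto
    then show ?thesis using that e
      by (simp add: ennreal_less_iff ennreal_mult'[symmetric] ennreal_plus[symmetric] flip: ennreal_numeral del: ennreal_plus)
  qed
  show "\<exists>J a. finite J \<and> J \<subseteq> test_functions \<and>
        L2_dist2 P (noise_comb F J a) X < ennreal \<epsilon> \<and> spectral_dist2 \<beta> (fourier_comb J a) h < ennreal \<epsilon>"
    using J(1,2) four[OF J(3) Y(2)] four[OF J(4) Y(3)]
      L2_dist2_triangle[OF noise_comb_measurable[OF F J(1,2)] Ym(1) m(1), of a]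
      spectral_dist2_triangle[OF fourier_comb_joint_measurable[OF J(2)] Ym(2) m(2), of \<beta> a]
    by (meson le_less_trans)
qed

lemma noise_image_lin:
  assumes F: "riesz_noise P \<beta> F" and X: "noise_image P \<beta> F X h" and Y: "noise_image P \<beta> F Y k"
  shows "noise_image P \<beta> F (\<lambda>\<omega>. p * X \<omega> + q * Y \<omega>) (\<lambda>s \<xi>. complex_of_real p * h s \<xi> + complex_of_real q * k s \<xi>)"
  unfolding noise_image_def
proof (intro conjI allI impI)
  have m: "X \<in> borel_measurable P" "joint_measurable h" "Y \<in> borel_measurable P" "joint_measurable k"
    using X Y by (simp_all add: noise_image_def)
  note [measurable] = m
  show mm: "(\<lambda>\<omega>. p * X \<omega> + q * Y \<omega>) \<in> borel_measurable P" by simp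
  show mh: "joint_measurable (\<lambda>s \<xi>. complex_of_real p * h s \<xi> + complex_of_real q * k s \<xi>)" by measurable
  fix \<epsilon> :: real assume e: "\<epsilon> > 0"
  \<comment> \<open>Small enough that 2 p^2 d + 2 q^2 d < \<epsilon>; the summand 1 keeps the
    denominator positive when p = q = 0.\<close>
  define d where "d = \<epsilon> / (4 * (p\<^sup>2 + q\<^sup>2 + 1))"
  have d: "d > 0" using e by (auto simp: d_def intro!: divide_pos_pos add_nonneg_pos)
  obtain J a where J: "finite J" "J \<subseteq> test_functions" "L2_dist2 P (noise_comb F J a) X < ennreal d"
    "spectral_dist2 \<beta> (fourier_comb J a) h < ennreal d"
    using X d by (auto simp: noise_image_def)
  obtain K b where K: "finite K" "K \<subseteq> test_functions" "L2_dist2 P (noise_comb F K b) Y < ennreal d"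
    "spectral_dist2 \<beta> (fourier_comb K b) k < ennreal d"
    using Y d by (auto simp: noise_image_def)
  \<comment> \<open>The two index sets may overlap; on the overlap both contributions are
    added.\<close>
  define c where "c \<phi> = (if \<phi> \<in> J then p * a \<phi> else 0) + (if \<phi> \<in> K then q * b \<phi> else 0)" for \<phi>
  have sp: "(\<Sum>\<phi>\<in>J \<union> K. complex_of_real (c \<phi>) * f \<phi>) =
     complex_of_real p * (\<Sum>\<phi>\<in>J. complex_of_real (a \<phi>) * f \<phi>) + complex_of_real q * (\<Sum>\<phi>\<in>K. complex_of_real (b \<phi>) * f \<phi>)" for f
  proof -
    have "(\<Sum>\<phi>\<in>J \<union> K. complex_of_real (c \<phi>) * f \<phi>) =
      (\<Sum>\<phi>\<in>J \<union> K. if \<phi> \<in> J then complex_of_real p * (complex_of_real (a \<phi>) * f \<phi>) else 0) +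
      (\<Sum>\<phi>\<in>J \<union> K. if \<phi> \<in> K then complex_of_real q * (complex_of_real (b \<phi>) * f \<phi>) else 0)"
      unfolding sum.distrib[symmetric] by (intro sum.cong) (auto simp: c_def algebra_simps)
    then show ?thesis
      using J(1) K(1) by (simp add: sum.If_cases Int_absorb1 sum_distrib_left)
  qed
  have fc: "fourier_comb (J \<union> K) c = (\<lambda>s \<xi>. complex_of_real p * fourier_comb J a s \<xi> + complex_of_real q * fourier_comb K b s \<xi>)"
    unfolding fourier_comb_def sp ..
  have nc: "noise_comb F (J \<union> K) c = (\<lambda>\<omega>. p * noise_comb F J a \<omega> + q * noise_comb F K b \<omega>)"
  proof
    fix \<omega>
    \<comment> \<open>The identity \<open>sp\<close> for symbols also serves the random variables,
      through the embedding of the reals into the complex numbers.\<close>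
    have "complex_of_real (noise_comb F (J \<union> K) c \<omega>) = complex_of_real (p * noise_comb F J a \<omega> + q * noise_comb F K b \<omega>)"
      using sp[of "\<lambda>\<phi>. complex_of_real (F \<phi> \<omega>)"] by (simp add: noise_comb_def)
    then show "noise_comb F (J \<union> K) c \<omega> = p * noise_comb F J a \<omega> + q * noise_comb F K b \<omega>"
      by (simp only: of_real_eq_iff)
  qed
  have small: "2 * (ennreal (p\<^sup>2) * x) + 2 * (ennreal (q\<^sup>2) * y) < ennreal \<epsilon>" if lt: "x < ennreal d" "y < ennreal d" for x y
  proof -
    obtain x' y' where xy: "x = ennreal x'" "y = ennreal y'" "x' \<ge> 0" "y' \<ge> 0"
      using lt by (cases x; cases y) auto
    have "x' < d" "y' < d" using that xy d by (simp_all add: ennreal_less_iff)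
    then have "2 * (p\<^sup>2 * x') + 2 * (q\<^sup>2 * y') \<le> 2 * (p\<^sup>2 * d) + 2 * (q\<^sup>2 * d)"
      by (intro add_mono mult_left_mono) simp_all
    also have "\<dots> < 4 * (p\<^sup>2 + q\<^sup>2 + 1) * d" using d by (simp add: algebra_simps add_strict_increasing2 add_pos_nonneg)
    also have "\<dots> = \<epsilon>"
    proof -
      have "p\<^sup>2 + q\<^sup>2 + 1 > 0" by (auto intro: add_nonneg_pos)
      then show ?thesis by (simp add: d_def)
    qed
    finally show ?thesis using xy e
      by (simp add: ennreal_less_iff ennreal_mult[symmetric] ennreal_plus[symmetric] flip: ennreal_numeral del: ennreal_plus)
  qed
  have mJ: "noise_comb F J a \<in> borel_measurable P" "noise_comb F K b \<in> borel_measurable P"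
    by (rule noise_comb_measurable[OF F J(1,2)], rule noise_comb_measurable[OF F K(1,2)])
  have fJ: "joint_measurable (fourier_comb J a)" "joint_measurable (fourier_comb K b)"
    by (rule fourier_comb_joint_measurable[OF J(2)], rule fourier_comb_joint_measurable[OF K(2)])
  note [measurable] = mJ fJ
  have scale: "(\<integral>\<^sup>+z. ennreal ((norm (p *\<^sub>R f z))\<^sup>2) \<partial>M) = ennreal (p\<^sup>2) * (\<integral>\<^sup>+z. ennreal ((norm (f z))\<^sup>2) \<partial>M)"
    if [measurable]: "f \<in> borel_measurable M" for p and f :: "'y \<Rightarrow> 'x::{real_normed_vector,second_countable_topology}" and M
    by (simp add: power_mult_distrib ennreal_mult nn_integral_cmult)
  show "\<exists>J a. finite J \<and> J \<subseteq> test_functions \<and>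
        L2_dist2 P (noise_comb F J a) (\<lambda>\<omega>. p * X \<omega> + q * Y \<omega>) < ennreal \<epsilon> \<and>
        spectral_dist2 \<beta> (fourier_comb J a) (\<lambda>s \<xi>. complex_of_real p * h s \<xi> + complex_of_real q * k s \<xi>) < ennreal \<epsilon>"
  proof (intro exI conjI)
    show "finite (J \<union> K)" "J \<union> K \<subseteq> test_functions" using J K by auto
    have "L2_dist2 P (noise_comb F (J \<union> K) c) (\<lambda>\<omega>. p * X \<omega> + q * Y \<omega>) =
       (\<integral>\<^sup>+\<omega>. ennreal ((norm (p *\<^sub>R (noise_comb F J a \<omega> - X \<omega>) + q *\<^sub>R (noise_comb F K b \<omega> - Y \<omega>)))\<^sup>2) \<partial>P)"
      unfolding L2_dist2_def nc by (simp add: algebra_simps)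
    also have "\<dots> \<le> 2 * (\<integral>\<^sup>+\<omega>. ennreal ((norm (p *\<^sub>R (noise_comb F J a \<omega> - X \<omega>)))\<^sup>2) \<partial>P) +
        2 * (\<integral>\<^sup>+\<omega>. ennreal ((norm (q *\<^sub>R (noise_comb F K b \<omega> - Y \<omega>)))\<^sup>2) \<partial>P)"
      by (rule nn_integral_norm_add_power2_le) simp_all
    also have "\<dots> = 2 * (ennreal (p\<^sup>2) * L2_dist2 P (noise_comb F J a) X) + 2 * (ennreal (q\<^sup>2) * L2_dist2 P (noise_comb F K b) Y)"
      by (subst (1 2) scale) (simp_all add: L2_dist2_def)
    also have "\<dots> < ennreal \<epsilon>" by (rule small[OF J(3) K(3)])
    finally show "L2_dist2 P (noise_comb F (J \<union> K) c) (\<lambda>\<omega>. p * X \<omega> + q * Y \<omega>) < ennreal \<epsilon>" .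
    let ?S = "space_time_spectral \<beta>"
    note st = m(2,4)[THEN joint_measurable_space_time] fJ[THEN joint_measurable_space_time]
    have "spectral_dist2 \<beta> (fourier_comb (J \<union> K) c) (\<lambda>s \<xi>. complex_of_real p * h s \<xi> + complex_of_real q * k s \<xi>) =
       (\<integral>\<^sup>+z. ennreal ((norm (p *\<^sub>R (fourier_comb J a (fst z) (snd z) - h (fst z) (snd z)) +
           q *\<^sub>R (fourier_comb K b (fst z) (snd z) - k (fst z) (snd z))))\<^sup>2) \<partial>?S)"
      unfolding fc by (subst spectral_dist2_eq) (measurable, simp add: algebra_simps scaleR_conv_of_real)
    also have "\<dots> \<le> 2 * (\<integral>\<^sup>+z. ennreal ((norm (p *\<^sub>R (fourier_comb J a (fst z) (snd z) - h (fst z) (snd z))))\<^sup>2) \<partial>?S) +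
        2 * (\<integral>\<^sup>+z. ennreal ((norm (q *\<^sub>R (fourier_comb K b (fst z) (snd z) - k (fst z) (snd z))))\<^sup>2) \<partial>?S)"
      using st by (intro nn_integral_norm_add_power2_le) simp_all
    also have "\<dots> = 2 * (ennreal (p\<^sup>2) * spectral_dist2 \<beta> (fourier_comb J a) h) + 2 * (ennreal (q\<^sup>2) * spectral_dist2 \<beta> (fourier_comb K b) k)"
      using st by (subst (1 2) scale) (simp_all add: spectral_dist2_eq[OF fJ(1) m(2)] spectral_dist2_eq[OF fJ(2) m(4)])
    also have "\<dots> < ennreal \<epsilon>" by (rule small[OF J(4) K(4)])
    finally show "spectral_dist2 \<beta> (fourier_comb (J \<union> K) c) (\<lambda>s \<xi>. complex_of_real p * h s \<xi> + complex_of_real q * k s \<xi>) < ennreal \<epsilon>" .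
  qed
qed

text \<open>The order of limits matters: d tends to 0 while e is fixed, since (1 + 1/e) c(e) may
  blow up; only afterwards does e tend to 0. The instance e = d = 1 first shows that x is
  finite.\<close>

lemma ennreal_le_weighted_limit:
  fixes x y :: ennreal and c :: "real \<Rightarrow> real"
  assumes le: "\<And>e d. e > 0 \<Longrightarrow> d > 0 \<Longrightarrow>
      x \<le> ennreal (1 + e) * (ennreal (1 + e) * y) + ennreal (1 + 1 / e) * (ennreal (c e) * ennreal d)"
    and c: "\<And>e. e > 0 \<Longrightarrow> c e \<ge> 0"
  shows "x \<le> y"
proof (cases "y = \<infinity>")
  case False
  then obtain y' where y: "y = ennreal y'" "y' \<ge> 0" by (cases y) auto
  have fin: "x \<le> ennreal ((1 + e) * ((1 + e) * y') + (1 + 1 / e) * (c e * d))" if "e > 0" "d > 0" for e d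
    using le[OF that] that y c[OF that(1)]
    by (simp add: ennreal_mult[symmetric] ennreal_plus[symmetric] del: ennreal_plus)
  obtain x' where x: "x = ennreal x'" "x' \<ge> 0"
    using fin[of 1 1] by (cases x) (auto simp: top_unique)
  have fin': "x' \<le> (1 + e) * ((1 + e) * y') + (1 + 1 / e) * (c e * d)" if "e > 0" "d > 0" for e d
  proof -
    have "0 \<le> (1 + e) * ((1 + e) * y') + (1 + 1 / e) * (c e * d)"
      using that y c[OF that(1)] by (intro add_nonneg_nonneg mult_nonneg_nonneg) simp_all
    then show ?thesis using fin[OF that] x by (simp add: ennreal_le_iff)
  qed
  have "x' \<le> (1 + 0) * ((1 + 0) * y')"
  proof (rule le_limit_at_0[where d=1 and f="\<lambda>e. (1 + e) * ((1 + e) * y')"])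
    fix e :: real assume e: "e > 0"
    have "x' \<le> (1 + e) * ((1 + e) * y') + (1 + 1 / e) * (c e * 0)"
    proof (rule le_limit_at_0[where d=1 and f="\<lambda>d. (1 + e) * ((1 + e) * y') + (1 + 1 / e) * (c e * d)"])
      show "((\<lambda>d. (1 + e) * ((1 + e) * y') + (1 + 1 / e) * (c e * d)) \<longlongrightarrow>
          (1 + e) * ((1 + e) * y') + (1 + 1 / e) * (c e * 0)) (at_right 0)"
        by (intro tendsto_intros)
    qed (use fin' e in simp_all)
    then show "x' \<le> (1 + e) * ((1 + e) * y')" by simp
  next
    show "((\<lambda>e. (1 + e) * ((1 + e) * y')) \<longlongrightarrow> (1 + 0) * ((1 + 0) * y')) (at_right 0)"
      by (intro tendsto_intros)
  qed simp
  then show ?thesis using x y by (simp add: ennreal_leI)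
qed simp

text \<open>One combination approximates both the variable and its symbol, and for the combination
  the isometry is exact. Two weighted inequalities in each direction transfer it to the limit, up to
  a factor (1 + e)^2 and an error proportional to d.\<close>

lemma noise_image_second_moment:
  assumes b: "0 < \<beta>" "\<beta> < 2"
  obtains C where "C > 0"
    "\<And>(P :: 'w measure) F X h. prob_space P \<Longrightarrow> riesz_noise P \<beta> F \<Longrightarrow> noise_image P \<beta> F X h \<Longrightarrow>
       gaussian_limit P X \<and> ennreal (LINT \<omega>|P. (X \<omega>)\<^sup>2) = ennreal C * spectral_dist2 \<beta> h (\<lambda>_ _. 0)"
proof -
  from noise_comb_isometry[OF b] obtain C where C: "C > 0"
    "\<And>(P :: 'w measure) F J a. prob_space P \<Longrightarrow> riesz_noise P \<beta> F \<Longrightarrow> finite J \<Longrightarrow> J \<subseteq> test_functions \<Longrightarrow>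
       ennreal (LINT \<omega>|P. (noise_comb F J a \<omega>)\<^sup>2) = ennreal C * spectral_dist2 \<beta> (fourier_comb J a) (\<lambda>_ _. 0)"
    by blast
  have "gaussian_limit P X \<and> ennreal (LINT \<omega>|P. (X \<omega>)\<^sup>2) = ennreal C * spectral_dist2 \<beta> h (\<lambda>_ _. 0)"
    if P: "prob_space P" and F: "riesz_noise P \<beta> F" and X: "noise_image P \<beta> F X h" for P :: "'w measure" and F X h
  proof
    have [measurable]: "X \<in> borel_measurable P" "joint_measurable h" using X by (simp_all add: noise_image_def)
    show g: "gaussian_limit P X"
      unfolding gaussian_limit_def
    proof (intro conjI allI impI)
      fix \<epsilon> :: real assume "\<epsilon> > 0"
      then obtain J a where "finite J" "J \<subseteq> test_functions" "L2_dist2 P (noise_comb F J a) X < ennreal \<epsilon>"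
        using X by (auto simp: noise_image_def)
      then show "\<exists>G. centred_gaussian P G \<and> L2_dist2 P G X < ennreal \<epsilon>"
        using noise_comb_second_moment(1)[OF P F] by blast
    qed simp
    let ?S = "space_time_spectral \<beta>"
    define A where "A X = (\<integral>\<^sup>+\<omega>. ennreal ((norm (X \<omega>))\<^sup>2) \<partial>P)" for X :: "_ \<Rightarrow> real"
    define N where "N h = (\<integral>\<^sup>+z. ennreal ((norm (h (fst z) (snd z)))\<^sup>2) \<partial>?S)" for h :: "real \<Rightarrow> real^3 \<Rightarrow> complex"
    have N: "spectral_dist2 \<beta> h (\<lambda>_ _. 0) = N h" if "joint_measurable h" for h
      unfolding N_def by (subst spectral_dist2_eq[OF that]) simp_all
    have AX: "ennreal (LINT \<omega>|P. (X \<omega>)\<^sup>2) = A X"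
      unfolding A_def using gaussian_limit_integrable[OF P g] by (simp add: nn_integral_eq_integral)
    have appr: "\<exists>J a. finite J \<and> J \<subseteq> test_functions \<and> A (noise_comb F J a) = ennreal C * N (fourier_comb J a) \<and>
        A (\<lambda>\<omega>. noise_comb F J a \<omega> - X \<omega>) < ennreal d \<and> N (\<lambda>s \<xi>. fourier_comb J a s \<xi> - h s \<xi>) < ennreal d"
      if d: "d > 0" for d
    proof -
      obtain J a where J: "finite J" "J \<subseteq> test_functions" and *: "L2_dist2 P (noise_comb F J a) X < ennreal d"
        "spectral_dist2 \<beta> (fourier_comb J a) h < ennreal d"
        using X d by (auto simp: noise_image_def)
      have "A (noise_comb F J a) = ennreal (LINT \<omega>|P. (noise_comb F J a \<omega>)\<^sup>2)"
        unfolding A_def using centred_gaussian_moment(1)[OF P noise_comb_second_moment(1)[OF P F J], where k=1]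
        by (simp add: nn_integral_eq_integral)
      also have "\<dots> = ennreal C * N (fourier_comb J a)"
        by (simp only: C(2)[OF P F J] N[OF fourier_comb_joint_measurable[OF J(2)]])
      finally have "A (noise_comb F J a) = ennreal C * N (fourier_comb J a)" .
      moreover have "A (\<lambda>\<omega>. noise_comb F J a \<omega> - X \<omega>) < ennreal d" using *(1) by (simp add: A_def L2_dist2_def)
      moreover have "N (\<lambda>s \<xi>. fourier_comb J a s \<xi> - h s \<xi>) < ennreal d"
        using *(2) spectral_dist2_eq[OF fourier_comb_joint_measurable[OF J(2)] \<open>joint_measurable h\<close>]
        by (simp add: N_def)
      ultimately show ?thesis using J by blast
    qed
    have wX: "A Y \<le> ennreal (1 + e) * A Z + ennreal (1 + 1 / e) * A (\<lambda>\<omega>. Y \<omega> - Z \<omega>)"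
      if "e > 0" "Y \<in> borel_measurable P" "Z \<in> borel_measurable P" for Y Z e
      unfolding A_def using that by (intro nn_integral_norm_power2_weighted)
    have wN: "N k \<le> ennreal (1 + e) * N l + ennreal (1 + 1 / e) * N (\<lambda>s \<xi>. k s \<xi> - l s \<xi>)"
      if "e > 0" "joint_measurable k" "joint_measurable l" for k l e
      unfolding N_def using that by (intro nn_integral_norm_power2_weighted joint_measurable_space_time)
    have A_comm: "A (\<lambda>\<omega>. Y \<omega> - Z \<omega>) = A (\<lambda>\<omega>. Z \<omega> - Y \<omega>)" for Y Z
      unfolding A_def by (simp add: norm_minus_commute power2_commute)
    have N_comm: "N (\<lambda>s \<xi>. k s \<xi> - l s \<xi>) = N (\<lambda>s \<xi>. l s \<xi> - k s \<xi>)" for k l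
      unfolding N_def by (simp add: norm_minus_commute)
    have two: "A X \<le> ennreal (1 + e) * (ennreal (1 + e) * (ennreal C * N h)) +
        ennreal (1 + 1 / e) * (ennreal (C * (1 + e) + 1) * ennreal d) \<and>
      ennreal C * N h \<le> ennreal (1 + e) * (ennreal (1 + e) * A X) +
        ennreal (1 + 1 / e) * (ennreal (C + 1 + e) * ennreal d)" if e: "e > 0" and d: "d > 0" for e d
    proof -
      obtain J a where J: "finite J" "J \<subseteq> test_functions" "A (noise_comb F J a) = ennreal C * N (fourier_comb J a)"
        and AJ: "A (\<lambda>\<omega>. noise_comb F J a \<omega> - X \<omega>) < ennreal d" and NJ: "N (\<lambda>s \<xi>. fourier_comb J a s \<xi> - h s \<xi>) < ennreal d"
        using appr[OF d] by blast
      have [measurable]: "noise_comb F J a \<in> borel_measurable P" "joint_measurable (fourier_comb J a)"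
        using noise_comb_measurable[OF F J(1,2)] fourier_comb_joint_measurable[OF J(2)] by simp_all
      let ?G = "noise_comb F J a" and ?k = "fourier_comb J a"
      let ?p = "ennreal (1 + e)" and ?q = "ennreal (1 + 1 / e)"
      have "A X \<le> ?p * A ?G + ?q * A (\<lambda>\<omega>. X \<omega> - ?G \<omega>)" by (rule wX) (use e in simp_all)
      also have "\<dots> \<le> ?p * (ennreal C * (?p * N h + ?q * ennreal d)) + ?q * ennreal d"
      proof (intro add_mono mult_left_mono)
        have "N ?k \<le> ?p * N h + ?q * N (\<lambda>s \<xi>. ?k s \<xi> - h s \<xi>)" by (rule wN) (use e in simp_all)
        also have "\<dots> \<le> ?p * N h + ?q * ennreal d" using NJ by (intro add_left_mono mult_left_mono) simp_all
        finally show "A ?G \<le> ennreal C * (?p * N h + ?q * ennreal d)" unfolding J(3) by (rule mult_left_mono) simp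
        show "A (\<lambda>\<omega>. X \<omega> - ?G \<omega>) \<le> ennreal d" using AJ by (simp add: A_comm[of X])
      qed simp_all
      also have "\<dots> = ?p * (?p * (ennreal C * N h)) + ?q * (ennreal (C * (1 + e) + 1) * ennreal d)"
      proof -
        have "ennreal (C * (1 + e) + 1) = ennreal C * ?p + 1"
          using C(1) e by (simp add: ennreal_mult[symmetric] ennreal_plus[symmetric] del: ennreal_plus flip: ennreal_1)
        moreover have "p * (c * (p * n + q * r)) + q * r = p * (p * (c * n)) + q * ((c * p + 1) * r)" for p c n q r :: ennreal
          by (simp add: distrib_left distrib_right mult_ac add_ac)
        ultimately show ?thesis by simp
      qed
      finally have 1: "A X \<le> ?p * (?p * (ennreal C * N h)) + ?q * (ennreal (C * (1 + e) + 1) * ennreal d)" .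
      have "ennreal C * N h \<le> ennreal C * (?p * N ?k + ?q * N (\<lambda>s \<xi>. h s \<xi> - ?k s \<xi>))"
        by (intro mult_left_mono wN) (use e in simp_all)
      also have "\<dots> = ?p * A ?G + ?q * (ennreal C * N (\<lambda>s \<xi>. ?k s \<xi> - h s \<xi>))"
        unfolding J(3) N_comm[of h] by (simp add: distrib_left mult_ac)
      also have "\<dots> \<le> ?p * (?p * A X + ?q * ennreal d) + ?q * (ennreal C * ennreal d)"
      proof (intro add_mono mult_left_mono)
        have "A ?G \<le> ?p * A X + ?q * A (\<lambda>\<omega>. ?G \<omega> - X \<omega>)" by (rule wX) (use e in simp_all)
        also have "\<dots> \<le> ?p * A X + ?q * ennreal d" using AJ by (intro add_left_mono mult_left_mono) simp_all
        finally show "A ?G \<le> ?p * A X + ?q * ennreal d" .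
      qed (use NJ in simp_all)
      also have "\<dots> = ?p * (?p * A X) + ?q * (ennreal (C + 1 + e) * ennreal d)"
      proof -
        have "ennreal (C + 1 + e) = ?p + ennreal C"
          using C(1) e by (simp add: ennreal_plus[symmetric] add_ac del: ennreal_plus)
        moreover have "p * (p * n + q * r) + q * (c * r) = p * (p * n) + q * ((p + c) * r)" for p c n q r :: ennreal
          by (simp add: distrib_left distrib_right mult_ac add_ac)
        ultimately show ?thesis by simp
      qed
      finally show ?thesis using 1 by blast
    qed
    have "A X \<le> ennreal C * N h \<and> ennreal C * N h \<le> A X"
    proof
      show "A X \<le> ennreal C * N h"
        by (rule ennreal_le_weighted_limit[where c="\<lambda>e. C * (1 + e) + 1"]) (use two C(1) in auto)
      show "ennreal C * N h \<le> A X"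
        by (rule ennreal_le_weighted_limit[where c="\<lambda>e. C + 1 + e"]) (use two C(1) in auto)
    qed
    then show "ennreal (LINT \<omega>|P. (X \<omega>)\<^sup>2) = ennreal C * spectral_dist2 \<beta> h (\<lambda>_ _. 0)"
      unfolding AX N[OF \<open>joint_measurable h\<close>] by (intro antisym) simp_all
  qed
  then show thesis using that[OF C(1)] by blast
qed

section \<open>From the noise through the martingale measure to the solution\<close>

lemma fourier_scale_add:
  assumes "integrable lborel f" "integrable lborel g"
  shows "fourier (\<lambda>y. c * f y + g y) \<xi> = complex_of_real c * fourier f \<xi> + fourier g \<xi>"
proof -
  have i: "integrable lborel (\<lambda>y. cis (- (\<xi> \<bullet> y)) * complex_of_real (f y))" if "integrable lborel f" for f
    by (rule Bochner_Integration.integrable_bound[OF that]) (use that in \<open>auto simp: norm_mult\<close>)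
  have "fourier (\<lambda>y. c * f y + g y) \<xi> =
     (LINT y|lborel. complex_of_real c * (cis (- (\<xi> \<bullet> y)) * complex_of_real (f y)) + cis (- (\<xi> \<bullet> y)) * complex_of_real (g y))"
    unfolding fourier_def by (simp add: algebra_simps)
  then show ?thesis
    using i[OF assms(1)] i[OF assms(2)] by (simp add: fourier_def)
qed

lemma fourier_zero [simp]: "fourier (\<lambda>y. 0) \<xi> = 0"
  by (simp add: fourier_def)

lemma fourier_scale: "fourier (\<lambda>y. c * f y) \<xi> = complex_of_real c * fourier f \<xi>"
  unfolding fourier_def by (simp add: mult.left_commute)

lemma integrable_indicator_bounded:
  fixes A :: "(real^3) set"
  assumes "A \<in> sets borel" "bounded A"
  shows "integrable lborel (indicator A :: _ \<Rightarrow> real)"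
  using assms emeasure_bounded_finite[OF assms(2)] by (intro integrable_real_indicator) simp_all

text \<open>A single test function is a combination with coefficient 1, and a late index of the
  given sequence makes both distances small together.\<close>

lemma noise_image_martingale_measure:
  assumes M: "martingale_measure_extending P \<beta> F M" and F: "riesz_noise P \<beta> F"
    and t: "t \<ge> 0" and A: "A \<in> sets borel" "bounded A"
  shows "noise_image P \<beta> F (M t A) (\<lambda>s. fourier (\<lambda>y. indicator {0..t} s * indicator A y))"
  unfolding noise_image_def
proof (intro conjI allI impI)
  note [measurable] = A(1)
  obtain \<phi> where phi: "\<And>n::nat. \<phi> n \<in> test_functions"
     "(\<lambda>n. spectral_dist2 \<beta> (\<lambda>s. fourier (\<lambda>y. \<phi> n (s, y))) (\<lambda>s. fourier (\<lambda>y. indicator {0..t} s * indicator A y))) \<longlonglongrightarrow> 0"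
     "(\<lambda>n. L2_dist2 P (F (\<phi> n)) (M t A)) \<longlonglongrightarrow> 0" and m: "M t A \<in> borel_measurable P"
    using M t A unfolding martingale_measure_extending_def by metis
  show "M t A \<in> borel_measurable P" by (rule m)
  show "joint_measurable (\<lambda>s. fourier (\<lambda>y. indicator {0..t} s * indicator A y))"
    by (rule fourier_measurable_param) measurable
  fix \<epsilon> :: real assume "\<epsilon> > 0"
  then have e: "ennreal \<epsilon> > 0" by simp
  obtain n where n: "spectral_dist2 \<beta> (\<lambda>s. fourier (\<lambda>y. \<phi> n (s, y))) (\<lambda>s. fourier (\<lambda>y. indicator {0..t} s * indicator A y)) < ennreal \<epsilon>"
    "L2_dist2 P (F (\<phi> n)) (M t A) < ennreal \<epsilon>"
    using eventually_happens'[OF _ eventually_conj[OF order_tendstoD(2)[OF phi(2) e] order_tendstoD(2)[OF phi(3) e]]]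
    by auto
  have "noise_comb F {\<phi> n} (\<lambda>_. 1) = F (\<phi> n)" by (simp add: noise_comb_def[abs_def])
  moreover have "fourier_comb {\<phi> n} (\<lambda>_. 1) = (\<lambda>s. fourier (\<lambda>y. \<phi> n (s, y)))" by (simp add: fourier_comb_def[abs_def])
  ultimately show "\<exists>J a. finite J \<and> J \<subseteq> test_functions \<and> L2_dist2 P (noise_comb F J a) (M t A) < ennreal \<epsilon> \<and>
      spectral_dist2 \<beta> (fourier_comb J a) (\<lambda>s. fourier (\<lambda>y. indicator {0..t} s * indicator A y)) < ennreal \<epsilon>"
    using n phi(1) by (intro exI[of _ "{\<phi> n}"] exI[of _ "\<lambda>_. 1"]) simp
qed

lemma integrable_elementary_fun:
  assumes "is_elementary g"
  shows "integrable lborel (elementary_fun g s)"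
  using assms
proof (induction g)
  case (Cons x g)
  obtain a r q A where x: "x = (a, r, q, A)" by (cases x) auto
  have "integrable lborel (\<lambda>y. a * indicator {r<..q} s * indicator A y + elementary_fun g s y)"
    using Cons x integrable_indicator_bounded[of A]
    by (intro Bochner_Integration.integrable_add integrable_mult_right) (auto simp: is_elementary_def)
  then show ?case by (simp add: x elementary_fun_def[abs_def])
qed (simp add: elementary_fun_def[abs_def])

text \<open>The interval (r,q] is [0,q] without [0,r], in accordance with
  \<open>M q A - M r A\<close>; induction along the list adds one such difference at a time.\<close>

lemma noise_image_elementary:
  assumes M: "martingale_measure_extending P \<beta> F M" and F: "riesz_noise P \<beta> F" and g: "is_elementary g"
  shows "noise_image P \<beta> F (elementary_integral M g) (\<lambda>s. fourier (elementary_fun g s))"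
  using g
proof (induction g)
  case Nil
  show ?case
    unfolding noise_image_def
  proof (intro conjI allI impI exI)
    fix \<epsilon> :: real assume "\<epsilon> > 0"
    show "L2_dist2 P (noise_comb F {} (\<lambda>_. 0)) (elementary_integral M []) < ennreal \<epsilon>"
      using \<open>\<epsilon> > 0\<close> by (simp add: L2_dist2_def noise_comb_def elementary_integral_def)
    show "spectral_dist2 \<beta> (fourier_comb {} (\<lambda>_. 0)) (\<lambda>s. fourier (elementary_fun [] s)) < ennreal \<epsilon>"
      using \<open>\<epsilon> > 0\<close> by (simp add: spectral_dist2_def fourier_comb_def elementary_fun_def[abs_def])
  qed (simp_all add: elementary_integral_def[abs_def] elementary_fun_def[abs_def])
next
  case (Cons x g)
  obtain a r q A where x: "x = (a, r, q, A)" by (cases x) auto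
  have rq: "0 \<le> r" "r \<le> q" "A \<in> sets borel" "bounded A" and g: "is_elementary g"
    using Cons.prems x by (auto simp: is_elementary_def)
  let ?h = "\<lambda>t s. fourier (\<lambda>y. indicator {0..t} s * indicator A y)"
  have q0: "0 \<le> q" using rq by simp
  note Mq = noise_image_martingale_measure[OF M F q0 rq(3,4)]
    and Mr = noise_image_martingale_measure[OF M F rq(1) rq(3,4)]
  have *: "noise_image P \<beta> F (\<lambda>\<omega>. a * (1 * M q A \<omega> + (-1) * M r A \<omega>) + 1 * elementary_integral M g \<omega>)
     (\<lambda>s \<xi>. complex_of_real a * (complex_of_real 1 * ?h q s \<xi> + complex_of_real (-1) * ?h r s \<xi>) +
        complex_of_real 1 * fourier (elementary_fun g s) \<xi>)"
    by (rule noise_image_lin[OF F noise_image_lin[OF F Mq Mr] Cons.IH[OF g]])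
  have "complex_of_real a * (complex_of_real 1 * ?h q s \<xi> + complex_of_real (-1) * ?h r s \<xi>) +
        complex_of_real 1 * fourier (elementary_fun g s) \<xi> = fourier (elementary_fun (x # g) s) \<xi>" for s \<xi>
  proof -
    have "fourier (elementary_fun (x # g) s) \<xi> = fourier (\<lambda>y. (a * indicator {r<..q} s) * indicator A y + elementary_fun g s y) \<xi>"
      by (simp add: x elementary_fun_def[abs_def])
    also have "\<dots> = complex_of_real (a * indicator {r<..q} s) * fourier (indicator A) \<xi> + fourier (elementary_fun g s) \<xi>"
      by (rule fourier_scale_add[OF integrable_indicator_bounded[OF rq(3,4)] integrable_elementary_fun[OF g]])
    also have "indicator {r<..q} s = (indicator {0..q} s - indicator {0..r} s :: real)"
      using rq by (auto simp: indicator_def)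
    finally show ?thesis unfolding fourier_scale by (simp add: algebra_simps)
  qed
  moreover have "(\<lambda>\<omega>. a * (1 * M q A \<omega> + (-1) * M r A \<omega>) + 1 * elementary_integral M g \<omega>) = elementary_integral M (x # g)"
    by (auto simp: x elementary_integral_def)
  ultimately show ?case using * by (simp only:)
qed

definition wave_hat :: "real \<Rightarrow> real^3 \<Rightarrow> real \<Rightarrow> real^3 \<Rightarrow> complex" where
  "wave_hat t x s \<xi> = (if 0 \<le> s \<and> s < t
     then cis (- (\<xi> \<bullet> x)) * complex_of_real (sin ((t - s) * norm \<xi>) / norm \<xi>) else 0)"

lemma wave_hat_joint_measurable: "joint_measurable (wave_hat t x)"
  unfolding wave_hat_def by measurable

lemma AE_spectral_measure_nonzero: "AE \<xi> in spectral_measure \<beta>. \<xi> \<noteq> 0"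
  unfolding spectral_measure_def
  by (subst AE_density) (auto intro: eventually_mono[OF AE_lborel_singleton[of 0]])

text \<open>The explicit transform of the kernel holds off the origin, and the spectral measure,
  having a Lebesgue density, gives the origin no mass.\<close>

lemma noise_image_wave_solution:
  assumes M: "martingale_measure_extending P \<beta> F M" and F: "riesz_noise P \<beta> F"
    and u: "wave_solution P \<beta> M T u" and t: "t \<in> {0..T}"
  shows "noise_image P \<beta> F (u t x) (wave_hat t x)"
proof -
  have "is_stochastic_integral P \<beta> M (wave_kernel t x) (u t x)"
    using u t by (simp add: wave_solution_def)
  then obtain g where um: "u t x \<in> borel_measurable P" and g: "\<And>n::nat. is_elementary (g n)"
    and s: "(\<lambda>n. spectral_dist2 \<beta> (\<lambda>s. fourier (elementary_fun (g n) s)) (\<lambda>s. fourier_measure (wave_kernel t x s))) \<longlonglongrightarrow> 0"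
    and l: "(\<lambda>n. L2_dist2 P (elementary_integral M (g n)) (u t x)) \<longlonglongrightarrow> 0"
    unfolding is_stochastic_integral_def by blast
  have eq: "spectral_dist2 \<beta> k (\<lambda>s. fourier_measure (wave_kernel t x s)) = spectral_dist2 \<beta> k (wave_hat t x)" for k
    unfolding spectral_dist2_def
    by (intro nn_integral_cong arg_cong2[where f="(*)"] nn_integral_cong_AE refl
        eventually_mono[OF AE_spectral_measure_nonzero]) (simp add: fourier_measure_wave_kernel wave_hat_def)
  show ?thesis
  proof (rule noise_image_limit[OF F um wave_hat_joint_measurable])
    fix \<epsilon> :: real assume "\<epsilon> > 0"
    then have e: "ennreal \<epsilon> > 0" by simp
    obtain n where "spectral_dist2 \<beta> (\<lambda>s. fourier (elementary_fun (g n) s)) (wave_hat t x) < ennreal \<epsilon>"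
      "L2_dist2 P (elementary_integral M (g n)) (u t x) < ennreal \<epsilon>"
      using eventually_happens'[OF _ eventually_conj[OF order_tendstoD(2)[OF s e] order_tendstoD(2)[OF l e]]]
      by (auto simp: eq)
    then show "\<exists>Y k. noise_image P \<beta> F Y k \<and> L2_dist2 P Y (u t x) < ennreal \<epsilon> \<and> spectral_dist2 \<beta> k (wave_hat t x) < ennreal \<epsilon>"
      using noise_image_elementary[OF M F g[of n]] by blast
  qed
qed

lemma wave_increment_second_moment:
  assumes b: "0 < \<beta>" "\<beta> < 2"
  obtains C where "C > 0"
    "\<And>(P :: 'w measure) F M T u t t' x y. prob_space P \<Longrightarrow> riesz_noise P \<beta> F \<Longrightarrow>
       martingale_measure_extending P \<beta> F M \<Longrightarrow> wave_solution P \<beta> M T u \<Longrightarrow> t \<in> {0..T} \<Longrightarrow> t' \<in> {0..T} \<Longrightarrow>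
       gaussian_limit P (\<lambda>\<omega>. u t x \<omega> - u t' y \<omega>) \<and>
       ennreal (LINT \<omega>|P. (u t x \<omega> - u t' y \<omega>)\<^sup>2) = ennreal C * spectral_dist2 \<beta> (wave_hat t x) (wave_hat t' y)"
proof -
  from noise_image_second_moment[OF b] obtain C where C: "C > 0"
    "\<And>(P :: 'w measure) F X h. prob_space P \<Longrightarrow> riesz_noise P \<beta> F \<Longrightarrow> noise_image P \<beta> F X h \<Longrightarrow>
       gaussian_limit P X \<and> ennreal (LINT \<omega>|P. (X \<omega>)\<^sup>2) = ennreal C * spectral_dist2 \<beta> h (\<lambda>_ _. 0)" by blast
  show thesis
  proof (rule that[OF C(1)])
    fix P :: "'w measure" and F M T u t t' x y
    assume P: "prob_space P" and F: "riesz_noise P \<beta> F" and M: "martingale_measure_extending P \<beta> F M"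
      and u: "wave_solution P \<beta> M T u" and t: "t \<in> {0..T}" "t' \<in> {0..T}"
    have "noise_image P \<beta> F (\<lambda>\<omega>. 1 * u t x \<omega> + (-1) * u t' y \<omega>)
       (\<lambda>s \<xi>. complex_of_real 1 * wave_hat t x s \<xi> + complex_of_real (-1) * wave_hat t' y s \<xi>)"
      by (rule noise_image_lin[OF F noise_image_wave_solution[OF M F u t(1)] noise_image_wave_solution[OF M F u t(2)]])
    from C(2)[OF P F this]
    show "gaussian_limit P (\<lambda>\<omega>. u t x \<omega> - u t' y \<omega>) \<and>
       ennreal (LINT \<omega>|P. (u t x \<omega> - u t' y \<omega>)\<^sup>2) = ennreal C * spectral_dist2 \<beta> (wave_hat t x) (wave_hat t' y)"
      by (simp add: spectral_dist2_def)
  qed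
qed

section \<open>Increments of the wave kernel\<close>

lemma cmod_cis_diff_power2: "(cmod (cis a - cis b))\<^sup>2 = 2 - 2 * cos (a - b)"
proof -
  have "(cmod (cis a - cis b))\<^sup>2 = (cos a)\<^sup>2 + (sin a)\<^sup>2 + ((cos b)\<^sup>2 + (sin b)\<^sup>2) - 2 * (cos a * cos b + sin a * sin b)"
    unfolding cmod_power2 by (simp add: power2_diff algebra_simps)
  then show ?thesis by (simp add: cos_diff)
qed

lemma cmod_cis_diff_le: "cmod (cis a - cis b) \<le> \<bar>a - b\<bar>"
proof -
  have "2 - 2 * cos (a - b) = (2 * sin ((a - b) / 2))\<^sup>2"
  proof -
    have "2 * ((a - b) / 2) = a - b" by simp
    then show ?thesis using cos_double_sin[of "(a - b) / 2"] by (simp only:) (simp add: power_mult_distrib)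
  qed
  also have "\<dots> \<le> (a - b)\<^sup>2"
    using abs_sin_x_le_abs_x[of "(a - b) / 2"] unfolding abs_le_square_iff[symmetric]
    by (simp add: abs_mult)
  finally show ?thesis
    unfolding cmod_cis_diff_power2[symmetric] abs_le_square_iff[symmetric] by simp
qed

lemma abs_sin_diff_le: "\<bar>sin a - sin b\<bar> \<le> \<bar>a - b\<bar>" for a b :: real
proof -
  have "\<bar>sin a - sin b\<bar> = 2 * \<bar>sin ((a - b) / 2)\<bar> * \<bar>cos ((a + b) / 2)\<bar>"
    by (simp add: sin_diff_sin abs_mult)
  also have "\<dots> \<le> 2 * \<bar>(a - b) / 2\<bar> * 1"
    by (intro mult_mono abs_sin_x_le_abs_x) simp_all
  finally show ?thesis by simp
qed

text \<open>High frequencies use the trivial bound 2 on the numerators. For low ones the Lipschitz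
  estimates apply: the phase contributes |\<xi>| |x - y| and the sine contributes |\<xi>| |t -
  t'|.\<close>

lemma wave_hat_diff_bound:
  assumes "\<xi> \<noteq> 0" "s \<ge> 0" "t \<in> {0..T}" "t' \<in> {0..T}"
  shows "cmod (wave_hat t x s \<xi> - wave_hat t' y s \<xi>) \<le>
    min 2 (norm \<xi> * (\<bar>t - t'\<bar> + norm (x - y))) / norm \<xi> * indicator {0..T} s"
proof (cases "s \<le> T")
  case False
  then show ?thesis using assms by (simp add: wave_hat_def)
next
  case True
  \<comment> \<open>The sine vanishes at 0, so cutting it off at s = t creates no jump: the
    extension by zero is still Lipschitz with constant |\<xi>|, also when s lies between the two
    times.\<close>
  define g where "g r = sin (max r 0 * norm \<xi>)" for r :: real
  have wh: "wave_hat t x s \<xi> = cis (- (\<xi> \<bullet> x)) * complex_of_real (g (t - s)) / complex_of_real (norm \<xi>)" for t x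
    using assms(2) by (simp add: wave_hat_def g_def max_def)
  have lip: "\<bar>g (t - s) - g (t' - s)\<bar> \<le> norm \<xi> * \<bar>t - t'\<bar>"
  proof -
    have "\<bar>g (t - s) - g (t' - s)\<bar> \<le> \<bar>max (t - s) 0 * norm \<xi> - max (t' - s) 0 * norm \<xi>\<bar>"
      unfolding g_def by (rule abs_sin_diff_le)
    also have "\<dots> = \<bar>max (t - s) 0 - max (t' - s) 0\<bar> * norm \<xi>"
      by (simp add: abs_mult flip: left_diff_distrib)
    also have "\<dots> \<le> \<bar>t - t'\<bar> * norm \<xi>" by (intro mult_right_mono) auto
    finally show ?thesis by (simp add: mult.commute)
  qed
  have g1: "\<bar>g r\<bar> \<le> 1" for r by (simp add: g_def)
  let ?a = "cis (- (\<xi> \<bullet> x))" and ?b = "cis (- (\<xi> \<bullet> y))"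
  let ?d = "?a * complex_of_real (g (t - s)) - ?b * complex_of_real (g (t' - s))"
  have "cmod ?d \<le> cmod (?a * complex_of_real (g (t - s))) + cmod (?b * complex_of_real (g (t' - s)))"
    by (rule norm_triangle_ineq4)
  also have "\<dots> \<le> 2" using g1[of "t - s"] g1[of "t' - s"] by (simp add: norm_mult)
  finally have d2: "cmod ?d \<le> 2" .
  have "?d = (?a - ?b) * complex_of_real (g (t - s)) + ?b * complex_of_real (g (t - s) - g (t' - s))"
    by (simp add: algebra_simps)
  then have "cmod ?d \<le> cmod (?a - ?b) * \<bar>g (t - s)\<bar> + \<bar>g (t - s) - g (t' - s)\<bar>"
    using norm_triangle_ineq[of "(?a - ?b) * complex_of_real (g (t - s))" "?b * complex_of_real (g (t - s) - g (t' - s))"]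
    by (simp add: norm_mult del: of_real_diff)
  also have "\<dots> \<le> \<bar>\<xi> \<bullet> (x - y)\<bar> * 1 + norm \<xi> * \<bar>t - t'\<bar>"
    using cmod_cis_diff_le[of "- (\<xi> \<bullet> x)" "- (\<xi> \<bullet> y)"] g1 lip
    by (intro add_mono mult_mono) (simp_all add: inner_diff_right abs_minus_commute)
  also have "\<dots> \<le> norm \<xi> * (\<bar>t - t'\<bar> + norm (x - y))"
    using Cauchy_Schwarz_ineq2[of \<xi> "x - y"] by (simp add: distrib_left)
  finally have "cmod ?d \<le> min 2 (norm \<xi> * (\<bar>t - t'\<bar> + norm (x - y)))" using d2 by simp
  moreover have "cmod (wave_hat t x s \<xi> - wave_hat t' y s \<xi>) = cmod ?d / norm \<xi>"
    unfolding wh by (simp add: norm_divide flip: diff_divide_distrib)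
  ultimately show ?thesis using True assms(2) by (simp add: divide_right_mono)
qed

section \<open>Upper bound by scaling\<close>

text \<open>With the polar weight the integrand is of order r^(\<beta>-1) at the origin and
  r^(\<beta>-3) at infinity, and 0 < \<beta> < 2 makes both ends integrable.\<close>

lemma spectral_energy_finite:
  assumes b: "0 < \<beta>" "\<beta> < 2"
  shows "(\<integral>\<^sup>+\<xi>. ennreal (norm (\<xi>::real^3) powr (\<beta> - 5) * (min 2 (norm \<xi>))\<^sup>2) \<partial>lborel) < \<infinity>"
proof -
  have "(\<integral>\<^sup>+r. ennreal (r powr (\<beta> - 5) * (min 2 r)\<^sup>2) * ennreal (3 * r\<^sup>2) * indicator {0<..} r \<partial>lborel) \<le>
    (\<integral>\<^sup>+r. 3 * (ennreal (r powr (\<beta> - 1)) * indicator {0..1} r) + 12 * (ennreal (r powr (\<beta> - 3)) * indicator {1..} r) \<partial>lborel)"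
  proof (rule nn_integral_mono)
    fix r :: real
    have e: "r powr (\<beta> - 5) * r\<^sup>2 = r powr (\<beta> - 3)" "r powr (\<beta> - 3) * r\<^sup>2 = r powr (\<beta> - 1)" if "r > 0"
      using that by (simp_all flip: powr_numeral powr_add)
    consider "r \<le> 0" | "0 < r" "r < 1" | "r \<ge> 1" by linarith
    then show "ennreal (r powr (\<beta> - 5) * (min 2 r)\<^sup>2) * ennreal (3 * r\<^sup>2) * indicator {0<..} r \<le>
      3 * (ennreal (r powr (\<beta> - 1)) * indicator {0..1} r) + 12 * (ennreal (r powr (\<beta> - 3)) * indicator {1..} r)"
    proof cases
      case 2
      have "(r powr (\<beta> - 5) * (min 2 r)\<^sup>2) * (3 * r\<^sup>2) = 3 * r powr (\<beta> - 1)"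
        using 2 e by (simp add: mult.assoc[symmetric])
      then show ?thesis using 2
        by (simp add: ennreal_mult'[symmetric] flip: ennreal_numeral)
    next
      case 3
      have "(min 2 r)\<^sup>2 \<le> 2\<^sup>2" using 3 by (intro power_mono) auto
      then have "(r powr (\<beta> - 5) * (min 2 r)\<^sup>2) * (3 * r\<^sup>2) \<le> (r powr (\<beta> - 5) * 4) * (3 * r\<^sup>2)"
        by (intro mult_right_mono mult_left_mono) simp_all
      also have "\<dots> = 12 * r powr (\<beta> - 3)"
        using 3 e(1) by simp
      finally have "ennreal (r powr (\<beta> - 5) * (min 2 r)\<^sup>2) * ennreal (3 * r\<^sup>2) \<le> 12 * ennreal (r powr (\<beta> - 3))"
        by (simp add: ennreal_mult'[symmetric] ennreal_leI flip: ennreal_numeral)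
      then show ?thesis using 3 by (intro add_increasing) simp_all
    qed simp
  qed
  also have "\<dots> = 3 * (\<integral>\<^sup>+r. (ennreal (r powr (\<beta> - 1)) * indicator {0..1} r) \<partial>lborel) +
     12 * (\<integral>\<^sup>+r. ennreal (r powr (\<beta> - 3)) * indicator {1..} r \<partial>lborel)"
    by (subst nn_integral_add) (simp_all add: nn_integral_cmult)
  also have "\<dots> < \<infinity>"
    using nn_integral_powr_near_0[of "\<beta> - 1" 1] nn_integral_powr_to_inf[of "\<beta> - 3" 1] b
    by (simp add: ennreal_mult_less_top)
  finally show ?thesis
    by (subst nn_integral_radial[of "\<lambda>r. ennreal (r powr (\<beta> - 5) * (min 2 r)\<^sup>2)"])
      (simp_all add: ennreal_mult_less_top)
qed

text \<open>Passing from \<xi> to \<xi>/d gives d^(-3) from the volume and d^(5-\<beta>) from the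
  weight.\<close>

lemma spectral_energy_scaling:
  assumes d: "d > 0"
  shows "(\<integral>\<^sup>+\<xi>. ennreal (norm (\<xi>::real^3) powr (\<beta> - 5) * (min 2 (norm \<xi> * d))\<^sup>2) \<partial>lborel) =
    ennreal (d powr (2 - \<beta>)) * (\<integral>\<^sup>+\<xi>. ennreal (norm (\<xi>::real^3) powr (\<beta> - 5) * (min 2 (norm \<xi>))\<^sup>2) \<partial>lborel)"
proof -
  have "(\<integral>\<^sup>+\<xi>. ennreal (norm (\<xi>::real^3) powr (\<beta> - 5) * (min 2 (norm \<xi> * d))\<^sup>2) \<partial>lborel) =
     ennreal ((1 / d) ^ 3) * (\<integral>\<^sup>+\<xi>. ennreal (norm ((1 / d) *\<^sub>R (\<xi>::real^3)) powr (\<beta> - 5) * (min 2 (norm ((1 / d) *\<^sub>R \<xi>) * d))\<^sup>2) \<partial>lborel)"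
    using d by (subst nn_integral_lborel_scale[of _ "1 / d"]) simp_all
  also have "\<dots> = ennreal ((1 / d) ^ 3) * (\<integral>\<^sup>+\<xi>. ennreal (d powr (5 - \<beta>)) * ennreal (norm (\<xi>::real^3) powr (\<beta> - 5) * (min 2 (norm \<xi>))\<^sup>2) \<partial>lborel)"
  proof (intro arg_cong[where f="(*) _"] nn_integral_cong)
    fix \<xi> :: "real^3"
    have "norm ((1 / d) *\<^sub>R \<xi>) powr (\<beta> - 5) = d powr (5 - \<beta>) * norm \<xi> powr (\<beta> - 5)"
      using d powr_minus_divide[of d "\<beta> - 5"] by (simp add: powr_divide)
    then show "ennreal (norm ((1 / d) *\<^sub>R \<xi>) powr (\<beta> - 5) * (min 2 (norm ((1 / d) *\<^sub>R \<xi>) * d))\<^sup>2) =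
       ennreal (d powr (5 - \<beta>)) * ennreal (norm \<xi> powr (\<beta> - 5) * (min 2 (norm \<xi>))\<^sup>2)"
      using d by (simp add: ennreal_mult[symmetric] mult.assoc)
  qed
  also have "\<dots> = ennreal ((1 / d) ^ 3) * (ennreal (d powr (5 - \<beta>)) * (\<integral>\<^sup>+\<xi>. ennreal (norm (\<xi>::real^3) powr (\<beta> - 5) * (min 2 (norm \<xi>))\<^sup>2) \<partial>lborel))"
    by (subst nn_integral_cmult) simp_all
  also have "\<dots> = ennreal (d powr (2 - \<beta>)) * (\<integral>\<^sup>+\<xi>. ennreal (norm (\<xi>::real^3) powr (\<beta> - 5) * (min 2 (norm \<xi>))\<^sup>2) \<partial>lborel)"
  proof -
    have "(1 / d) ^ 3 = d powr (- 3)"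
      using d by (simp add: powr_minus power_divide inverse_eq_divide)
    then have "(1 / d) ^ 3 * d powr (5 - \<beta>) = d powr (2 - \<beta>)"
      by (simp flip: powr_add)
    then show ?thesis using d by (simp add: mult.assoc[symmetric] ennreal_mult[symmetric])
  qed
  finally show ?thesis .
qed

lemma wave_hat_dist_upper:
  assumes b: "0 < \<beta>" "\<beta> < 2" and T: "T > 0"
  obtains K where "K > 0" "\<And>t t' x y. t \<in> {0..T} \<Longrightarrow> t' \<in> {0..T} \<Longrightarrow>
     spectral_dist2 \<beta> (wave_hat t x) (wave_hat t' y) \<le> ennreal (K * (\<bar>t - t'\<bar> + norm (x - y)) powr (2 - \<beta>))"
proof -
  obtain I where I: "I \<ge> 0" "(\<integral>\<^sup>+\<xi>. ennreal (norm (\<xi>::real^3) powr (\<beta> - 5) * (min 2 (norm \<xi>))\<^sup>2) \<partial>lborel) = ennreal I"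
    using spectral_energy_finite[OF b]
    by (cases "\<integral>\<^sup>+\<xi>. ennreal (norm (\<xi>::real^3) powr (\<beta> - 5) * (min 2 (norm \<xi>))\<^sup>2) \<partial>lborel") auto
  define c where "c = spectral_const \<beta>"
  have c: "c > 0" using spectral_const_pos b by (simp add: c_def)
  have "spectral_dist2 \<beta> (wave_hat t x) (wave_hat t' y) \<le> ennreal ((T * c * I + 1) * (\<bar>t - t'\<bar> + norm (x - y)) powr (2 - \<beta>))"
    if t: "t \<in> {0..T}" "t' \<in> {0..T}" for t t' x y
  proof -
    define d where "d = \<bar>t - t'\<bar> + norm (x - y)"
    have d: "d \<ge> 0" by (simp add: d_def)
    let ?e = "\<lambda>\<xi>::real^3. (min 2 (norm \<xi> * d) / norm \<xi>)\<^sup>2"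
    have inner: "(\<integral>\<^sup>+\<xi>. ennreal ((cmod (wave_hat t x s \<xi> - wave_hat t' y s \<xi>))\<^sup>2) \<partial>spectral_measure \<beta>) * indicator {0..} s \<le>
        ennreal (c * (I * d powr (2 - \<beta>))) * indicator {0..T} s" for s
    proof (cases "s \<in> {0..T}")
      case True
      have "(\<integral>\<^sup>+\<xi>. ennreal ((cmod (wave_hat t x s \<xi> - wave_hat t' y s \<xi>))\<^sup>2) \<partial>spectral_measure \<beta>) \<le>
         (\<integral>\<^sup>+\<xi>. ennreal (?e \<xi>) \<partial>spectral_measure \<beta>)"
      proof (rule nn_integral_mono_AE, rule eventually_mono[OF AE_spectral_measure_nonzero])
        fix \<xi> :: "real^3" assume "\<xi> \<noteq> 0"
        from wave_hat_diff_bound[OF this _ t, of s x y] True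
        show "ennreal ((cmod (wave_hat t x s \<xi> - wave_hat t' y s \<xi>))\<^sup>2) \<le> ennreal (?e \<xi>)"
          by (intro ennreal_leI power_mono) (simp_all add: d_def)
      qed
      also have "\<dots> = ennreal c * (\<integral>\<^sup>+\<xi>. ennreal (norm \<xi> powr (\<beta> - 3)) * ennreal (?e \<xi>) \<partial>lborel)"
        unfolding c_def using b by (intro nn_integral_spectral_measure) simp_all
      also have "(\<integral>\<^sup>+\<xi>. ennreal (norm \<xi> powr (\<beta> - 3)) * ennreal (?e \<xi>) \<partial>lborel) =
          (\<integral>\<^sup>+\<xi>. ennreal (norm (\<xi>::real^3) powr (\<beta> - 5) * (min 2 (norm \<xi> * d))\<^sup>2) \<partial>lborel)"
      proof (rule nn_integral_cong_AE, rule eventually_mono[OF AE_lborel_singleton[of 0]])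
        fix \<xi> :: "real^3" assume "\<xi> \<noteq> 0"
        then have "norm \<xi> powr (\<beta> - 5) * (norm \<xi>)\<^sup>2 = norm \<xi> powr (\<beta> - 3)"
          by (simp flip: powr_numeral powr_add)
        then have "norm \<xi> powr (\<beta> - 3) / (norm \<xi>)\<^sup>2 = norm \<xi> powr (\<beta> - 5)"
          using \<open>\<xi> \<noteq> 0\<close> by (simp add: field_simps)
        then show "ennreal (norm \<xi> powr (\<beta> - 3)) * ennreal (?e \<xi>) = ennreal (norm \<xi> powr (\<beta> - 5) * (min 2 (norm \<xi> * d))\<^sup>2)"
          by (simp add: ennreal_mult[symmetric] power_divide flip: times_divide_eq_left)
      qed
      also have "\<dots> = ennreal (I * d powr (2 - \<beta>))"
      proof (cases "d = 0")
        case False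
        then have "d > 0" using d by simp
        then show ?thesis using I by (subst spectral_energy_scaling) (simp_all add: ennreal_mult[symmetric] mult.commute)
      qed simp
      finally show ?thesis using True c I by (simp add: ennreal_mult)
    next
      case False
      then have "wave_hat t x s \<xi> = 0" "wave_hat t' y s \<xi> = 0" for \<xi>
        using t by (auto simp: wave_hat_def)
      then show ?thesis by simp
    qed
    have "spectral_dist2 \<beta> (wave_hat t x) (wave_hat t' y) \<le> (\<integral>\<^sup>+s. ennreal (c * (I * d powr (2 - \<beta>))) * indicator {0..T} s \<partial>lborel)"
      unfolding spectral_dist2_def by (intro nn_integral_mono inner)
    also have "\<dots> = ennreal (c * (I * d powr (2 - \<beta>))) * ennreal T"
      using T by (simp add: nn_integral_cmult)
    also have "\<dots> \<le> ennreal ((T * c * I + 1) * d powr (2 - \<beta>))"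
      using c I T by (simp add: ennreal_mult[symmetric] ennreal_leI algebra_simps)
    finally show ?thesis by (simp add: d_def)
  qed
  then show thesis using that[of "T * c * I + 1"] T c I by (simp add: add_nonneg_pos)
qed

section \<open>Lower bounds from a ball of frequencies\<close>

text \<open>Tonelli's theorem moves the time integral inside, and the frequency integral is then
  restricted to a ball. As \<beta> < 3, the spectral weight decreases in |\<xi>|, so on the ball it
  is at least its value at radius \<open>L\<close>.\<close>

lemma spectral_dist2_lower:
  assumes b: "0 < \<beta>" "\<beta> < 3" and [measurable]: "joint_measurable g" "joint_measurable h"
    and m: "m \<ge> 0" "\<rho> > 0" "L > 0"
    and ball: "\<And>\<xi>. \<xi> \<in> ball w \<rho> \<Longrightarrow> \<xi> \<noteq> 0 \<and> norm \<xi> \<le> L \<and>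
       ennreal m \<le> (\<integral>\<^sup>+s. ennreal ((cmod (g s \<xi> - h s \<xi>))\<^sup>2) * indicator {0..} s \<partial>lborel)"
  shows "ennreal (spectral_const \<beta> * L powr (\<beta> - 3) * m * (4 / 3 * pi * \<rho> ^ 3)) \<le> spectral_dist2 \<beta> g h"
proof -
  have c: "spectral_const \<beta> > 0" by (rule spectral_const_pos[OF b])
  have "ennreal (spectral_const \<beta> * L powr (\<beta> - 3) * m * (4 / 3 * pi * \<rho> ^ 3)) =
     (\<integral>\<^sup>+\<xi>. ennreal (spectral_const \<beta> * L powr (\<beta> - 3) * m) * indicator (ball w \<rho>) \<xi> \<partial>lborel)"
    using c m by (simp add: nn_integral_cmult_indicator emeasure_ball unit_ball_vol_3 ennreal_mult[symmetric])
  also have "\<dots> \<le> (\<integral>\<^sup>+\<xi>. \<integral>\<^sup>+s. (indicator {0..} s * ennreal (spectral_const \<beta> * norm \<xi> powr (\<beta> - 3))) * ennreal ((norm (g s \<xi> - h s \<xi>))\<^sup>2) \<partial>lborel \<partial>lborel)"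
  proof (rule nn_integral_mono)
    fix \<xi> :: "real^3"
    have [measurable]: "(\<lambda>s. g s \<xi>) \<in> borel_measurable borel" "(\<lambda>s. h s \<xi>) \<in> borel_measurable borel"
      by measurable
    show "ennreal (spectral_const \<beta> * L powr (\<beta> - 3) * m) * indicator (ball w \<rho>) \<xi> \<le>
      (\<integral>\<^sup>+s. (indicator {0..} s * ennreal (spectral_const \<beta> * norm \<xi> powr (\<beta> - 3))) * ennreal ((norm (g s \<xi> - h s \<xi>))\<^sup>2) \<partial>lborel)"
    proof (cases "\<xi> \<in> ball w \<rho>")
      case True
      have "L powr (\<beta> - 3) \<le> norm \<xi> powr (\<beta> - 3)"
        using ball[OF True] b by (intro powr_mono2') simp_all
      then have "ennreal (spectral_const \<beta> * L powr (\<beta> - 3)) * ennreal m \<le>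
         ennreal (spectral_const \<beta> * norm \<xi> powr (\<beta> - 3)) * (\<integral>\<^sup>+s. ennreal ((cmod (g s \<xi> - h s \<xi>))\<^sup>2) * indicator {0..} s \<partial>lborel)"
        using ball[OF True] c by (intro mult_mono ennreal_leI mult_left_mono) simp_all
      also have "\<dots> = (\<integral>\<^sup>+s. ennreal (spectral_const \<beta> * norm \<xi> powr (\<beta> - 3)) * (ennreal ((cmod (g s \<xi> - h s \<xi>))\<^sup>2) * indicator {0..} s) \<partial>lborel)"
        by (rule nn_integral_cmult[symmetric]) simp
      finally show ?thesis using True c m by (simp add: ennreal_mult[symmetric] mult_ac)
    qed simp
  qed
  also have "\<dots> = (\<integral>\<^sup>+s. \<integral>\<^sup>+\<xi>. (indicator {0..} s * ennreal (spectral_const \<beta> * norm \<xi> powr (\<beta> - 3))) * ennreal ((norm (g s \<xi> - h s \<xi>))\<^sup>2) \<partial>lborel \<partial>lborel)"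
    by (rule lborel_pair.Fubini') measurable
  also have "\<dots> = spectral_dist2 \<beta> g h"
    unfolding spectral_dist2_def
  proof (rule nn_integral_cong)
    fix s :: real
    have m: "(\<lambda>\<xi>. g s \<xi>) \<in> borel_measurable borel" "(\<lambda>\<xi>. h s \<xi>) \<in> borel_measurable borel"
      by measurable
    have "(\<integral>\<^sup>+\<xi>. ennreal ((cmod (g s \<xi> - h s \<xi>))\<^sup>2) \<partial>spectral_measure \<beta>) =
        (\<integral>\<^sup>+\<xi>. ennreal (spectral_const \<beta> * norm \<xi> powr (\<beta> - 3)) * ennreal ((norm (g s \<xi> - h s \<xi>))\<^sup>2) \<partial>lborel)"
      unfolding spectral_measure_def using m by (subst nn_integral_density) simp_all
    then show "(\<integral>\<^sup>+\<xi>. (indicator {0..} s * ennreal (spectral_const \<beta> * norm \<xi> powr (\<beta> - 3))) * ennreal ((norm (g s \<xi> - h s \<xi>))\<^sup>2) \<partial>lborel) =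
        (\<integral>\<^sup>+\<xi>. ennreal ((cmod (g s \<xi> - h s \<xi>))\<^sup>2) \<partial>spectral_measure \<beta>) * indicator {0..} s"
      by (simp add: indicator_def)
  qed
  finally show ?thesis .
qed

text \<open>The mean of sin^2 is 1/2. The phase vanishes at s = t, so a single boundary term
  remains, of size at most 1/(4k); the condition 1/k \<le> t leaves at least half of the
  mean.\<close>

lemma nn_integral_sin_power2_lower:
  assumes k: "k > 0" "1 / k \<le> t"
  shows "ennreal (t / 4) \<le> (\<integral>\<^sup>+s. ennreal ((sin ((t - s) * k))\<^sup>2) * indicator {0..t} s \<partial>lborel)"
proof -
  let ?F = "\<lambda>s. s / 2 + sin (2 * (t - s) * k) / (4 * k)"
  have t: "t > 0" using k less_le_trans[of 0 "1 / k" t] by simp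
  have "((\<lambda>s. (sin ((t - s) * k))\<^sup>2) has_integral (?F t - ?F 0)) {0..t}"
  proof (rule fundamental_theorem_of_calculus)
    fix s assume "s \<in> {0..t}"
    have "(?F has_real_derivative 1 / 2 + cos (2 * (t - s) * k) * (- 2 * k) / (4 * k)) (at s within {0..t})"
      using k by (auto intro!: derivative_eq_intros)
    moreover have "1 / 2 + cos (2 * (t - s) * k) * (- 2 * k) / (4 * k) = (sin ((t - s) * k))\<^sup>2"
    proof -
      have "cos (2 * (t - s) * k) = 1 - 2 * (sin ((t - s) * k))\<^sup>2"
        using cos_double_sin[of "(t - s) * k"] by (simp only: mult.assoc)
      then show ?thesis using k by (simp add: field_simps)
    qed
    ultimately show "(?F has_vector_derivative (sin ((t - s) * k))\<^sup>2) (at s within {0..t})"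
      by (simp add: has_real_derivative_iff_has_vector_derivative)
  qed (use t in simp)
  from nn_integral_has_integral_lebesgue'[OF _ this]
  have "(\<integral>\<^sup>+s. ennreal ((sin ((t - s) * k))\<^sup>2) * indicator {0..t} s \<partial>lborel) = ennreal (?F t - ?F 0)" by simp
  moreover have "t / 4 \<le> ?F t - ?F 0"
  proof -
    have "sin (2 * t * k) / (4 * k) \<le> 1 / (4 * k)" using k by (intro divide_right_mono) simp_all
    moreover have "1 / (4 * k) \<le> t / 4" using k by (simp add: field_simps)
    ultimately show ?thesis by simp
  qed
  ultimately show ?thesis by (simp add: ennreal_leI)
qed

text \<open>With an arbitrary phase both boundary terms remain, whence the stronger condition 2/k
  \<le> t.\<close>

lemma nn_integral_cos_power2_lower:
  assumes k: "k > 0" "2 / k \<le> t"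
  shows "ennreal (t / 4) \<le> (\<integral>\<^sup>+s. ennreal ((cos ((c - s) * k))\<^sup>2) * indicator {0..t} s \<partial>lborel)"
proof -
  let ?F = "\<lambda>s. s / 2 - sin (2 * (c - s) * k) / (4 * k)"
  have t: "t > 0" using k less_le_trans[of 0 "2 / k" t] by simp
  have "((\<lambda>s. (cos ((c - s) * k))\<^sup>2) has_integral (?F t - ?F 0)) {0..t}"
  proof (rule fundamental_theorem_of_calculus)
    fix s assume "s \<in> {0..t}"
    have "(?F has_real_derivative 1 / 2 - cos (2 * (c - s) * k) * (- 2 * k) / (4 * k)) (at s within {0..t})"
      using k by (auto intro!: derivative_eq_intros)
    moreover have "1 / 2 - cos (2 * (c - s) * k) * (- 2 * k) / (4 * k) = (cos ((c - s) * k))\<^sup>2"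
      using k cos_double_cos[of "(c - s) * k"] by (simp add: mult.assoc field_simps)
    ultimately show "(?F has_vector_derivative (cos ((c - s) * k))\<^sup>2) (at s within {0..t})"
      by (simp add: has_real_derivative_iff_has_vector_derivative)
  qed (use t in simp)
  from nn_integral_has_integral_lebesgue'[OF _ this]
  have "(\<integral>\<^sup>+s. ennreal ((cos ((c - s) * k))\<^sup>2) * indicator {0..t} s \<partial>lborel) = ennreal (?F t - ?F 0)" by simp
  moreover have "t / 4 \<le> ?F t - ?F 0"
  proof -
    have "sin (2 * (c - t) * k) / (4 * k) \<le> 1 / (4 * k)" "- 1 / (4 * k) \<le> sin (2 * c * k) / (4 * k)"
      using k by (intro divide_right_mono; simp)+
    moreover have "1 / (4 * k) + 1 / (4 * k) \<le> t / 4" using k by (simp add: field_simps)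
    ultimately show ?thesis by simp
  qed
  ultimately show ?thesis by (simp add: ennreal_leI)
qed

lemma spectral_dist2_commute: "spectral_dist2 \<beta> g h = spectral_dist2 \<beta> h g"
  unfolding spectral_dist2_def by (simp add: norm_minus_commute)

text \<open>
  The frequencies responsible for the increment over \<open>z = x - y\<close> lie in a ball of radius
  \<open>1/|z|\<close> around a multiple of \<open>z/|z|\<^sup>2\<close>, on which \<open>\<xi> \<bullet> z\<close> is close to an odd multiple of \<open>\<pi>\<close>
  large enough to average out the oscillation of \<open>sin\<^sup>2\<close> in time.
\<close>

lemma wave_hat_space_lower:
  assumes b: "0 < \<beta>" "\<beta> < 2" and t: "t > 0" and D: "D > 0"
  obtains c where "c > 0" "\<And>x y. norm (x - y) \<le> D \<Longrightarrow>
     ennreal (c * norm (x - y) powr (2 - \<beta>)) \<le> spectral_dist2 \<beta> (wave_hat t x) (wave_hat t y)"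
proof -
  \<comment> \<open>This makes the odd multiple \<open>p\<close> of pi so large that p - 1 \<ge>
    D/t. Since |z| \<le> D, the frequencies used below then satisfy |\<xi>| \<ge> 1/t, as the
    average over sin^2 requires.\<close>
  obtain n :: nat where n: "D / t + 1 \<le> real n" using real_arch_simple by blast
  define p where "p = (2 * real n + 1) * pi"
  have p1: "p - 1 \<ge> D / t"
  proof -
    have "real n * 1 \<le> (2 * real n + 1) * pi" using pi_gt3 by (intro mult_mono) simp_all
    then show ?thesis using n by (simp add: p_def)
  qed
  have p: "p > 1" using p1 divide_pos_pos[OF D t] by linarith
  have cosp: "cos (p + d) = - cos d" for d
  proof -
    have "p = real (2 * n + 1) * pi" by (simp add: p_def)
    then have "cos p = - 1" "sin p = 0" by (simp_all only: cos_npi sin_npi) simp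
    then show ?thesis by (simp add: cos_add)
  qed
  define c where "c = spectral_const \<beta> * (p + 1) powr (\<beta> - 3) * (t / 2 / (p + 1)\<^sup>2) * (4 / 3 * pi)"
  have sc: "spectral_const \<beta> > 0" using spectral_const_pos b by simp
  have c: "c > 0" using sc p t by (simp add: c_def)
  have "ennreal (c * norm (x - y) powr (2 - \<beta>)) \<le> spectral_dist2 \<beta> (wave_hat t x) (wave_hat t y)"
    if xy: "norm (x - y) \<le> D" for x y
  proof (cases "x = y")
    case False
    define z where "z = x - y"
    define r where "r = norm z"
    have r: "0 < r" "r \<le> D" using False xy by (simp_all add: z_def r_def)
    \<comment> \<open>\<open>w\<close> is the multiple of \<open>z\<close> with inner product
      \<open>p\<close>; moving \<xi> away from it by less than 1/r changes the phase by at most 1,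
      which is below pi/2.\<close>
    define w where "w = (p / r\<^sup>2) *\<^sub>R z"
    define L where "L = (p + 1) / r"
    have L: "L > 0" using p r by (simp add: L_def)
    have nw: "norm w = p / r" using r p by (simp add: w_def r_def power2_eq_square)
    have wz: "w \<bullet> z = p" using r by (simp add: w_def r_def power2_norm_eq_inner)
    have "ennreal (spectral_const \<beta> * L powr (\<beta> - 3) * (t / 2 / L\<^sup>2) * (4 / 3 * pi * (1 / r) ^ 3)) \<le>
        spectral_dist2 \<beta> (wave_hat t x) (wave_hat t y)"
    proof (rule spectral_dist2_lower[OF b(1) _ wave_hat_joint_measurable wave_hat_joint_measurable, where w=w])
      fix \<xi> :: "real^3" assume "\<xi> \<in> ball w (1 / r)"
      then have xw: "norm (\<xi> - w) < 1 / r" by (simp add: dist_norm norm_minus_commute)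
      have k1: "norm \<xi> \<le> L"
        using xw nw norm_triangle_ineq[of w "\<xi> - w"] by (simp add: L_def add_divide_distrib)
      have "norm \<xi> \<ge> (p - 1) / r"
        using xw nw norm_triangle_ineq2[of w "w - \<xi>"] by (simp add: diff_divide_distrib norm_minus_commute)
      moreover have "(p - 1) / r \<ge> 1 / t"
      proof -
        have "D / t / r \<le> (p - 1) / r" using p1 r by (intro divide_right_mono) simp_all
        moreover have "1 / t \<le> D / t / r" using r t D by (simp add: field_simps)
        ultimately show ?thesis by linarith
      qed
      ultimately have k2: "norm \<xi> \<ge> 1 / t" by linarith
      then have k0: "norm \<xi> > 0" using t by (auto intro: less_le_trans[rotated])
      have "\<bar>(\<xi> - w) \<bullet> z\<bar> \<le> norm (\<xi> - w) * r"
        unfolding r_def by (rule Cauchy_Schwarz_ineq2)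
      also have "\<dots> \<le> 1" using xw r by (simp add: field_simps)
      finally have dz: "\<bar>\<xi> \<bullet> z - p\<bar> \<le> 1" by (simp add: inner_diff_left wz)
      have "cos (\<xi> \<bullet> z) = - cos (\<xi> \<bullet> z - p)" using cosp[of "\<xi> \<bullet> z - p"] by simp
      moreover have "cos (\<xi> \<bullet> z - p) \<ge> 0"
        using dz pi_gt3 by (intro cos_ge_zero) linarith+
      \<comment> \<open>Consequently the squared phase difference 2 - 2 cos is at least 2 on the
        whole ball.\<close>
      ultimately have cz: "cos (\<xi> \<bullet> z) \<le> 0" by simp
      have "ennreal (t / 2 / L\<^sup>2) \<le> ennreal (2 / (norm \<xi>)\<^sup>2) * ennreal (t / 4)"
      proof -
        have "t / 2 / L\<^sup>2 \<le> t / 2 / (norm \<xi>)\<^sup>2"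
          using k0 k1 t L by (intro divide_left_mono power_mono) simp_all
        then show ?thesis using t by (simp add: ennreal_mult[symmetric] ennreal_leI)
      qed
      also have "\<dots> \<le> ennreal (2 / (norm \<xi>)\<^sup>2) * (\<integral>\<^sup>+s. ennreal ((sin ((t - s) * norm \<xi>))\<^sup>2) * indicator {0..t} s \<partial>lborel)"
        using k0 k2 t by (intro mult_left_mono nn_integral_sin_power2_lower) (simp_all add: field_simps)
      also have "\<dots> = (\<integral>\<^sup>+s. ennreal (2 / (norm \<xi>)\<^sup>2) * (ennreal ((sin ((t - s) * norm \<xi>))\<^sup>2) * indicator {0..t} s) \<partial>lborel)"
        by (rule nn_integral_cmult[symmetric]) simp
      also have "\<dots> \<le> (\<integral>\<^sup>+s. ennreal ((cmod (wave_hat t x s \<xi> - wave_hat t y s \<xi>))\<^sup>2) * indicator {0..} s \<partial>lborel)"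
      proof (rule nn_integral_mono)
        fix s :: real
        show "ennreal (2 / (norm \<xi>)\<^sup>2) * (ennreal ((sin ((t - s) * norm \<xi>))\<^sup>2) * indicator {0..t} s) \<le>
           ennreal ((cmod (wave_hat t x s \<xi> - wave_hat t y s \<xi>))\<^sup>2) * indicator {0..} s"
        proof (cases "0 \<le> s \<and> s < t")
          case True
          have "wave_hat t x s \<xi> - wave_hat t y s \<xi> =
              (cis (- (\<xi> \<bullet> x)) - cis (- (\<xi> \<bullet> y))) * complex_of_real (sin ((t - s) * norm \<xi>) / norm \<xi>)"
            using True by (simp add: wave_hat_def left_diff_distrib del: of_real_divide)
          then have "(cmod (wave_hat t x s \<xi> - wave_hat t y s \<xi>))\<^sup>2 =
              (2 - 2 * cos (\<xi> \<bullet> z)) * (sin ((t - s) * norm \<xi>) / norm \<xi>)\<^sup>2"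
            by (simp only: norm_mult norm_of_real power_mult_distrib cmod_cis_diff_power2 power2_abs)
              (simp add: z_def inner_diff_right cos_diff mult.commute)
          also have "\<dots> \<ge> 2 * (sin ((t - s) * norm \<xi>) / norm \<xi>)\<^sup>2"
            using cz by (intro mult_right_mono) simp_all
          finally show ?thesis using True
            by (simp add: ennreal_mult[symmetric] ennreal_leI power_divide)
        qed (auto simp: indicator_def)
      qed
      finally show "\<xi> \<noteq> 0 \<and> norm \<xi> \<le> L \<and> ennreal (t / 2 / L\<^sup>2) \<le>
          (\<integral>\<^sup>+s. ennreal ((cmod (wave_hat t x s \<xi> - wave_hat t y s \<xi>))\<^sup>2) * indicator {0..} s \<partial>lborel)"
        using k0 k1 by auto
    qed (use b t r L in simp_all)
    \<comment> \<open>The powers of r are 3 - \<beta> from the spectral weight, 2 from 1/L^2 and -3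
      from the volume of the ball.\<close>
    also have "spectral_const \<beta> * L powr (\<beta> - 3) * (t / 2 / L\<^sup>2) * (4 / 3 * pi * (1 / r) ^ 3) = c * r powr (2 - \<beta>)"
    proof -
      have "L powr (\<beta> - 3) = (p + 1) powr (\<beta> - 3) * r powr (3 - \<beta>)"
        using p r powr_minus_divide[of r "\<beta> - 3"] by (simp add: L_def powr_divide)
      moreover have "t / 2 / L\<^sup>2 = t / 2 / (p + 1)\<^sup>2 * r powr 2" using r by (simp add: L_def power_divide)
      moreover have "(1 / r) ^ 3 = r powr (- 3)" using r by (simp add: powr_minus power_divide inverse_eq_divide)
      moreover have "r powr (2 - \<beta>) = r powr (3 - \<beta>) * r powr 2 * r powr (- 3)" by (simp flip: powr_add)
      ultimately show ?thesis unfolding c_def by (simp only: mult_ac)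
    qed
    finally show ?thesis by (simp add: r_def z_def)
  qed simp
  then show thesis using that[OF c] by blast
qed

text \<open>The sine difference factors as 2 sin (h|\<xi>|/2) cos (((t+t')/2 - s)|\<xi>|) with h =
  t' - t. The first factor is bounded below for h|\<xi>| between 1 and 3, the second is averaged
  over the times s < t at which both kernels are present.\<close>

lemma wave_hat_time_lower:
  assumes b: "0 < \<beta>" "\<beta> < 2" and t0: "t0 > 0"
  obtains c \<delta> where "c > 0" "\<delta> > 0" "\<And>t t' x. t0 \<le> t \<Longrightarrow> t0 \<le> t' \<Longrightarrow> \<bar>t - t'\<bar> < \<delta> \<Longrightarrow>
     ennreal (c * \<bar>t - t'\<bar> powr (2 - \<beta>)) \<le> spectral_dist2 \<beta> (wave_hat t x) (wave_hat t' x)"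
proof -
  \<comment> \<open>On the chosen frequencies h|\<xi>|/2 lies in [1/2, 3/2], where the sine
    increases because 3/2 < pi/2; \<open>S\<close> is its smallest square there.\<close>
  define S where "S = (sin (1 / 2 :: real))\<^sup>2"
  have S: "S > 0" using sin_gt_zero[of "1 / 2"] pi_gt3 by (simp add: S_def)
  define c where "c = spectral_const \<beta> * 3 powr (\<beta> - 3) * (S * t0 / 9) * (4 / 3 * pi)"
  have sc: "spectral_const \<beta> > 0" using spectral_const_pos b by simp
  have c: "c > 0" using sc S t0 by (simp add: c_def)
  have main: "ennreal (c * (t' - t) powr (2 - \<beta>)) \<le> spectral_dist2 \<beta> (wave_hat t' x) (wave_hat t x)"
    if t: "t0 \<le> t" "t < t'" "t' - t < t0 / 2" for t t' x
  proof -
    define h where "h = t' - t"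
    have h: "h > 0" "h < t0 / 2" using t by (simp_all add: h_def)
    obtain e :: "real^3" where e: "e \<in> Basis" using nonempty_Basis by blast
    \<comment> \<open>Any direction serves, since the spatial phases of the two kernels
      coincide.\<close>
    define w where "w = (2 / h) *\<^sub>R e"
    define L where "L = 3 / h"
    have L: "L > 0" using h by (simp add: L_def)
    have nw: "norm w = 2 / h" using h e by (simp add: w_def)
    have "ennreal (spectral_const \<beta> * L powr (\<beta> - 3) * (S * t0 / L\<^sup>2) * (4 / 3 * pi * (1 / h) ^ 3)) \<le>
        spectral_dist2 \<beta> (wave_hat t' x) (wave_hat t x)"
    proof (rule spectral_dist2_lower[OF b(1) _ wave_hat_joint_measurable wave_hat_joint_measurable, where w=w])
      fix \<xi> :: "real^3" assume "\<xi> \<in> ball w (1 / h)"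
      then have xw: "norm (\<xi> - w) < 1 / h" by (simp add: dist_norm norm_minus_commute)
      have k1: "norm \<xi> \<le> L"
        using xw nw norm_triangle_ineq[of w "\<xi> - w"] by (simp add: L_def)
      have k2: "norm \<xi> \<ge> 1 / h"
        using xw nw norm_triangle_ineq2[of w "w - \<xi>"] by (simp add: norm_minus_commute)
      then have k0: "norm \<xi> > 0" using h by (auto intro: less_le_trans[rotated])
      have hk: "1 / 2 \<le> h * norm \<xi> / 2" "h * norm \<xi> / 2 \<le> 3 / 2"
        using k1 k2 h by (simp_all add: L_def field_simps)
      have "sin (1 / 2) \<le> sin (h * norm \<xi> / 2)"
        using hk pi_gt3 by (intro sin_monotone_2pi_le) linarith+
      then have Sk: "S \<le> (sin (h * norm \<xi> / 2))\<^sup>2"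
        unfolding S_def using sin_gt_zero[of "1 / 2"] pi_gt3 by (intro power_mono) simp_all
      \<comment> \<open>This is where h < t0/2 enters: 2/|\<xi>| \<le> 2h < t0 \<le> t.\<close>
      have kt: "2 / norm \<xi> \<le> t"
      proof -
        have "2 / norm \<xi> \<le> 2 * h" using k2 h k0 by (simp add: field_simps)
        then show ?thesis using h t by linarith
      qed
      define m where "m = 4 * (sin (h * norm \<xi> / 2))\<^sup>2 / (norm \<xi>)\<^sup>2"
      have m: "m \<ge> 0" by (simp add: m_def)
      have "ennreal (S * t0 / L\<^sup>2) \<le> ennreal m * ennreal (t / 4)"
      proof -
        have "S * t0 / L\<^sup>2 \<le> S * t0 / (norm \<xi>)\<^sup>2"
          using k0 k1 t0 S L by (intro divide_left_mono power_mono) simp_all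
        also have "\<dots> \<le> (sin (h * norm \<xi> / 2))\<^sup>2 * t / (norm \<xi>)\<^sup>2"
          using Sk S t t0 by (intro divide_right_mono mult_mono) simp_all
        also have "\<dots> = m * (t / 4)" by (simp add: m_def)
        finally show ?thesis using m t t0 by (simp add: ennreal_mult[symmetric] ennreal_leI)
      qed
      also have "\<dots> \<le> ennreal m * (\<integral>\<^sup>+s. ennreal ((cos (((t + t') / 2 - s) * norm \<xi>))\<^sup>2) * indicator {0..t} s \<partial>lborel)"
        using k0 kt by (intro mult_left_mono nn_integral_cos_power2_lower) simp_all
      also have "\<dots> = (\<integral>\<^sup>+s. ennreal m * (ennreal ((cos (((t + t') / 2 - s) * norm \<xi>))\<^sup>2) * indicator {0..t} s) \<partial>lborel)"
        by (rule nn_integral_cmult[symmetric]) simp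
      also have "\<dots> \<le> (\<integral>\<^sup>+s. ennreal ((cmod (wave_hat t' x s \<xi> - wave_hat t x s \<xi>))\<^sup>2) * indicator {0..} s \<partial>lborel)"
      proof (rule nn_integral_mono_AE, rule eventually_mono[OF AE_lborel_singleton[of t]])
        fix s :: real assume st: "s \<noteq> t"
        show "ennreal m * (ennreal ((cos (((t + t') / 2 - s) * norm \<xi>))\<^sup>2) * indicator {0..t} s) \<le>
           ennreal ((cmod (wave_hat t' x s \<xi> - wave_hat t x s \<xi>))\<^sup>2) * indicator {0..} s"
        proof (cases "0 \<le> s \<and> s < t")
          case True
          have "sin ((t' - s) * norm \<xi>) - sin ((t - s) * norm \<xi>) =
             2 * sin (((t' - s) * norm \<xi> - (t - s) * norm \<xi>) / 2) * cos (((t' - s) * norm \<xi> + (t - s) * norm \<xi>) / 2)"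
            by (rule sin_diff_sin)
          also have "((t' - s) * norm \<xi> - (t - s) * norm \<xi>) / 2 = h * norm \<xi> / 2"
            by (simp add: h_def algebra_simps)
          also have "((t' - s) * norm \<xi> + (t - s) * norm \<xi>) / 2 = ((t + t') / 2 - s) * norm \<xi>"
            by (simp add: field_simps)
          finally have sd: "sin ((t' - s) * norm \<xi>) - sin ((t - s) * norm \<xi>) =
             2 * sin (h * norm \<xi> / 2) * cos (((t + t') / 2 - s) * norm \<xi>)" .
          have "wave_hat t' x s \<xi> - wave_hat t x s \<xi> = cis (- (\<xi> \<bullet> x)) *
              complex_of_real ((sin ((t' - s) * norm \<xi>) - sin ((t - s) * norm \<xi>)) / norm \<xi>)"
            using True t by (simp add: wave_hat_def right_diff_distrib diff_divide_distrib)
          then have "(cmod (wave_hat t' x s \<xi> - wave_hat t x s \<xi>))\<^sup>2 = m * (cos (((t + t') / 2 - s) * norm \<xi>))\<^sup>2"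
            unfolding sd by (simp only: norm_mult norm_cis norm_of_real mult_1 power2_abs)
              (simp add: m_def power_divide power_mult_distrib)
          then show ?thesis using True m by (simp add: ennreal_mult)
        qed (use st in \<open>auto simp: indicator_def\<close>)
      qed
      finally show "\<xi> \<noteq> 0 \<and> norm \<xi> \<le> L \<and> ennreal (S * t0 / L\<^sup>2) \<le>
          (\<integral>\<^sup>+s. ennreal ((cmod (wave_hat t' x s \<xi> - wave_hat t x s \<xi>))\<^sup>2) * indicator {0..} s \<partial>lborel)"
        using k0 k1 by auto
    qed (use b t0 S h L in simp_all)
    also have "spectral_const \<beta> * L powr (\<beta> - 3) * (S * t0 / L\<^sup>2) * (4 / 3 * pi * (1 / h) ^ 3) = c * h powr (2 - \<beta>)"
    proof -
      have "L powr (\<beta> - 3) = 3 powr (\<beta> - 3) * h powr (3 - \<beta>)"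
        using h powr_minus_divide[of h "\<beta> - 3"] by (simp add: L_def powr_divide)
      moreover have "S * t0 / L\<^sup>2 = S * t0 / 9 * h powr 2" using h by (simp add: L_def power_divide)
      moreover have "(1 / h) ^ 3 = h powr (- 3)" using h by (simp add: powr_minus power_divide inverse_eq_divide)
      moreover have "h powr (2 - \<beta>) = h powr (3 - \<beta>) * h powr 2 * h powr (- 3)" by (simp flip: powr_add)
      ultimately show ?thesis unfolding c_def by (simp only: mult_ac)
    qed
    finally show ?thesis by (simp add: h_def)
  qed
  have "ennreal (c * \<bar>t - t'\<bar> powr (2 - \<beta>)) \<le> spectral_dist2 \<beta> (wave_hat t x) (wave_hat t' x)"
    if t: "t0 \<le> t" "t0 \<le> t'" "\<bar>t - t'\<bar> < t0 / 2" for t t' x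
  proof -
    consider "t = t'" | "t < t'" | "t' < t" by linarith
    then show ?thesis
    proof cases
      case 2
      then show ?thesis using main[of t t' x] t by (simp add: spectral_dist2_commute[of _ "wave_hat t x"] abs_minus_commute)
    next
      case 3
      then show ?thesis using main[of t' t x] t by simp
    qed simp
  qed
  then show thesis using that[OF c, of "t0 / 2"] t0 by simp
qed

section \<open>Chaining\<close>

text \<open>Consecutive approximants of p are within 4c 2^(-n) of each other, so their increments
  are dominated by a geometric series, whose tail from level n is the stated bound.\<close>

lemma chaining_limit:
  fixes f :: "'p::metric_space \<Rightarrow> real" and \<pi> :: "nat \<Rightarrow> 'p \<Rightarrow> 'p" and D :: "nat \<Rightarrow> 'p set"
  assumes th: "0 < \<theta>" "\<theta> < 1"
    and \<pi>: "\<And>n p. p \<in> S \<Longrightarrow> \<pi> n p \<in> D n" "\<And>n p. p \<in> S \<Longrightarrow> dist (\<pi> n p) p \<le> c * (1/2) ^ n"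
    and f: "\<And>n p q. n \<ge> N \<Longrightarrow> p \<in> D n \<union> D (Suc n) \<Longrightarrow> q \<in> D n \<union> D (Suc n) \<Longrightarrow>
       dist p q \<le> 4 * c * (1/2) ^ n \<Longrightarrow> \<bar>f p - f q\<bar> \<le> \<theta> ^ n"
    and p: "p \<in> S" and n: "n \<ge> N"
  shows "\<bar>lim (\<lambda>n. f (\<pi> n p)) - f (\<pi> n p)\<bar> \<le> \<theta> ^ n / (1 - \<theta>)"
proof -
  have c: "c \<ge> 0" using order_trans[OF zero_le_dist \<pi>(2)[OF p, of 0]] by simp
  have step: "\<bar>f (\<pi> (Suc k) p) - f (\<pi> k p)\<bar> \<le> \<theta> ^ k" if "k \<ge> N" for k
  proof (rule f[OF that])
    have "dist (\<pi> (Suc k) p) (\<pi> k p) \<le> dist (\<pi> (Suc k) p) p + dist (\<pi> k p) p"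
      by (rule dist_triangle2)
    also have "\<dots> \<le> c * (1/2) ^ Suc k + c * (1/2) ^ k" by (intro add_mono \<pi>(2) p)
    also have "\<dots> \<le> 4 * c * (1/2) ^ k" using c by (simp add: field_simps)
    finally show "dist (\<pi> (Suc k) p) (\<pi> k p) \<le> 4 * c * (1/2) ^ k" .
  qed (use \<pi>(1)[OF p] in auto)
  define a where "a k = f (\<pi> (Suc (k + n)) p) - f (\<pi> (k + n) p)" for k
  have abd: "norm (a k) \<le> \<theta> ^ n * \<theta> ^ k" for k
    using step[of "k + n"] n by (simp add: a_def power_add mult.commute)
  have sg: "summable (\<lambda>k. \<theta> ^ n * \<theta> ^ k)" using th by (intro summable_mult summable_geometric) simp
  have sa: "summable a" by (rule summable_comparison_test'[OF sg, of 0]) (use abd in simp)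
  have "(\<lambda>m. \<Sum>k<m. a k) = (\<lambda>m. f (\<pi> (m + n) p) - f (\<pi> n p))"
  proof
    fix m
    show "(\<Sum>k<m. a k) = f (\<pi> (m + n) p) - f (\<pi> n p)"
      unfolding a_def by (induction m) simp_all
  qed
  then have "(\<lambda>m. f (\<pi> (m + n) p) - f (\<pi> n p)) \<longlonglongrightarrow> suminf a"
    using summable_LIMSEQ[OF sa] by simp
  then have "(\<lambda>m. f (\<pi> (m + n) p) - f (\<pi> n p) + f (\<pi> n p)) \<longlonglongrightarrow> suminf a + f (\<pi> n p)"
    by (intro tendsto_add tendsto_const)
  then have "(\<lambda>m. f (\<pi> (m + n) p)) \<longlonglongrightarrow> suminf a + f (\<pi> n p)" by simp
  then have "(\<lambda>m. f (\<pi> m p)) \<longlonglongrightarrow> suminf a + f (\<pi> n p)" by (rule LIMSEQ_offset)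
  then have "lim (\<lambda>m. f (\<pi> m p)) = suminf a + f (\<pi> n p)" by (rule limI)
  moreover have "norm (suminf a) \<le> (\<Sum>k. \<theta> ^ n * \<theta> ^ k)"
    by (rule norm_suminf_le[OF abd sg])
  moreover have "(\<Sum>k. \<theta> ^ n * \<theta> ^ k) = \<theta> ^ n / (1 - \<theta>)"
    using sums_unique[OF sums_mult[OF geometric_sums[of \<theta>], of "\<theta> ^ n"]] th by simp
  ultimately show ?thesis by simp
qed

text \<open>Points at a distance between c 2^(-m) and 2c 2^(-m) are compared through their
  approximants at level m, which are at most c + 2c + c times 2^(-m) apart; this is the origin of
  4c. Distances too large for the first admissible level are handled by boundedness, which
  finiteness of \<open>D N\<close> provides.\<close>

lemma chaining_holder:
  fixes f :: "'p::metric_space \<Rightarrow> real" and \<pi> :: "nat \<Rightarrow> 'p \<Rightarrow> 'p" and D :: "nat \<Rightarrow> 'p set"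
  assumes g: "\<gamma> > 0" and c: "c > 0"
    and fin: "\<And>n. finite (D n)"
    and \<pi>: "\<And>n p. p \<in> S \<Longrightarrow> \<pi> n p \<in> D n" "\<And>n p. p \<in> S \<Longrightarrow> dist (\<pi> n p) p \<le> c * (1/2) ^ n"
    and f: "\<And>n p q. n \<ge> N \<Longrightarrow> p \<in> D n \<union> D (Suc n) \<Longrightarrow> q \<in> D n \<union> D (Suc n) \<Longrightarrow>
       dist p q \<le> 4 * c * (1/2) ^ n \<Longrightarrow> \<bar>f p - f q\<bar> \<le> ((1/2) powr \<gamma>) ^ n"
  shows "holder_on \<gamma> S (\<lambda>p. lim (\<lambda>n. f (\<pi> n p)))"
proof -
  define \<theta> where "\<theta> = (1/2 :: real) powr \<gamma>"
  have th: "0 < \<theta>" "\<theta> < 1" using g powr_less_mono2[of \<gamma> "1/2" 1] by (simp_all add: \<theta>_def)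
  have thp: "\<theta> ^ n = ((1/2) ^ n) powr \<gamma>" for n
    unfolding \<theta>_def by (simp add: powr_powr mult.commute flip: powr_realpow)
  define v where "v p = lim (\<lambda>n. f (\<pi> n p))" for p
  have v: "\<bar>v p - f (\<pi> n p)\<bar> \<le> \<theta> ^ n / (1 - \<theta>)" if "p \<in> S" "n \<ge> N" for n p
    unfolding v_def by (rule chaining_limit[OF th \<pi>, of S N]) (use f that in \<open>auto simp: \<theta>_def\<close>)
  define B0 where "B0 = (\<Sum>q\<in>D N. \<bar>f q\<bar>) + \<theta> ^ N / (1 - \<theta>)"
  have B0: "\<bar>v p\<bar> \<le> B0" if "p \<in> S" for p
  proof -
    have "\<bar>f (\<pi> N p)\<bar> \<le> (\<Sum>q\<in>D N. \<bar>f q\<bar>)"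
      by (rule member_le_sum) (use fin \<pi>(1)[OF that] in auto)
    then show ?thesis using v[OF that, of N] by (simp add: B0_def)
  qed
  define C1 where "C1 = 2 * B0 / (2 * c * (1/2) ^ N) powr \<gamma>"
  define C2 where "C2 = (2 / (1 - \<theta>) + 1) / c powr \<gamma>"
  have C2: "C2 \<ge> 0" using th by (auto simp: C2_def intro!: divide_nonneg_nonneg add_nonneg_nonneg)
  have "\<bar>v p - v q\<bar> \<le> (\<bar>C1\<bar> + C2) * dist p q powr \<gamma>" if pq: "p \<in> S" "q \<in> S" for p q
  proof (cases "p = q")
    case False
    then have d: "dist p q > 0" by simp
    show ?thesis
    proof (cases "dist p q \<le> 2 * c * (1/2) ^ N")
      case big: False
      have "\<bar>v p - v q\<bar> \<le> 2 * B0" using B0[OF pq(1)] B0[OF pq(2)] by simp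
      also have "\<dots> = C1 * (2 * c * (1/2) ^ N) powr \<gamma>" using c by (simp add: C1_def)
      also have "\<dots> \<le> \<bar>C1\<bar> * dist p q powr \<gamma>"
        using big c g by (intro mult_mono powr_mono2) auto
      also have "\<dots> \<le> (\<bar>C1\<bar> + C2) * dist p q powr \<gamma>"
        using C2 by (intro mult_right_mono) simp_all
      finally show ?thesis .
    next
      case small: True
      have "(\<lambda>n. 2 * c * (1/2) ^ n) \<longlonglongrightarrow> 2 * c * 0"
        by (intro tendsto_mult tendsto_const LIMSEQ_power_zero) simp
      then have "\<forall>\<^sub>F n in sequentially. 2 * c * (1/2) ^ n < dist p q"
        by (rule order_tendstoD(2)) (use d in simp)
      then obtain n0 where n0: "\<And>n. n \<ge> n0 \<Longrightarrow> 2 * c * (1/2) ^ n < dist p q"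
        unfolding eventually_sequentially by blast
      \<comment> \<open>The least admissible level whose successor resolves the distance. Minimality
        gives the upper bound \<open>dm\<close>, except at m = N, where \<open>small\<close>
        does.\<close>
      define m where "m = (LEAST m. m \<ge> N \<and> 2 * c * (1/2) ^ Suc m < dist p q)"
      have "N + n0 \<ge> N \<and> 2 * c * (1/2) ^ Suc (N + n0) < dist p q" using n0[of "Suc (N + n0)"] by simp
      then have "m \<ge> N \<and> 2 * c * (1/2) ^ Suc m < dist p q"
        unfolding m_def by (rule LeastI)
      then have m: "m \<ge> N" "2 * c * (1/2) ^ Suc m < dist p q" by blast+
      have dm: "dist p q \<le> 2 * c * (1/2) ^ m"
      proof (cases "m = N")
        case True
        then show ?thesis using small by simp
      next
        case False
        then obtain k where k: "m = Suc k" "k \<ge> N" using m(1) by (cases m) auto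
        then have "\<not> (k \<ge> N \<and> 2 * c * (1/2) ^ Suc k < dist p q)"
          using not_less_Least[of k "\<lambda>m. m \<ge> N \<and> 2 * c * (1/2) ^ Suc m < dist p q"] by (simp add: m_def)
        then show ?thesis using k by simp
      qed
      have "dist (\<pi> m p) (\<pi> m q) \<le> dist (\<pi> m p) p + dist p q + dist (\<pi> m q) q"
        using dist_triangle[of "\<pi> m p" "\<pi> m q" p] dist_triangle2[of p "\<pi> m q" q] by (simp add: dist_commute)
      also have "\<dots> \<le> c * (1/2) ^ m + 2 * c * (1/2) ^ m + c * (1/2) ^ m"
        by (intro add_mono \<pi>(2) pq dm)
      finally have dd: "dist (\<pi> m p) (\<pi> m q) \<le> 4 * c * (1/2) ^ m" by simp
      have "\<bar>f (\<pi> m p) - f (\<pi> m q)\<bar> \<le> \<theta> ^ m"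
        unfolding \<theta>_def by (rule f[OF m(1) _ _ dd]) (use \<pi>(1) pq in auto)
      then have "\<bar>v p - v q\<bar> \<le> \<theta> ^ m / (1 - \<theta>) + \<theta> ^ m + \<theta> ^ m / (1 - \<theta>)"
        using v[OF pq(1) m(1)] v[OF pq(2) m(1)] by linarith
      also have "\<dots> = (2 / (1 - \<theta>) + 1) * \<theta> ^ m" by (simp add: algebra_simps)
      also have "\<dots> \<le> (2 / (1 - \<theta>) + 1) * (dist p q / c) powr \<gamma>"
      proof (rule mult_left_mono)
        have "(1/2) ^ m \<le> dist p q / c" using m(2) c by (simp add: field_simps)
        then show "\<theta> ^ m \<le> (dist p q / c) powr \<gamma>" unfolding thp using g by (intro powr_mono2) simp_all
      qed (use th in \<open>auto intro!: add_nonneg_nonneg\<close>)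
      also have "\<dots> = C2 * dist p q powr \<gamma>" using c d by (simp add: C2_def powr_divide)
      also have "\<dots> \<le> (\<bar>C1\<bar> + C2) * dist p q powr \<gamma>" by (intro mult_right_mono) simp_all
      finally show ?thesis .
    qed
  qed simp
  then show ?thesis unfolding holder_on_def v_def by blast
qed

text \<open>
  Arbitrarily high moments are available, so the union bound may count all pairs of net points
  instead of only neighbouring ones.
\<close>

lemma chaining_AE:
  fixes X :: "'p::metric_space \<Rightarrow> 'w \<Rightarrow> real" and D :: "nat \<Rightarrow> 'p set"
  assumes "prob_space P" and [measurable]: "\<And>p. X p \<in> borel_measurable P"
    and tail: "\<And>k p q l. l > 0 \<Longrightarrow>
       measure P {\<omega> \<in> space P. \<bar>X p \<omega> - X q \<omega>\<bar> \<ge> l} \<le> C k * (dist p q powr (2 * H) / l\<^sup>2) ^ k"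
    and C: "\<And>k. C k \<ge> 0" and g: "0 < \<gamma>" "\<gamma> < H" and c: "c > 0"
    and D: "\<And>n. finite (D n)" "\<And>n. real (card (D n)) \<le> K * A ^ n" "A \<ge> 1" "K \<ge> 0"
  shows "AE \<omega> in P. \<exists>N. \<forall>n\<ge>N. \<forall>p\<in>D n \<union> D (Suc n). \<forall>q\<in>D n \<union> D (Suc n).
     dist p q \<le> 4 * c * (1/2) ^ n \<longrightarrow> \<bar>X p \<omega> - X q \<omega>\<bar> \<le> ((1/2) powr \<gamma>) ^ n"
proof -
  interpret prob_space P by fact
  define \<theta> where "\<theta> = (1/2 :: real) powr \<gamma>"
  have th: "\<theta> > 0" by (simp add: \<theta>_def)
  \<comment> \<open>The factor gained per level when the second moment scale 2^(-2nH) is divided by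
    the squared threshold; it is below 1 because \<gamma> < H.\<close>
  define \<eta> where "\<eta> = (1/2 :: real) powr (2 * (H - \<gamma>))"
  have eta: "0 < \<eta>" "\<eta> < 1" using g powr_less_mono2[of "2 * (H - \<gamma>)" "1/2" 1] by (simp_all add: \<eta>_def)
  \<comment> \<open>The number of pairs grows like A^(2n). The moment order is chosen so that A^2
    \<eta>^k < 1/2, which makes the probabilities of the bad events summable.\<close>
  obtain k where k: "\<eta> ^ k < 1 / (2 * A\<^sup>2)"
    using real_arch_pow_inv[of "1 / (2 * A\<^sup>2)" \<eta>] eta D(3) by auto
  define E where "E n = {(p, q). p \<in> D n \<union> D (Suc n) \<and> q \<in> D n \<union> D (Suc n) \<and> dist p q \<le> 4 * c * (1/2) ^ n}" for n
  have Esub: "E n \<subseteq> (D n \<union> D (Suc n)) \<times> (D n \<union> D (Suc n))" for n by (auto simp: E_def)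
  have Efin: "finite (E n)" for n by (rule finite_subset[OF Esub]) (use D(1) in auto)
  have Ecard: "real (card (E n)) \<le> (K * (1 + A))\<^sup>2 * (A\<^sup>2) ^ n" for n
  proof -
    have "card (E n) \<le> card ((D n \<union> D (Suc n)) \<times> (D n \<union> D (Suc n)))"
      by (rule card_mono[OF _ Esub]) (use D(1) in auto)
    also have "\<dots> = (card (D n \<union> D (Suc n)))\<^sup>2"
      by (simp add: card_cartesian_product power2_eq_square)
    finally have "real (card (E n)) \<le> (real (card (D n \<union> D (Suc n))))\<^sup>2"
      by (simp only: of_nat_power[symmetric] of_nat_le_iff)
    also have "\<dots> \<le> (K * (1 + A) * A ^ n)\<^sup>2"
    proof (rule power_mono)
      have "real (card (D n \<union> D (Suc n))) \<le> real (card (D n)) + real (card (D (Suc n)))"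
        using card_Un_le[of "D n" "D (Suc n)"] by linarith
      also have "\<dots> \<le> K * A ^ n + K * A ^ Suc n" by (intro add_mono D(2))
      finally show "real (card (D n \<union> D (Suc n))) \<le> K * (1 + A) * A ^ n" by (simp add: algebra_simps)
    qed simp
    finally show ?thesis by (simp add: power_mult_distrib power_mult[symmetric] mult.commute)
  qed
  define bad where "bad n = (\<Union>(p, q)\<in>E n. {\<omega> \<in> space P. \<bar>X p \<omega> - X q \<omega>\<bar> \<ge> \<theta> ^ n})" for n
  have badm: "bad n \<in> events" for n
    unfolding bad_def using Efin by (intro sets.finite_UN) auto
  define Q where "Q = (K * (1 + A))\<^sup>2 * (C k * ((4 * c) powr (2 * H)) ^ k)"
  have Q: "Q \<ge> 0" using C by (simp add: Q_def)
  have badle: "prob (bad n) \<le> Q * (1/2) ^ n" for n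
  proof -
    have "prob (bad n) \<le> (\<Sum>pq\<in>E n. prob (case pq of (p, q) \<Rightarrow> {\<omega> \<in> space P. \<bar>X p \<omega> - X q \<omega>\<bar> \<ge> \<theta> ^ n}))"
      unfolding bad_def by (rule finite_measure_subadditive_finite[OF Efin]) auto
    also have "\<dots> \<le> (\<Sum>pq\<in>E n. C k * ((4 * c) powr (2 * H) * \<eta> ^ n) ^ k)"
    proof (rule sum_mono)
      fix pq assume "pq \<in> E n"
      then obtain p q where pq: "pq = (p, q)" "dist p q \<le> 4 * c * (1/2) ^ n" by (auto simp: E_def)
      have "dist p q powr (2 * H) / (\<theta> ^ n)\<^sup>2 \<le> (4 * c * (1/2) ^ n) powr (2 * H) / (\<theta> ^ n)\<^sup>2"
        using pq(2) g by (intro divide_right_mono powr_mono2) simp_all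
      also have "\<dots> = (4 * c) powr (2 * H) * \<eta> ^ n"
      proof -
        have "((1/2) ^ n) powr (2 * H) = ((1/2) powr (2 * H)) ^ n"
          by (simp add: powr_powr mult.commute flip: powr_realpow)
        moreover have "(\<theta> ^ n)\<^sup>2 = (\<theta>\<^sup>2) ^ n" by (simp add: power_mult[symmetric] mult.commute)
        moreover have "(1/2) powr (2 * H) / \<theta>\<^sup>2 = \<eta>"
          unfolding \<theta>_def \<eta>_def by (simp add: powr_powr right_diff_distrib mult.commute flip: powr_numeral powr_diff)
        ultimately have "((1/2) ^ n) powr (2 * H) / (\<theta> ^ n)\<^sup>2 = \<eta> ^ n"
          by (simp only: power_divide[symmetric])
        moreover have "(4 * c * (1/2) ^ n) powr (2 * H) = (4 * c) powr (2 * H) * ((1/2) ^ n) powr (2 * H)"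
          by (rule powr_mult)
        ultimately show ?thesis by (simp only: times_divide_eq_right[symmetric])
      qed
      finally have "(dist p q powr (2 * H) / (\<theta> ^ n)\<^sup>2) ^ k \<le> ((4 * c) powr (2 * H) * \<eta> ^ n) ^ k"
        by (intro power_mono) simp_all
      then have "C k * (dist p q powr (2 * H) / (\<theta> ^ n)\<^sup>2) ^ k \<le> C k * ((4 * c) powr (2 * H) * \<eta> ^ n) ^ k"
        by (rule mult_left_mono[OF _ C])
      moreover have "prob {\<omega> \<in> space P. \<bar>X p \<omega> - X q \<omega>\<bar> \<ge> \<theta> ^ n} \<le> C k * (dist p q powr (2 * H) / (\<theta> ^ n)\<^sup>2) ^ k"
        by (rule tail) (simp add: th)
      ultimately show "prob (case pq of (p, q) \<Rightarrow> {\<omega> \<in> space P. \<bar>X p \<omega> - X q \<omega>\<bar> \<ge> \<theta> ^ n}) \<le> C k * ((4 * c) powr (2 * H) * \<eta> ^ n) ^ k"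
        unfolding pq(1) prod.case by (rule order_trans[rotated])
    qed
    also have "\<dots> = real (card (E n)) * (C k * ((4 * c) powr (2 * H) * \<eta> ^ n) ^ k)" by simp
    also have "\<dots> \<le> (K * (1 + A))\<^sup>2 * (A\<^sup>2) ^ n * (C k * ((4 * c) powr (2 * H) * \<eta> ^ n) ^ k)"
      using C eta by (intro mult_right_mono Ecard mult_nonneg_nonneg zero_le_power) simp_all
    also have "\<dots> = Q * (A\<^sup>2 * \<eta> ^ k) ^ n"
      by (simp add: Q_def power_mult_distrib power_mult[symmetric] mult_ac)
    also have "\<dots> \<le> Q * (1/2) ^ n"
    proof (intro mult_left_mono power_mono)
      show "A\<^sup>2 * \<eta> ^ k \<le> 1 / 2" using k D(3) by (simp add: field_simps)
    qed (use Q eta in simp_all)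
    finally show ?thesis .
  qed
  have "summable (\<lambda>n. prob (bad n))"
    by (rule summable_comparison_test'[of "\<lambda>n. Q * (1/2) ^ n" 0])
      (use badle in \<open>auto intro!: summable_mult summable_geometric\<close>)
  then have "AE \<omega> in P. eventually (\<lambda>n. \<omega> \<in> space P - bad n) sequentially"
    by (intro borel_cantelli_AE1 badm) (simp_all add: emeasure_eq_measure)
  then show ?thesis
  proof (rule eventually_mono)
    fix \<omega> assume "eventually (\<lambda>n. \<omega> \<in> space P - bad n) sequentially"
    then obtain N where N: "\<And>n. n \<ge> N \<Longrightarrow> \<omega> \<in> space P - bad n" by (auto simp: eventually_sequentially)
    show "\<exists>N. \<forall>n\<ge>N. \<forall>p\<in>D n \<union> D (Suc n). \<forall>q\<in>D n \<union> D (Suc n).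
       dist p q \<le> 4 * c * (1/2) ^ n \<longrightarrow> \<bar>X p \<omega> - X q \<omega>\<bar> \<le> ((1/2) powr \<gamma>) ^ n"
    proof (intro exI[of _ N] allI ballI impI)
      fix n p q assume *: "N \<le> n" "p \<in> D n \<union> D (Suc n)" "q \<in> D n \<union> D (Suc n)" "dist p q \<le> 4 * c * (1/2) ^ n"
      then have "(p, q) \<in> E n" by (simp add: E_def)
      then have "\<not> \<bar>X p \<omega> - X q \<omega>\<bar> \<ge> \<theta> ^ n" using N[OF *(1)] by (auto simp: bad_def)
      then show "\<bar>X p \<omega> - X q \<omega>\<bar> \<le> ((1/2) powr \<gamma>) ^ n" by (simp add: \<theta>_def)
    qed
  qed
qed

text \<open>Chaining on the nets {p, \<pi> n p}, of cardinality at most 2 and hence with A = 1,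
  shows that the approximants of a fixed p converge almost surely to \<open>X p\<close>
  itself.\<close>

lemma chaining_version:
  fixes X :: "'p::metric_space \<Rightarrow> 'w \<Rightarrow> real" and \<pi> :: "nat \<Rightarrow> 'p \<Rightarrow> 'p"
  assumes "prob_space P" and X: "\<And>p. X p \<in> borel_measurable P"
    and tail: "\<And>k p q l. l > 0 \<Longrightarrow>
       measure P {\<omega> \<in> space P. \<bar>X p \<omega> - X q \<omega>\<bar> \<ge> l} \<le> C k * (dist p q powr (2 * H) / l\<^sup>2) ^ k"
    and C: "\<And>k. C k \<ge> 0" and H: "H > 0" and c: "c > 0"
    and \<pi>: "\<And>n. dist (\<pi> n p) p \<le> c * (1/2) ^ n"
  shows "AE \<omega> in P. lim (\<lambda>n. X (\<pi> n p) \<omega>) = X p \<omega>"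
proof -
  define \<gamma> where "\<gamma> = H / 2"
  have "AE \<omega> in P. \<exists>N. \<forall>n\<ge>N. \<forall>a\<in>{p, \<pi> n p} \<union> {p, \<pi> (Suc n) p}. \<forall>b\<in>{p, \<pi> n p} \<union> {p, \<pi> (Suc n) p}.
     dist a b \<le> 4 * c * (1/2) ^ n \<longrightarrow> \<bar>X a \<omega> - X b \<omega>\<bar> \<le> ((1/2) powr \<gamma>) ^ n"
  proof (rule chaining_AE[OF assms(1) X tail C, where K=2 and A=1])
    show "real (card {p, \<pi> n p}) \<le> 2 * 1 ^ n" for n
      using card_insert_le_m1[of 2 "{\<pi> n p}" p] by simp
  qed (use H c in \<open>simp_all add: \<gamma>_def\<close>)
  then show ?thesis
  proof (rule eventually_mono)
    fix \<omega> assume "\<exists>N. \<forall>n\<ge>N. \<forall>a\<in>{p, \<pi> n p} \<union> {p, \<pi> (Suc n) p}. \<forall>b\<in>{p, \<pi> n p} \<union> {p, \<pi> (Suc n) p}.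
       dist a b \<le> 4 * c * (1/2) ^ n \<longrightarrow> \<bar>X a \<omega> - X b \<omega>\<bar> \<le> ((1/2) powr \<gamma>) ^ n"
    then obtain N where N: "\<And>n a b. n \<ge> N \<Longrightarrow> a \<in> {p, \<pi> n p} \<union> {p, \<pi> (Suc n) p} \<Longrightarrow> b \<in> {p, \<pi> n p} \<union> {p, \<pi> (Suc n) p} \<Longrightarrow>
       dist a b \<le> 4 * c * (1/2) ^ n \<Longrightarrow> \<bar>X a \<omega> - X b \<omega>\<bar> \<le> ((1/2) powr \<gamma>) ^ n" by blast
    have "(\<lambda>n. X (\<pi> n p) \<omega>) \<longlonglongrightarrow> X p \<omega>"
    proof (rule LIM_zero_cancel, rule Lim_null_comparison)
      show "(\<lambda>n. ((1/2::real) powr \<gamma>) ^ n) \<longlonglongrightarrow> 0"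
        using powr_less_mono2[of \<gamma> "1/2" 1] H by (intro LIMSEQ_power_zero) (simp_all add: \<gamma>_def)
      show "\<forall>\<^sub>F n in sequentially. norm (X (\<pi> n p) \<omega> - X p \<omega>) \<le> ((1/2) powr \<gamma>) ^ n"
        unfolding eventually_sequentially
      proof (intro exI[of _ N] allI impI)
        fix n assume "n \<ge> N"
        moreover have "c * (1/2) ^ n \<le> 4 * c * (1/2) ^ n" using c by simp
        ultimately show "norm (X (\<pi> n p) \<omega> - X p \<omega>) \<le> ((1/2) powr \<gamma>) ^ n"
          using N[of n "\<pi> n p" p] order_trans[OF \<pi>[of n]] by simp
      qed
    qed
    then show "lim (\<lambda>n. X (\<pi> n p) \<omega>) = X p \<omega>" by (rule limI)
  qed
qed

section \<open>Dyadic nets of space-time\<close>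

definition dyadic_floor :: "nat \<Rightarrow> real \<Rightarrow> real" where
  "dyadic_floor n r = of_int \<lfloor>2 ^ n * r\<rfloor> / 2 ^ n"

definition dyadic_point :: "nat \<Rightarrow> real \<times> (real^3) \<Rightarrow> real \<times> (real^3)" where
  "dyadic_point n p = (dyadic_floor n (fst p), \<chi> i. dyadic_floor n (snd p $ i))"

text \<open>A box in the supremum norm with integer half-width: rounding coordinates down at any
  level keeps them in the integer range of \<open>dyadic_net\<close>.\<close>

definition space_time_box :: "nat \<Rightarrow> (real \<times> (real^3)) set" where
  "space_time_box N = {p. \<bar>fst p\<bar> \<le> real N \<and> (\<forall>i. \<bar>snd p $ i\<bar> \<le> real N)}"

definition dyadic_net :: "nat \<Rightarrow> nat \<Rightarrow> (real \<times> (real^3)) set" where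
  "dyadic_net N n = (\<lambda>(a, b, c, d). (real_of_int a / 2 ^ n, vector [real_of_int b / 2 ^ n, real_of_int c / 2 ^ n, real_of_int d / 2 ^ n])) `
     (let G = {- (int N * 2 ^ n)..int N * 2 ^ n} in G \<times> G \<times> G \<times> G)"

lemma dyadic_floor_dist: "\<bar>dyadic_floor n r - r\<bar> \<le> (1/2) ^ n"
proof -
  have "\<bar>real_of_int \<lfloor>2 ^ n * r\<rfloor> - 2 ^ n * r\<bar> \<le> 1" by linarith
  then have "\<bar>real_of_int \<lfloor>2 ^ n * r\<rfloor> - 2 ^ n * r\<bar> / 2 ^ n \<le> 1 / 2 ^ n"
    by (intro divide_right_mono) simp_all
  moreover have "dyadic_floor n r - r = (real_of_int \<lfloor>2 ^ n * r\<rfloor> - 2 ^ n * r) / 2 ^ n"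
    by (simp add: dyadic_floor_def diff_divide_distrib)
  ultimately show ?thesis by (simp add: power_one_over)
qed

text \<open>One unit 2^(-n) for the time coordinate and three for the space coordinates, by the l1
  bound on the norm.\<close>

lemma dyadic_point_dist: "dist (dyadic_point n p) p \<le> 4 * (1/2) ^ n"
proof -
  have "dist (dyadic_point n p) p \<le> dist (fst (dyadic_point n p)) (fst p) + dist (snd (dyadic_point n p)) (snd p)"
    using norm_Pair_le[of "fst (dyadic_point n p) - fst p" "snd (dyadic_point n p) - snd p"]
    by (simp add: dist_norm minus_prod_def)
  also have "dist (fst (dyadic_point n p)) (fst p) \<le> (1/2) ^ n"
    using dyadic_floor_dist by (simp add: dyadic_point_def dist_real_def)
  also have "dist (snd (dyadic_point n p)) (snd p) \<le> (\<Sum>i\<in>UNIV. \<bar>(snd (dyadic_point n p) - snd p) $ i\<bar>)"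
    unfolding dist_norm by (rule norm_le_l1_cart)
  also have "\<dots> \<le> (\<Sum>i\<in>(UNIV::3 set). (1/2) ^ n)"
    by (intro sum_mono) (use dyadic_floor_dist in \<open>simp add: dyadic_point_def\<close>)
  finally show ?thesis by simp
qed

lemma dyadic_floor_range:
  assumes "\<bar>r\<bar> \<le> real N"
  shows "\<lfloor>2 ^ n * r\<rfloor> \<in> {- (int N * 2 ^ n)..int N * 2 ^ n}"
proof -
  have "\<bar>2 ^ n * r\<bar> \<le> 2 ^ n * real N" using assms by (simp add: abs_mult)
  then have "- (real N * 2 ^ n) \<le> 2 ^ n * r" "2 ^ n * r \<le> real N * 2 ^ n" by (simp_all add: abs_le_iff mult.commute)
  moreover have "real_of_int (int N * 2 ^ n) = real N * 2 ^ n" by simp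
  ultimately have "real_of_int (- (int N * 2 ^ n)) \<le> 2 ^ n * r" "2 ^ n * r < real_of_int (int N * 2 ^ n) + 1"
    unfolding of_int_minus by linarith+
  then have "- (int N * 2 ^ n) \<le> \<lfloor>2 ^ n * r\<rfloor>" "\<lfloor>2 ^ n * r\<rfloor> < int N * 2 ^ n + 1"
    by (simp only: le_floor_iff, simp only: floor_less_iff of_int_add of_int_1)
  then show ?thesis by simp
qed

lemma dyadic_point_in_net:
  assumes "p \<in> space_time_box N"
  shows "dyadic_point n p \<in> dyadic_net N n"
proof -
  let ?f = "\<lambda>r. \<lfloor>2 ^ n * r\<rfloor>"
  have "dyadic_point n p = (\<lambda>(a, b, c, d). (real_of_int a / 2 ^ n, vector [real_of_int b / 2 ^ n, real_of_int c / 2 ^ n, real_of_int d / 2 ^ n]))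
     (?f (fst p), ?f (snd p $ 1), ?f (snd p $ 2), ?f (snd p $ 3))"
    by (simp add: dyadic_point_def dyadic_floor_def vec_eq_iff forall_3)
  then show ?thesis
    unfolding dyadic_net_def Let_def using assms
    by (intro image_eqI[of _ _ "(?f (fst p), ?f (snd p $ 1), ?f (snd p $ 2), ?f (snd p $ 3))"])
      (auto simp: space_time_box_def intro!: dyadic_floor_range[unfolded atLeastAtMost_iff, THEN conjunct1] dyadic_floor_range[unfolded atLeastAtMost_iff, THEN conjunct2])
qed

lemma finite_dyadic_net: "finite (dyadic_net N n)"
  unfolding dyadic_net_def Let_def by (intro finite_imageI finite_cartesian_product) simp_all

text \<open>Each of the four coordinates takes at most 2N 2^n + 1 values; 16 = 2^4 is the growth
  rate passed to the chaining estimate.\<close>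

lemma card_dyadic_net: "real (card (dyadic_net N n)) \<le> (2 * real N + 1) ^ 4 * 16 ^ n"
proof -
  define g where "g = card {- (int N * 2 ^ n)..int N * 2 ^ n}"
  have g: "real g \<le> (2 * real N + 1) * 2 ^ n"
  proof -
    have "real g = 2 * real N * 2 ^ n + 1" by (simp add: g_def)
    also have "\<dots> \<le> 2 * real N * 2 ^ n + 2 ^ n" by simp
    finally show ?thesis by (simp add: algebra_simps)
  qed
  have "card (dyadic_net N n) \<le> g ^ 4"
  proof -
    let ?G = "{- (int N * 2 ^ n)..int N * 2 ^ n}"
    have "card (dyadic_net N n) \<le> card (?G \<times> ?G \<times> ?G \<times> ?G)"
      unfolding dyadic_net_def Let_def by (intro card_image_le finite_cartesian_product) simp_all
    also have "\<dots> = g ^ 4" unfolding card_cartesian_product g_def[symmetric] by (simp add: eval_nat_numeral)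
    finally show ?thesis .
  qed
  then have "real (card (dyadic_net N n)) \<le> real g ^ 4" by (simp only: of_nat_power[symmetric] of_nat_le_iff)
  also have "\<dots> \<le> ((2 * real N + 1) * 2 ^ n) ^ 4" by (intro power_mono g) simp
  also have "\<dots> = (2 * real N + 1) ^ 4 * 16 ^ n"
    by (simp add: power_mult_distrib power_mult[symmetric] mult.commute[of n]) (simp add: power_mult)
  finally show ?thesis .
qed

lemma space_time_box_interior:
  assumes "norm p < real N"
  shows "p \<in> interior (space_time_box N)"
proof -
  have "ball 0 (real N) \<subseteq> space_time_box N"
  proof
    fix q :: "real \<times> (real^3)" assume "q \<in> ball 0 (real N)"
    then have q: "norm q < real N" by simp
    have "\<bar>fst q\<bar> \<le> norm q" "norm (snd q) \<le> norm q"
      using norm_fst_le[of "fst q" "snd q"] norm_snd_le[of "snd q" "fst q"] by simp_all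
    then show "q \<in> space_time_box N"
      using q component_le_norm_cart[of "snd q"] by (fastforce simp: space_time_box_def intro: order_trans)
  qed
  then show ?thesis using assms by (intro interiorI[of "ball 0 (real N)"]) simp_all
qed

section \<open>Hoelder classes and increments that are too large for them\<close>

lemma holder_on_subset: "holder_on \<gamma> S f \<Longrightarrow> S' \<subseteq> S \<Longrightarrow> holder_on \<gamma> S' f"
  unfolding holder_on_def by blast

lemma holder_on_weaken:
  assumes f: "holder_on \<gamma>' S f" and g: "0 < \<gamma>" "\<gamma> \<le> \<gamma>'" and S: "bounded S"
  shows "holder_on \<gamma> S f"
proof -
  obtain C where C: "\<And>x y. x \<in> S \<Longrightarrow> y \<in> S \<Longrightarrow> \<bar>f x - f y\<bar> \<le> C * dist x y powr \<gamma>'"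
    using f unfolding holder_on_def by blast
  have "\<bar>f x - f y\<bar> \<le> (\<bar>C\<bar> * diameter S powr (\<gamma>' - \<gamma>)) * dist x y powr \<gamma>" if "x \<in> S" "y \<in> S" for x y
  proof -
    have "\<bar>f x - f y\<bar> \<le> \<bar>C\<bar> * dist x y powr \<gamma>'"
      using C[OF that] by (rule order_trans) (intro mult_right_mono, simp_all)
    also have "dist x y powr \<gamma>' = dist x y powr (\<gamma>' - \<gamma>) * dist x y powr \<gamma>"
      by (simp flip: powr_add)
    also have "\<dots> \<le> diameter S powr (\<gamma>' - \<gamma>) * dist x y powr \<gamma>"
      using g diameter_bounded_bound[OF S that] by (intro mult_right_mono powr_mono2) simp_all
    finally show ?thesis by (simp add: mult_left_mono mult.assoc)
  qed
  then show ?thesis unfolding holder_on_def by blast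
qed

lemma holder_on_imp_continuous_on:
  assumes f: "holder_on \<gamma> S f" and g: "0 < \<gamma>"
  shows "continuous_on S f"
proof -
  obtain C where C: "\<And>x y. x \<in> S \<Longrightarrow> y \<in> S \<Longrightarrow> \<bar>f x - f y\<bar> \<le> C * dist x y powr \<gamma>"
    using f unfolding holder_on_def by blast
  show ?thesis
    unfolding continuous_on_def
  proof
    fix x assume x: "x \<in> S"
    have "((\<lambda>y. C * dist y x powr \<gamma>) \<longlongrightarrow> C * dist x x powr \<gamma>) (at x within S)"
      using g by (intro tendsto_mult tendsto_const tendsto_powr' tendsto_dist tendsto_ident_at) auto
    then have "((\<lambda>y. C * dist y x powr \<gamma>) \<longlongrightarrow> 0) (at x within S)" by simp
    then have "((\<lambda>y. f y - f x) \<longlongrightarrow> 0) (at x within S)"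
      by (rule Lim_null_comparison[rotated]) (use C x in \<open>auto simp: eventually_at_filter\<close>)
    then show "(f \<longlongrightarrow> f x) (at x within S)" by (rule LIM_zero_cancel)
  qed
qed

text \<open>Along the sequence the increments exceed 2^(-n\<gamma>'), whereas a Hoelder bound allows
  C 2^(-n\<gamma>), which is smaller for large n.\<close>

lemma holder_on_local_contradiction:
  assumes f: "holder_on \<gamma> S f" and g: "\<gamma> > \<gamma>'"
    and x: "x \<in> S" and y: "\<forall>\<^sub>F n in sequentially. y n \<in> S \<and> dist x (y n) = (1/2) ^ n \<and> \<bar>f x - f (y n)\<bar> > ((1/2) ^ n) powr \<gamma>'"
  shows False
proof -
  obtain C where C: "\<And>x y. x \<in> S \<Longrightarrow> y \<in> S \<Longrightarrow> \<bar>f x - f y\<bar> \<le> C * dist x y powr \<gamma>"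
    using f unfolding holder_on_def by blast
  have "(\<lambda>n. C * ((1/2) powr (\<gamma> - \<gamma>')) ^ n) \<longlonglongrightarrow> C * 0"
    using g powr_less_mono2[of "\<gamma> - \<gamma>'" "1/2" 1] by (intro tendsto_mult tendsto_const LIMSEQ_power_zero) simp
  then have "\<forall>\<^sub>F n in sequentially. C * ((1/2) powr (\<gamma> - \<gamma>')) ^ n < 1"
    by (rule order_tendstoD(2)) simp
  then have "\<forall>\<^sub>F n in sequentially. False"
    using y
  proof eventually_elim
    fix n assume n: "C * ((1/2) powr (\<gamma> - \<gamma>')) ^ n < 1"
      and y: "y n \<in> S \<and> dist x (y n) = (1/2) ^ n \<and> \<bar>f x - f (y n)\<bar> > ((1/2) ^ n) powr \<gamma>'"
    have e: "((1/2) powr (\<gamma> - \<gamma>')) ^ n = ((1/2) ^ n) powr (\<gamma> - \<gamma>')"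
      by (simp add: powr_powr mult.commute flip: powr_realpow)
    have "((1/2) ^ n) powr \<gamma>' < C * ((1/2) ^ n) powr \<gamma>" using C[OF x, of "y n"] y by auto
    also have "((1/2::real) ^ n) powr \<gamma> = ((1/2) ^ n) powr (\<gamma> - \<gamma>') * ((1/2) ^ n) powr \<gamma>'" by (simp flip: powr_add)
    finally have "1 * ((1/2) ^ n) powr \<gamma>' < (C * ((1/2) ^ n) powr (\<gamma> - \<gamma>')) * ((1/2) ^ n) powr \<gamma>'" by (simp add: mult.assoc)
    then have "1 < C * ((1/2) ^ n) powr (\<gamma> - \<gamma>')" by (rule mult_right_less_imp_less) simp
    then show False using n unfolding e by simp
  qed
  then show False by simp
qed

text \<open>The standard deviation is at least of order 2^(-nH), so by the small-ball estimate an
  increment below 2^(-n\<gamma>) has probability at most a multiple of 2^(-n(\<gamma>-H)), which is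
  summable.\<close>

lemma gaussian_limit_large_increments:
  assumes P: "prob_space P" and Z: "\<And>n. n \<ge> m \<Longrightarrow> gaussian_limit P (Z n)"
    and low: "\<And>n. n \<ge> m \<Longrightarrow> (LINT \<omega>|P. (Z n \<omega>)\<^sup>2) \<ge> c * ((1/2) ^ n) powr (2 * H)"
    and c: "c > 0" and g: "\<gamma> > H"
  shows "AE \<omega> in P. \<forall>\<^sub>F n in sequentially. \<bar>Z n \<omega>\<bar> > ((1/2) ^ n) powr \<gamma>"
proof -
  interpret prob_space P by fact
  \<comment> \<open>Empty below \<open>m\<close>, where the hypotheses say nothing about
    \<open>Z n\<close>.\<close>
  define A where "A n = (if n \<ge> m then {\<omega> \<in> space P. \<bar>Z n \<omega>\<bar> \<le> ((1/2) ^ n) powr \<gamma>} else {})" for n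
  have Zm: "Z n \<in> borel_measurable P" if "n \<ge> m" for n using Z[OF that] by (simp add: gaussian_limit_def)
  have Am: "A n \<in> events" for n
    using Zm[of n] by (cases "n \<ge> m") (auto simp: A_def)
  have le: "prob (A n) \<le> 2 / sqrt (c / 2) * ((1/2) powr (\<gamma> - H)) ^ n" for n
  proof (cases "n \<ge> m")
    case True
    let ?d = "(1/2 :: real) ^ n"
    have pos: "c * ?d powr (2 * H) > 0" using c by simp
    have "prob (A n) \<le> 2 * ?d powr \<gamma> / sqrt ((LINT \<omega>|P. (Z n \<omega>)\<^sup>2) / 2)"
      unfolding A_def using True low[OF True] pos
      by (simp del: power_one_over, intro gaussian_limit_small_ball[OF P Z]) simp_all
    also have "\<dots> \<le> 2 * ?d powr \<gamma> / sqrt (c * ?d powr (2 * H) / 2)"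
      using low[OF True] pos by (intro divide_left_mono mult_pos_pos) simp_all
    also have "sqrt (c * ?d powr (2 * H) / 2) = sqrt (c / 2) * ?d powr H"
    proof -
      have "?d powr (2 * H) = (?d powr H)\<^sup>2" by (simp add: powr_powr mult.commute flip: powr_numeral)
      then show ?thesis by (simp add: real_sqrt_mult flip: times_divide_eq_left)
    qed
    also have "2 * ?d powr \<gamma> / (sqrt (c / 2) * ?d powr H) = 2 / sqrt (c / 2) * ?d powr (\<gamma> - H)"
      by (simp add: powr_diff)
    also have "?d powr (\<gamma> - H) = ((1/2) powr (\<gamma> - H)) ^ n"
      by (simp add: powr_powr mult.commute flip: powr_realpow)
    finally show ?thesis .
  qed (use c in \<open>simp add: A_def\<close>)
  have "summable (\<lambda>n. prob (A n))"
  proof (rule summable_comparison_test'[of "\<lambda>n. 2 / sqrt (c / 2) * ((1/2) powr (\<gamma> - H)) ^ n" 0])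
    show "summable (\<lambda>n. 2 / sqrt (c / 2) * ((1/2) powr (\<gamma> - H)) ^ n)"
      using g powr_less_mono2[of "\<gamma> - H" "1/2" 1] by (intro summable_mult summable_geometric) simp
  qed (use le in simp)
  then have "AE \<omega> in P. eventually (\<lambda>n. \<omega> \<in> space P - A n) sequentially"
    by (intro borel_cantelli_AE1 Am) (simp_all add: emeasure_eq_measure)
  then show ?thesis
  proof (rule eventually_mono)
    fix \<omega> assume "eventually (\<lambda>n. \<omega> \<in> space P - A n) sequentially"
    then show "\<forall>\<^sub>F n in sequentially. \<bar>Z n \<omega>\<bar> > ((1/2) ^ n) powr \<gamma>"
      using eventually_ge_at_top[of m] by eventually_elim (auto simp: A_def)
  qed
qed

lemma continuous_on_eq_of_dense:
  fixes f g :: "'a::metric_space \<Rightarrow> real"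
  assumes "continuous_on S f" "continuous_on S g" "D \<subseteq> S" "S \<subseteq> closure D"
    and eq: "\<And>x. x \<in> D \<Longrightarrow> f x = g x" and x: "x \<in> S"
  shows "f x = g x"
proof -
  obtain d where d: "\<And>n. d n \<in> D" "d \<longlonglongrightarrow> x"
    using x assms(4) unfolding closure_sequential[symmetric] by (meson closure_sequential subsetD)
  have "(\<lambda>n. f (d n)) \<longlonglongrightarrow> f x" "(\<lambda>n. g (d n)) \<longlonglongrightarrow> g x"
    using assms(3) d(1)
    by (auto intro!: continuous_on_tendsto_compose[OF assms(1) d(2) x]
        continuous_on_tendsto_compose[OF assms(2) d(2) x] always_eventually)
  then show ?thesis using eq d(1) LIMSEQ_unique by fastforce
qed

section \<open>Sample paths of the solution\<close>

locale stochastic_wave = prob_space P for P :: "'w measure" +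
  fixes F :: "(real \<times> (real^3) \<Rightarrow> real) \<Rightarrow> 'w \<Rightarrow> real"
    and M :: "real \<Rightarrow> (real^3) set \<Rightarrow> 'w \<Rightarrow> real"
    and u :: "real \<Rightarrow> real^3 \<Rightarrow> 'w \<Rightarrow> real"
    and \<beta> T :: real
  assumes T: "0 < T" and \<beta>: "0 < \<beta>" "\<beta> < 2"
    and noise: "riesz_noise P \<beta> F"
    and martingale: "martingale_measure_extending P \<beta> F M"
    and solution: "wave_solution P \<beta> M T u"
begin

text \<open>The critical exponent: an increment of size d has standard deviation of order d^H, so 2H
  appears in all second moments.\<close>

definition H :: real where "H = (2 - \<beta>) / 2"

lemma H_pos: "H > 0" using \<beta> by (simp add: H_def)

lemma two_H: "2 * H = 2 - \<beta>" by (simp add: H_def)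

lemma second_moment_increment:
  obtains C where "C > 0"
    "\<And>t t' x y. t \<in> {0..T} \<Longrightarrow> t' \<in> {0..T} \<Longrightarrow> gaussian_limit P (\<lambda>\<omega>. u t x \<omega> - u t' y \<omega>)"
    "\<And>t t' x y. t \<in> {0..T} \<Longrightarrow> t' \<in> {0..T} \<Longrightarrow>
       ennreal (LINT \<omega>|P. (u t x \<omega> - u t' y \<omega>)\<^sup>2) = ennreal C * spectral_dist2 \<beta> (wave_hat t x) (wave_hat t' y)"
proof -
  from wave_increment_second_moment[OF \<beta>] obtain C where C: "C > 0"
    "\<And>(P :: 'w measure) F M T u t t' x y. prob_space P \<Longrightarrow> riesz_noise P \<beta> F \<Longrightarrow>
       martingale_measure_extending P \<beta> F M \<Longrightarrow> wave_solution P \<beta> M T u \<Longrightarrow> t \<in> {0..T} \<Longrightarrow> t' \<in> {0..T} \<Longrightarrow>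
       gaussian_limit P (\<lambda>\<omega>. u t x \<omega> - u t' y \<omega>) \<and>
       ennreal (LINT \<omega>|P. (u t x \<omega> - u t' y \<omega>)\<^sup>2) = ennreal C * spectral_dist2 \<beta> (wave_hat t x) (wave_hat t' y)" by blast
  show thesis
    by (rule that[OF C(1)]) (use C(2)[OF prob_space_axioms noise martingale solution] in blast)+
qed

lemma increment_gaussian_limit:
  assumes "t \<in> {0..T}" "t' \<in> {0..T}"
  shows "gaussian_limit P (\<lambda>\<omega>. u t x \<omega> - u t' y \<omega>)"
  by (rule second_moment_increment) (use assms in blast)

lemma u_measurable: "t \<in> {0..T} \<Longrightarrow> u t x \<in> borel_measurable P"
  using solution by (auto simp: wave_solution_def is_stochastic_integral_def)

lemma increment_upper:
  obtains K where "K > 0" "\<And>t t' x y. t \<in> {0..T} \<Longrightarrow> t' \<in> {0..T} \<Longrightarrow>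
     (LINT \<omega>|P. (u t x \<omega> - u t' y \<omega>)\<^sup>2) \<le> K * (\<bar>t - t'\<bar> + norm (x - y)) powr (2 * H)"
proof -
  obtain C where C: "C > 0" "\<And>t t' x y. t \<in> {0..T} \<Longrightarrow> t' \<in> {0..T} \<Longrightarrow>
       ennreal (LINT \<omega>|P. (u t x \<omega> - u t' y \<omega>)\<^sup>2) = ennreal C * spectral_dist2 \<beta> (wave_hat t x) (wave_hat t' y)"
    by (rule second_moment_increment) blast
  obtain K where K: "K > 0" "\<And>t t' x y. t \<in> {0..T} \<Longrightarrow> t' \<in> {0..T} \<Longrightarrow>
     spectral_dist2 \<beta> (wave_hat t x) (wave_hat t' y) \<le> ennreal (K * (\<bar>t - t'\<bar> + norm (x - y)) powr (2 - \<beta>))"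
    by (rule wave_hat_dist_upper[OF \<beta> T]) blast
  show thesis
  proof (rule that[of "C * K"])
    fix t t' x y assume t: "t \<in> {0..T}" "t' \<in> {0..T}"
    have "ennreal (LINT \<omega>|P. (u t x \<omega> - u t' y \<omega>)\<^sup>2) \<le> ennreal C * ennreal (K * (\<bar>t - t'\<bar> + norm (x - y)) powr (2 - \<beta>))"
      unfolding C(2)[OF t] by (intro mult_left_mono K(2) t) simp
    then have "ennreal (LINT \<omega>|P. (u t x \<omega> - u t' y \<omega>)\<^sup>2) \<le> ennreal (C * K * (\<bar>t - t'\<bar> + norm (x - y)) powr (2 - \<beta>))"
      using C(1) K(1) by (simp add: ennreal_mult[symmetric] mult.assoc)
    then have "(LINT \<omega>|P. (u t x \<omega> - u t' y \<omega>)\<^sup>2) \<le> C * K * (\<bar>t - t'\<bar> + norm (x - y)) powr (2 - \<beta>)"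
      using C(1) K(1) by (subst (asm) ennreal_le_iff) simp_all
    then show "(LINT \<omega>|P. (u t x \<omega> - u t' y \<omega>)\<^sup>2) \<le> C * K * (\<bar>t - t'\<bar> + norm (x - y)) powr (2 * H)"
      unfolding two_H .
  qed (use C K in simp)
qed

lemma increment_lower_of_spectral:
  obtains C where "C > 0"
    "\<And>t t' x y a. t \<in> {0..T} \<Longrightarrow> t' \<in> {0..T} \<Longrightarrow> ennreal a \<le> spectral_dist2 \<beta> (wave_hat t x) (wave_hat t' y) \<Longrightarrow> a \<ge> 0 \<Longrightarrow>
       C * a \<le> (LINT \<omega>|P. (u t x \<omega> - u t' y \<omega>)\<^sup>2)"
proof -
  obtain C where C: "C > 0" "\<And>t t' x y. t \<in> {0..T} \<Longrightarrow> t' \<in> {0..T} \<Longrightarrow>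
       ennreal (LINT \<omega>|P. (u t x \<omega> - u t' y \<omega>)\<^sup>2) = ennreal C * spectral_dist2 \<beta> (wave_hat t x) (wave_hat t' y)"
    by (rule second_moment_increment) blast
  show thesis
  proof (rule that[OF C(1)])
    fix t t' x y a assume t: "t \<in> {0..T}" "t' \<in> {0..T}"
      and a: "ennreal a \<le> spectral_dist2 \<beta> (wave_hat t x) (wave_hat t' y)" "a \<ge> 0"
    have "ennreal (C * a) \<le> ennreal (LINT \<omega>|P. (u t x \<omega> - u t' y \<omega>)\<^sup>2)"
      unfolding C(2)[OF t] using C(1) a by (simp add: ennreal_mult mult_left_mono)
    then show "C * a \<le> (LINT \<omega>|P. (u t x \<omega> - u t' y \<omega>)\<^sup>2)"
      by (subst (asm) ennreal_le_iff) (simp_all add: integral_nonneg_AE)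
  qed
qed

lemma space_increment_lower:
  assumes t: "t \<in> {0<..T}" and D: "D > 0"
  obtains c where "c > 0" "\<And>x y. norm (x - y) \<le> D \<Longrightarrow>
     c * norm (x - y) powr (2 * H) \<le> (LINT \<omega>|P. (u t x \<omega> - u t y \<omega>)\<^sup>2)"
proof -
  have t': "t > 0" "t \<in> {0..T}" using t by auto
  obtain c where c: "c > 0" "\<And>x y. norm (x - y) \<le> D \<Longrightarrow>
     ennreal (c * norm (x - y) powr (2 - \<beta>)) \<le> spectral_dist2 \<beta> (wave_hat t x) (wave_hat t y)"
    by (rule wave_hat_space_lower[OF \<beta> t'(1) D]) blast
  obtain C where C: "C > 0" "\<And>t t' x y a. t \<in> {0..T} \<Longrightarrow> t' \<in> {0..T} \<Longrightarrow> ennreal a \<le> spectral_dist2 \<beta> (wave_hat t x) (wave_hat t' y) \<Longrightarrow> a \<ge> 0 \<Longrightarrow>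
       C * a \<le> (LINT \<omega>|P. (u t x \<omega> - u t' y \<omega>)\<^sup>2)"
    by (rule increment_lower_of_spectral) blast
  show thesis
  proof (rule that[of "C * c"])
    fix x y :: "real^3" assume "norm (x - y) \<le> D"
    from C(2)[OF t'(2) t'(2) c(2)[OF this]]
    show "C * c * norm (x - y) powr (2 * H) \<le> (LINT \<omega>|P. (u t x \<omega> - u t y \<omega>)\<^sup>2)"
      using c(1) unfolding two_H by (simp add: mult.assoc)
  qed (use c C in simp)
qed

lemma time_increment_lower:
  assumes t0: "t0 > 0"
  obtains c \<delta> where "c > 0" "\<delta> > 0" "\<And>t t' x. t \<in> {t0..T} \<Longrightarrow> t' \<in> {t0..T} \<Longrightarrow> \<bar>t - t'\<bar> < \<delta> \<Longrightarrow>
     c * \<bar>t - t'\<bar> powr (2 * H) \<le> (LINT \<omega>|P. (u t x \<omega> - u t' x \<omega>)\<^sup>2)"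
proof -
  obtain c \<delta> where c: "c > 0" "\<delta> > 0" "\<And>t t' x. t0 \<le> t \<Longrightarrow> t0 \<le> t' \<Longrightarrow> \<bar>t - t'\<bar> < \<delta> \<Longrightarrow>
     ennreal (c * \<bar>t - t'\<bar> powr (2 - \<beta>)) \<le> spectral_dist2 \<beta> (wave_hat t x) (wave_hat t' x)"
    by (rule wave_hat_time_lower[OF \<beta> t0]) blast
  obtain C where C: "C > 0" "\<And>t t' x y a. t \<in> {0..T} \<Longrightarrow> t' \<in> {0..T} \<Longrightarrow> ennreal a \<le> spectral_dist2 \<beta> (wave_hat t x) (wave_hat t' y) \<Longrightarrow> a \<ge> 0 \<Longrightarrow>
       C * a \<le> (LINT \<omega>|P. (u t x \<omega> - u t' y \<omega>)\<^sup>2)"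
    by (rule increment_lower_of_spectral) blast
  show thesis
  proof (rule that[of "C * c" \<delta>])
    fix t t' x assume t: "t \<in> {t0..T}" "t' \<in> {t0..T}" "\<bar>t - t'\<bar> < \<delta>"
    have "C * (c * \<bar>t - t'\<bar> powr (2 - \<beta>)) \<le> (LINT \<omega>|P. (u t x \<omega> - u t' x \<omega>)\<^sup>2)"
      by (rule C(2)[OF _ _ c(3)]) (use t t0 c(1) in auto)
    then show "C * c * \<bar>t - t'\<bar> powr (2 * H) \<le> (LINT \<omega>|P. (u t x \<omega> - u t' x \<omega>)\<^sup>2)"
      unfolding two_H by (simp only: mult.assoc)
  qed (use c C in simp_all)
qed

text \<open>Freezing the time argument outside \<open>[0,T]\<close> gives a field on all of space-time with the same increment bounds.\<close>

definition field :: "real \<times> (real^3) \<Rightarrow> 'w \<Rightarrow> real" where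
  "field p = u (max 0 (min T (fst p))) (snd p)"

text \<open>\<open>lim\<close> is a total function, so the definition covers every outcome and stays
  measurable; outside a null set it is a genuine limit at each given point.\<close>

definition cont_field :: "real \<Rightarrow> real^3 \<Rightarrow> 'w \<Rightarrow> real" where
  "cont_field t x \<omega> = lim (\<lambda>n. field (dyadic_point n (t, x)) \<omega>)"

lemma field_measurable: "field p \<in> borel_measurable P"
  unfolding field_def using T by (intro u_measurable) simp

lemma field_tail:
  obtains C :: "nat \<Rightarrow> real" where "\<And>k. C k \<ge> 0"
    "\<And>k p q l. l > 0 \<Longrightarrow> measure P {\<omega> \<in> space P. \<bar>field p \<omega> - field q \<omega>\<bar> \<ge> l} \<le> C k * (dist p q powr (2 * H) / l\<^sup>2) ^ k"
proof -
  obtain K where K: "K > 0" "\<And>t t' x y. t \<in> {0..T} \<Longrightarrow> t' \<in> {0..T} \<Longrightarrow>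
     (LINT \<omega>|P. (u t x \<omega> - u t' y \<omega>)\<^sup>2) \<le> K * (\<bar>t - t'\<bar> + norm (x - y)) powr (2 * H)"
    by (rule increment_upper) blast
  define a where "a k = (fact (2 * k) / (2 ^ k * fact k) * 8 ^ k :: real)" for k
  have a: "a k \<ge> 0" for k by (simp add: a_def)
  show thesis
  proof (rule that[of "\<lambda>k. a k * (K * 2 powr (2 * H)) ^ k"])
    fix k :: nat and p q :: "real \<times> (real^3)" and l :: real assume l: "l > 0"
    let ?t = "max 0 (min T (fst p))" and ?t' = "max 0 (min T (fst q))"
    have t: "?t \<in> {0..T}" "?t' \<in> {0..T}" using T by auto
    let ?E = "LINT \<omega>|P. (field p \<omega> - field q \<omega>)\<^sup>2"
    have E0: "?E \<ge> 0" by (simp add: integral_nonneg_AE)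
    have "?E \<le> K * (\<bar>?t - ?t'\<bar> + norm (snd p - snd q)) powr (2 * H)"
      unfolding field_def by (rule K(2)[OF t])
    also have "\<dots> \<le> K * (2 * dist p q) powr (2 * H)"
    proof (intro mult_left_mono powr_mono2)
      \<comment> \<open>Clamping to [0,T] is 1-Lipschitz, and the time and space increments are each
        at most the distance in the product space, whence the factor 2.\<close>
      have "\<bar>?t - ?t'\<bar> \<le> dist (fst p) (fst q)" by (simp add: dist_real_def)
      then show "\<bar>?t - ?t'\<bar> + norm (snd p - snd q) \<le> 2 * dist p q"
        using dist_fst_le[of p q] dist_snd_le[of p q] by (simp add: dist_norm)
    qed (use K(1) H_pos in simp_all)
    also have "\<dots> = K * 2 powr (2 * H) * dist p q powr (2 * H)" by (simp add: powr_mult)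
    finally have "(?E / l\<^sup>2) ^ k \<le> (K * 2 powr (2 * H) * dist p q powr (2 * H) / l\<^sup>2) ^ k"
      using E0 by (intro power_mono divide_right_mono divide_nonneg_nonneg) simp_all
    also have "\<dots> = (K * 2 powr (2 * H)) ^ k * (dist p q powr (2 * H) / l\<^sup>2) ^ k"
      by (simp only: power_mult_distrib[symmetric] times_divide_eq_right)
    finally have "a k * (?E / l\<^sup>2) ^ k \<le> a k * ((K * 2 powr (2 * H)) ^ k * (dist p q powr (2 * H) / l\<^sup>2) ^ k)"
      by (intro mult_left_mono a)
    moreover have "measure P {\<omega> \<in> space P. \<bar>field p \<omega> - field q \<omega>\<bar> \<ge> l} \<le> a k * (?E / l\<^sup>2) ^ k"
      unfolding a_def using increment_gaussian_limit[OF t, of "snd p" "snd q"] l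
      by (intro gaussian_limit_tail[OF prob_space_axioms]) (simp_all add: field_def)
    ultimately show "measure P {\<omega> \<in> space P. \<bar>field p \<omega> - field q \<omega>\<bar> \<ge> l} \<le>
        a k * (K * 2 powr (2 * H)) ^ k * (dist p q powr (2 * H) / l\<^sup>2) ^ k"
      by (simp add: mult.assoc)
  qed (use a K in simp)
qed

section \<open>The continuous version\<close>

lemma cont_field_measurable: "cont_field t x \<in> borel_measurable P"
  unfolding cont_field_def[abs_def] by (intro borel_measurable_lim_metric field_measurable)

lemma cont_field_eq:
  assumes t: "t \<in> {0..T}"
  shows "AE \<omega> in P. cont_field t x \<omega> = u t x \<omega>"
proof -
  obtain C where C: "\<And>k. C k \<ge> 0"
    "\<And>k p q l. l > 0 \<Longrightarrow> measure P {\<omega> \<in> space P. \<bar>field p \<omega> - field q \<omega>\<bar> \<ge> l} \<le> C k * (dist p q powr (2 * H) / l\<^sup>2) ^ k"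
    by (rule field_tail) blast
  have "AE \<omega> in P. lim (\<lambda>n. field (dyadic_point n (t, x)) \<omega>) = field (t, x) \<omega>"
    by (rule chaining_version[OF prob_space_axioms field_measurable C(2) C(1) H_pos _ dyadic_point_dist]) simp_all
  moreover have "field (t, x) = u t x" using t by (simp add: field_def)
  ultimately show ?thesis by (simp add: cont_field_def)
qed

text \<open>Chaining along the dyadic nets of each box; the constant 4 of
  \<open>dyadic_point_dist\<close> is the mesh constant c there, and countably many boxes leave one
  null set.\<close>

lemma cont_field_holder:
  assumes g: "0 < \<gamma>" "\<gamma> < H"
  shows "AE \<omega> in P. \<forall>N. holder_on \<gamma> (space_time_box N) (\<lambda>p. cont_field (fst p) (snd p) \<omega>)"
  unfolding AE_all_countable
proof
  fix N
  obtain C where C: "\<And>k. C k \<ge> 0"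
    "\<And>k p q l. l > 0 \<Longrightarrow> measure P {\<omega> \<in> space P. \<bar>field p \<omega> - field q \<omega>\<bar> \<ge> l} \<le> C k * (dist p q powr (2 * H) / l\<^sup>2) ^ k"
    by (rule field_tail) blast
  have "AE \<omega> in P. \<exists>n0. \<forall>n\<ge>n0. \<forall>p\<in>dyadic_net N n \<union> dyadic_net N (Suc n). \<forall>q\<in>dyadic_net N n \<union> dyadic_net N (Suc n).
     dist p q \<le> 4 * 4 * (1/2) ^ n \<longrightarrow> \<bar>field p \<omega> - field q \<omega>\<bar> \<le> ((1/2) powr \<gamma>) ^ n"
    by (rule chaining_AE[OF prob_space_axioms field_measurable C(2) C(1) g _ finite_dyadic_net card_dyadic_net]) simp_all
  then show "AE \<omega> in P. holder_on \<gamma> (space_time_box N) (\<lambda>p. cont_field (fst p) (snd p) \<omega>)"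
  proof (rule eventually_mono)
    fix \<omega> assume "\<exists>n0. \<forall>n\<ge>n0. \<forall>p\<in>dyadic_net N n \<union> dyadic_net N (Suc n). \<forall>q\<in>dyadic_net N n \<union> dyadic_net N (Suc n).
     dist p q \<le> 4 * 4 * (1/2) ^ n \<longrightarrow> \<bar>field p \<omega> - field q \<omega>\<bar> \<le> ((1/2) powr \<gamma>) ^ n"
    then obtain n0 where n0: "\<And>n p q. n0 \<le> n \<Longrightarrow> p \<in> dyadic_net N n \<union> dyadic_net N (Suc n) \<Longrightarrow>
       q \<in> dyadic_net N n \<union> dyadic_net N (Suc n) \<Longrightarrow> dist p q \<le> 4 * 4 * (1/2) ^ n \<Longrightarrow>
       \<bar>field p \<omega> - field q \<omega>\<bar> \<le> ((1/2) powr \<gamma>) ^ n" by blast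
    have "holder_on \<gamma> (space_time_box N) (\<lambda>p. lim (\<lambda>n. field (dyadic_point n p) \<omega>))"
      by (rule chaining_holder[OF g(1) _ finite_dyadic_net dyadic_point_in_net dyadic_point_dist n0]) simp_all
    then show "holder_on \<gamma> (space_time_box N) (\<lambda>p. cont_field (fst p) (snd p) \<omega>)"
      by (simp add: cont_field_def)
  qed
qed

lemma cont_field_continuous: "AE \<omega> in P. continuous_on UNIV (\<lambda>p. cont_field (fst p) (snd p) \<omega>)"
proof -
  have g: "0 < H / 2" "H / 2 < H" using H_pos by simp_all
  show ?thesis
  proof (rule eventually_mono[OF cont_field_holder[OF g]])
    fix \<omega> assume h: "\<forall>N. holder_on (H / 2) (space_time_box N) (\<lambda>p. cont_field (fst p) (snd p) \<omega>)"
    have "isCont (\<lambda>p. cont_field (fst p) (snd p) \<omega>) p" for p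
    proof -
      obtain N :: nat where "norm p < real N" using reals_Archimedean2 by blast
      then have "p \<in> interior (space_time_box N)" by (rule space_time_box_interior)
      moreover have "continuous_on (space_time_box N) (\<lambda>p. cont_field (fst p) (snd p) \<omega>)"
        using h g(1) by (intro holder_on_imp_continuous_on[of "H / 2"]) simp_all
      ultimately show ?thesis by (intro continuous_on_interior)
    qed
    then show "continuous_on UNIV (\<lambda>p. cont_field (fst p) (snd p) \<omega>)"
      by (intro continuous_at_imp_continuous_on) simp
  qed
qed

lemma continuous_version_cont_field: "continuous_version P T u cont_field"
  unfolding continuous_version_def
proof (intro conjI ballI allI)
  show "AE \<omega> in P. continuous_on ({0..T} \<times> UNIV) (\<lambda>(t, x). cont_field t x \<omega>)"
    using cont_field_continuous by (rule eventually_mono) (auto simp: split_beta' intro: continuous_on_subset)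
qed (simp_all add: cont_field_measurable cont_field_eq)

text \<open>Agreement holds almost surely at each point of a countable dense set, hence at all of
  them outside one null set, and continuity of both fields extends it to the whole strip. Path
  properties of \<open>cont_field\<close> thereby pass to any continuous version.\<close>

lemma continuous_version_eq:
  assumes v: "continuous_version P T u v"
  shows "AE \<omega> in P. \<forall>t\<in>{0..T}. \<forall>x. v t x \<omega> = cont_field t x \<omega>"
proof -
  let ?S = "{0..T} \<times> (UNIV :: (real^3) set)"
  obtain D where D: "countable D" "D \<subseteq> ?S" "?S \<subseteq> closure D" using separable by blast
  have "AE \<omega> in P. v (fst p) (snd p) \<omega> = cont_field (fst p) (snd p) \<omega>" if "p \<in> D" for p
  proof -
    have "fst p \<in> {0..T}" using D(2) that by auto
    then have "AE \<omega> in P. v (fst p) (snd p) \<omega> = u (fst p) (snd p) \<omega>" "AE \<omega> in P. cont_field (fst p) (snd p) \<omega> = u (fst p) (snd p) \<omega>"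
      using v cont_field_eq by (auto simp: continuous_version_def)
    then show ?thesis by eventually_elim simp
  qed
  then have "AE \<omega> in P. \<forall>p\<in>D. v (fst p) (snd p) \<omega> = cont_field (fst p) (snd p) \<omega>"
    by (simp add: AE_ball_countable[OF D(1)])
  moreover have "AE \<omega> in P. continuous_on ?S (\<lambda>p. v (fst p) (snd p) \<omega>)"
    using v by (simp add: continuous_version_def split_beta')
  ultimately show ?thesis
    using cont_field_continuous
  proof eventually_elim
    fix \<omega> assume e: "\<forall>p\<in>D. v (fst p) (snd p) \<omega> = cont_field (fst p) (snd p) \<omega>"
      and c: "continuous_on ?S (\<lambda>p. v (fst p) (snd p) \<omega>)" "continuous_on UNIV (\<lambda>p. cont_field (fst p) (snd p) \<omega>)"
    show "\<forall>t\<in>{0..T}. \<forall>x. v t x \<omega> = cont_field t x \<omega>"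
    proof (intro ballI allI)
      fix t x assume "t \<in> {0..T}"
      then show "v t x \<omega> = cont_field t x \<omega>"
        using continuous_on_eq_of_dense[OF c(1) continuous_on_subset[OF c(2)] D(2,3), of "(t, x)"] e by simp
    qed
  qed
qed

text \<open>To have one null set for all exponents, rational ones are treated first. A rational
  between \<gamma> and \<open>H\<close> then covers \<gamma>, because on bounded sets a larger
  exponent implies a smaller one.\<close>

lemma continuous_version_holder:
  assumes v: "continuous_version P T u v"
  shows "AE \<omega> in P. \<forall>\<gamma>. 0 < \<gamma> \<and> \<gamma> < H \<longrightarrow>
     (\<forall>S. bounded S \<and> S \<subseteq> {0..T} \<times> UNIV \<longrightarrow> holder_on \<gamma> S (\<lambda>p. v (fst p) (snd p) \<omega>))"
proof -
  have "AE \<omega> in P. \<forall>\<gamma>\<in>\<rat> \<inter> {0<..<H}. \<forall>N. holder_on \<gamma> (space_time_box N) (\<lambda>p. cont_field (fst p) (snd p) \<omega>)"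
  proof (subst AE_ball_countable)
    show "countable (\<rat> \<inter> {0<..<H})" by (rule countable_Int1[OF countable_rat])
  qed (simp add: cont_field_holder)
  with continuous_version_eq[OF v] show ?thesis
  proof eventually_elim
    fix \<omega> assume e: "\<forall>t\<in>{0..T}. \<forall>x. v t x \<omega> = cont_field t x \<omega>"
      and h: "\<forall>\<gamma>\<in>\<rat> \<inter> {0<..<H}. \<forall>N. holder_on \<gamma> (space_time_box N) (\<lambda>p. cont_field (fst p) (snd p) \<omega>)"
    show "\<forall>\<gamma>. 0 < \<gamma> \<and> \<gamma> < H \<longrightarrow>
     (\<forall>S. bounded S \<and> S \<subseteq> {0..T} \<times> UNIV \<longrightarrow> holder_on \<gamma> S (\<lambda>p. v (fst p) (snd p) \<omega>))"
    proof (intro allI impI)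
      fix \<gamma> and S :: "(real \<times> (real^3)) set" assume g: "0 < \<gamma> \<and> \<gamma> < H" and S: "bounded S \<and> S \<subseteq> {0..T} \<times> UNIV"
      obtain r where r: "r \<in> \<rat>" "\<gamma> < r" "r < H" using Rats_dense_in_real[OF conjunct2[OF g]] by blast
      obtain B where B: "\<And>p. p \<in> S \<Longrightarrow> norm p \<le> B" using conjunct1[OF S] unfolding bounded_iff by blast
      obtain N :: nat where N: "B < real N" using reals_Archimedean2 by blast
      have "S \<subseteq> space_time_box N"
      proof
        fix p assume "p \<in> S"
        then have "norm p < real N" by (rule le_less_trans[OF B N])
        then show "p \<in> space_time_box N"
          by (rule subsetD[OF interior_subset space_time_box_interior])
      qed
      then have "holder_on r S (\<lambda>p. cont_field (fst p) (snd p) \<omega>)"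
        by (intro holder_on_subset[OF h[rule_format]]) (use r g in auto)
      then obtain C where C: "\<forall>p\<in>S. \<forall>q\<in>S. \<bar>cont_field (fst p) (snd p) \<omega> - cont_field (fst q) (snd q) \<omega>\<bar> \<le> C * dist p q powr r"
        unfolding holder_on_def by blast
      have v: "v (fst p) (snd p) \<omega> = cont_field (fst p) (snd p) \<omega>" if "p \<in> S" for p
      proof -
        have "fst p \<in> {0..T}" using subsetD[OF conjunct2[OF S] that] by (simp add: mem_Times_iff)
        then show ?thesis using e by blast
      qed
      have "holder_on r S (\<lambda>p. v (fst p) (snd p) \<omega>)"
        unfolding holder_on_def by (rule exI[of _ C], intro ballI) (simp only: v C)
      then show "holder_on \<gamma> S (\<lambda>p. v (fst p) (snd p) \<omega>)"
        by (rule holder_on_weaken) (use g r S in auto)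
    qed
  qed
qed

lemma continuous_version_space_holder:
  assumes v: "continuous_version P T u v" and t: "t \<in> {0..T}"
  shows "AE \<omega> in P. \<forall>\<gamma>. 0 < \<gamma> \<and> \<gamma> < H \<longrightarrow> (\<forall>K. compact K \<longrightarrow> holder_on \<gamma> K (\<lambda>x. v t x \<omega>))"
proof (rule eventually_mono[OF continuous_version_holder[OF v]], intro allI impI)
  fix \<omega> \<gamma> and K :: "(real^3) set"
  assume h: "\<forall>\<gamma>. 0 < \<gamma> \<and> \<gamma> < H \<longrightarrow>
     (\<forall>S. bounded S \<and> S \<subseteq> {0..T} \<times> UNIV \<longrightarrow> holder_on \<gamma> S (\<lambda>p. v (fst p) (snd p) \<omega>))"
    and g: "0 < \<gamma> \<and> \<gamma> < H" and K: "compact K"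
  have "holder_on \<gamma> ({t} \<times> K) (\<lambda>p. v (fst p) (snd p) \<omega>)"
  proof -
    have "bounded ({t} \<times> K) \<and> {t} \<times> K \<subseteq> {0..T} \<times> UNIV"
      using t by (auto intro: bounded_Times compact_imp_bounded[OF K])
    then show ?thesis using h g by blast
  qed
  then show "holder_on \<gamma> K (\<lambda>x. v t x \<omega>)"
    unfolding holder_on_def by (simp add: dist_Pair_Pair)
qed

lemma continuous_version_time_holder:
  assumes v: "continuous_version P T u v"
  shows "AE \<omega> in P. \<forall>\<gamma>. 0 < \<gamma> \<and> \<gamma> < H \<longrightarrow> holder_on \<gamma> {0..T} (\<lambda>t. v t x \<omega>)"
proof (rule eventually_mono[OF continuous_version_holder[OF v]], intro allI impI)
  fix \<omega> \<gamma>
  assume h: "\<forall>\<gamma>. 0 < \<gamma> \<and> \<gamma> < H \<longrightarrow>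
     (\<forall>S. bounded S \<and> S \<subseteq> {0..T} \<times> UNIV \<longrightarrow> holder_on \<gamma> S (\<lambda>p. v (fst p) (snd p) \<omega>))"
    and g: "0 < \<gamma> \<and> \<gamma> < H"
  have "holder_on \<gamma> ({0..T} \<times> {x}) (\<lambda>p. v (fst p) (snd p) \<omega>)"
    using h[rule_format, of \<gamma> "{0..T} \<times> {x}"] g by (auto simp: bounded_Times)
  then show "holder_on \<gamma> {0..T} (\<lambda>t. v t x \<omega>)"
    unfolding holder_on_def by (simp add: dist_Pair_Pair)
qed

section \<open>Irregularity of the paths\<close>

lemma continuous_version_AE_eq:
  assumes "continuous_version P T u v" "t \<in> {0..T}"
  shows "AE \<omega> in P. v t x \<omega> = u t x \<omega>"
  using assms by (simp add: continuous_version_def)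

text \<open>Base points from a countable dense set and rational exponents leave one null set. A set
  with interior contains some base point d and, for all large n, also d + 2^(-n) e; the increments
  along this sequence violate any Hoelder bound of exponent above \<open>H\<close>.\<close>

lemma continuous_version_space_rough:
  assumes v: "continuous_version P T u v" and t: "t \<in> {0<..T}"
  shows "AE \<omega> in P. \<forall>\<gamma>>H. \<forall>K. compact K \<and> interior K \<noteq> {} \<longrightarrow> \<not> holder_on \<gamma> K (\<lambda>x. v t x \<omega>)"
proof -
  have tT: "t \<in> {0..T}" using t by simp
  obtain e :: "real^3" where e: "e \<in> Basis" using nonempty_Basis by blast
  then have e: "norm e = 1" by (rule norm_Basis)
  obtain D :: "(real^3) set" where D: "countable D" "\<And>X. open X \<Longrightarrow> X \<noteq> {} \<Longrightarrow> \<exists>d\<in>D. d \<in> X"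
    by (rule countable_dense_setE) blast
  obtain c where c: "c > 0" "\<And>x y. norm (x - y) \<le> 1 \<Longrightarrow>
     c * norm (x - y) powr (2 * H) \<le> (LINT \<omega>|P. (u t x \<omega> - u t y \<omega>)\<^sup>2)"
    by (rule space_increment_lower[OF t zero_less_one]) blast
  let ?y = "\<lambda>d n. d + (1/2) ^ n *\<^sub>R e"
  have rough: "AE \<omega> in P. \<forall>\<^sub>F n in sequentially. \<bar>v t d \<omega> - v t (?y d n) \<omega>\<bar> > ((1/2) ^ n) powr \<gamma>" if "\<gamma> > H" for d \<gamma>
  proof -
    have "AE \<omega> in P. \<forall>\<^sub>F n in sequentially. \<bar>u t d \<omega> - u t (?y d n) \<omega>\<bar> > ((1/2) ^ n) powr \<gamma>"
    proof (rule gaussian_limit_large_increments[OF prob_space_axioms _ _ c(1) that, where m=0])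
      fix n
      show "gaussian_limit P (\<lambda>\<omega>. u t d \<omega> - u t (?y d n) \<omega>)" by (rule increment_gaussian_limit[OF tT tT])
      show "c * ((1/2) ^ n) powr (2 * H) \<le> (LINT \<omega>|P. (u t d \<omega> - u t (?y d n) \<omega>)\<^sup>2)"
        using c(2)[of d "?y d n"] e by (simp add: power_le_one)
    qed
    moreover have "AE \<omega> in P. \<forall>n. v t (?y d n) \<omega> = u t (?y d n) \<omega>"
      unfolding AE_all_countable using continuous_version_AE_eq[OF v tT] by blast
    ultimately show ?thesis
      using continuous_version_AE_eq[OF v tT, of d] by eventually_elim simp
  qed
  have "AE \<omega> in P. \<forall>z\<in>D \<times> (\<rat> \<inter> {H<..}). \<forall>\<^sub>F n in sequentially. \<bar>v t (fst z) \<omega> - v t (?y (fst z) n) \<omega>\<bar> > ((1/2) ^ n) powr (snd z)"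
    using D(1) by (subst AE_ball_countable) (auto intro!: rough countable_SIGMA countable_Int1 countable_rat)
  then show ?thesis
  proof (rule eventually_mono, intro allI impI notI)
    fix \<omega> \<gamma> K
    assume *: "\<forall>z\<in>D \<times> (\<rat> \<inter> {H<..}). \<forall>\<^sub>F n in sequentially. \<bar>v t (fst z) \<omega> - v t (?y (fst z) n) \<omega>\<bar> > ((1/2) ^ n) powr (snd z)"
      and g: "\<gamma> > H" and K: "compact K \<and> interior K \<noteq> {}" and h: "holder_on \<gamma> K (\<lambda>x. v t x \<omega>)"
    obtain d where d: "d \<in> D" "d \<in> interior K" using D(2)[of "interior K"] K by auto
    obtain r where r: "r \<in> \<rat>" "H < r" "r < \<gamma>" using Rats_dense_in_real[OF g] by blast
    have big: "\<forall>\<^sub>F n in sequentially. \<bar>v t d \<omega> - v t (?y d n) \<omega>\<bar> > ((1/2) ^ n) powr r"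
      using bspec[OF *, of "(d, r)"] d r by simp
    have "(\<lambda>n. ?y d n) \<longlonglongrightarrow> d + 0 *\<^sub>R e"
      by (intro tendsto_add tendsto_const tendsto_scaleR LIMSEQ_power_zero) simp
    then have "\<forall>\<^sub>F n in sequentially. ?y d n \<in> interior K"
      using d by (intro topological_tendstoD) simp_all
    with big have "\<forall>\<^sub>F n in sequentially. ?y d n \<in> K \<and> dist d (?y d n) = (1/2) ^ n \<and> \<bar>v t d \<omega> - v t (?y d n) \<omega>\<bar> > ((1/2) ^ n) powr r"
    proof eventually_elim
      fix n assume "\<bar>v t d \<omega> - v t (?y d n) \<omega>\<bar> > ((1/2) ^ n) powr r" "?y d n \<in> interior K"
      then show "?y d n \<in> K \<and> dist d (?y d n) = (1/2) ^ n \<and> \<bar>v t d \<omega> - v t (?y d n) \<omega>\<bar> > ((1/2) ^ n) powr r"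
        using e interior_subset[of K] by (auto simp: dist_norm)
    qed
    then show False
      by (rule holder_on_local_contradiction[OF h r(3) subsetD[OF interior_subset d(2)]])
  qed
qed

text \<open>The scheme in space is repeated with rational base times d in (0,T) and increments to
  the right of d. The lower bound on time increments is taken with t0 = d, which is positive because
  d > a \<ge> 0.\<close>

lemma continuous_version_time_rough:
  assumes v: "continuous_version P T u v"
  shows "AE \<omega> in P. \<forall>\<gamma>>H. \<forall>a b. 0 \<le> a \<and> a < b \<and> b \<le> T \<longrightarrow> \<not> holder_on \<gamma> {a..b} (\<lambda>t. v t x \<omega>)"
proof -
  let ?y = "\<lambda>d n. d + (1/2 :: real) ^ n"
  have y: "(\<lambda>n. ?y d n) \<longlonglongrightarrow> d" for d
    using tendsto_add[OF tendsto_const[of d] LIMSEQ_power_zero[of "1/2 :: real"]] by simp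
  have rough: "AE \<omega> in P. \<forall>\<^sub>F n in sequentially. \<bar>v d x \<omega> - v (?y d n) x \<omega>\<bar> > ((1/2) ^ n) powr \<gamma>"
    if g: "\<gamma> > H" and d: "0 < d" "d < T" for d \<gamma>
  proof -
    obtain c \<delta> where c: "c > 0" "\<delta> > 0" "\<And>t t' x. t \<in> {d..T} \<Longrightarrow> t' \<in> {d..T} \<Longrightarrow> \<bar>t - t'\<bar> < \<delta> \<Longrightarrow>
     c * \<bar>t - t'\<bar> powr (2 * H) \<le> (LINT \<omega>|P. (u t x \<omega> - u t' x \<omega>)\<^sup>2)"
      by (rule time_increment_lower[OF d(1)]) blast
    \<comment> \<open>Late enough, the second time lies in [d,T] and within the range
      \<open>\<delta>\<close> of the lower bound.\<close>
    have "\<forall>\<^sub>F n in sequentially. ?y d n < T \<and> ?y d n < d + \<delta>"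
      using order_tendstoD(2)[OF y d(2)] order_tendstoD(2)[OF y[of d], of "d + \<delta>"] c(2) by (auto intro: eventually_conj)
    then obtain n0 where n0: "\<And>n. n \<ge> n0 \<Longrightarrow> ?y d n < T \<and> ?y d n < d + \<delta>"
      unfolding eventually_sequentially by blast
    have "AE \<omega> in P. \<forall>\<^sub>F n in sequentially. \<bar>u d x \<omega> - u (?y d n) x \<omega>\<bar> > ((1/2) ^ n) powr \<gamma>"
    proof (rule gaussian_limit_large_increments[OF prob_space_axioms _ _ c(1) g, where m=n0])
      fix n assume n: "n \<ge> n0"
      have yn: "?y d n \<in> {d..T}" using n0[OF n] by simp
      show "gaussian_limit P (\<lambda>\<omega>. u d x \<omega> - u (?y d n) x \<omega>)"
        using yn d by (intro increment_gaussian_limit) auto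
      show "c * ((1/2) ^ n) powr (2 * H) \<le> (LINT \<omega>|P. (u d x \<omega> - u (?y d n) x \<omega>)\<^sup>2)"
        using c(3)[of d "?y d n" x] yn n0[OF n] d by simp
    qed
    moreover have "AE \<omega> in P. \<forall>n\<in>{n0..}. v (?y d n) x \<omega> = u (?y d n) x \<omega>"
    proof (subst AE_ball_countable)
      show "\<forall>n\<in>{n0..}. AE \<omega> in P. v (?y d n) x \<omega> = u (?y d n) x \<omega>"
        using n0 d by (auto intro!: continuous_version_AE_eq[OF v] add_nonneg_nonneg less_imp_le)
    qed simp
    moreover have "AE \<omega> in P. v d x \<omega> = u d x \<omega>"
      using d by (intro continuous_version_AE_eq[OF v]) simp
    ultimately show ?thesis
    proof eventually_elim
      fix \<omega> assume a: "\<forall>\<^sub>F n in sequentially. \<bar>u d x \<omega> - u (?y d n) x \<omega>\<bar> > ((1/2) ^ n) powr \<gamma>"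
        and e: "\<forall>n\<in>{n0..}. v (?y d n) x \<omega> = u (?y d n) x \<omega>" "v d x \<omega> = u d x \<omega>"
      show "\<forall>\<^sub>F n in sequentially. \<bar>v d x \<omega> - v (?y d n) x \<omega>\<bar> > ((1/2) ^ n) powr \<gamma>"
        using a eventually_ge_at_top[of n0] by eventually_elim (use e in simp)
    qed
  qed
  have "AE \<omega> in P. \<forall>z\<in>(\<rat> \<inter> {0<..<T}) \<times> (\<rat> \<inter> {H<..}). \<forall>\<^sub>F n in sequentially. \<bar>v (fst z) x \<omega> - v (?y (fst z) n) x \<omega>\<bar> > ((1/2) ^ n) powr (snd z)"
    by (subst AE_ball_countable) (auto intro!: rough countable_SIGMA countable_Int1 countable_rat)
  then show ?thesis
  proof (rule eventually_mono, intro allI impI notI)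
    fix \<omega> \<gamma> a b
    assume *: "\<forall>z\<in>(\<rat> \<inter> {0<..<T}) \<times> (\<rat> \<inter> {H<..}). \<forall>\<^sub>F n in sequentially. \<bar>v (fst z) x \<omega> - v (?y (fst z) n) x \<omega>\<bar> > ((1/2) ^ n) powr (snd z)"
      and g: "\<gamma> > H" and ab: "0 \<le> a \<and> a < b \<and> b \<le> T" and h: "holder_on \<gamma> {a..b} (\<lambda>t. v t x \<omega>)"
    obtain d where d: "d \<in> \<rat>" "a < d" "d < b" using Rats_dense_in_real ab by blast
    obtain r where r: "r \<in> \<rat>" "H < r" "r < \<gamma>" using Rats_dense_in_real[OF g] by blast
    have "\<forall>\<^sub>F n in sequentially. \<bar>v d x \<omega> - v (?y d n) x \<omega>\<bar> > ((1/2) ^ n) powr r"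
      using bspec[OF *, of "(d, r)"] d r ab by simp
    with order_tendstoD(2)[OF y d(3)]
    have "\<forall>\<^sub>F n in sequentially. ?y d n \<in> {a..b} \<and> dist d (?y d n) = (1/2) ^ n \<and> \<bar>v d x \<omega> - v (?y d n) x \<omega>\<bar> > ((1/2) ^ n) powr r"
    proof eventually_elim
      fix n assume "\<bar>v d x \<omega> - v (?y d n) x \<omega>\<bar> > ((1/2) ^ n) powr r" "?y d n < b"
      then show "?y d n \<in> {a..b} \<and> dist d (?y d n) = (1/2) ^ n \<and> \<bar>v d x \<omega> - v (?y d n) x \<omega>\<bar> > ((1/2) ^ n) powr r"
        using d(2) by (auto simp: dist_real_def intro!: add_increasing2)
    qed
    then show False
      using holder_on_local_contradiction[OF h r(3), of d] d by simp
  qed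
qed

end

text \<open>Irregularity is asserted on compact sets with nonempty interior and on nondegenerate
  intervals, since on a single point every function is Hoelder continuous. The almost sure
  quantifier stands outside those over exponents and sets, so one exceptional event serves them all
  for each fixed t or x.\<close>

theorem theorem5p1:
  fixes P :: "'w measure"
    and F :: "(real \<times> (real^3) \<Rightarrow> real) \<Rightarrow> 'w \<Rightarrow> real"
    and M :: "real \<Rightarrow> (real^3) set \<Rightarrow> 'w \<Rightarrow> real"
    and u :: "real \<Rightarrow> real^3 \<Rightarrow> 'w \<Rightarrow> real"
    and \<beta> T :: real
  assumes "prob_space P"
    and "0 < T"
    and "0 < \<beta>" and "\<beta> < 2"
    and "riesz_noise P \<beta> F"
    and "martingale_measure_extending P \<beta> F M"
    and "wave_solution P \<beta> M T u"
  shows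
    "(\<forall>t\<in>{0<..T}. \<forall>K. compact K \<longrightarrow>
        (\<exists>c1>0. \<forall>x\<in>K. \<forall>y\<in>K.
           (LINT \<omega>|P. \<bar>u t x \<omega> - u t y \<omega>\<bar>\<^sup>2) \<ge> c1 * norm (x - y) powr (2 - \<beta>))) \<and>
     (\<forall>x. \<forall>t0>0. \<exists>c2>0. \<exists>\<delta>>0. \<forall>t\<in>{t0..T}. \<forall>t'\<in>{t0..T}. \<bar>t' - t\<bar> < \<delta> \<longrightarrow>
        (LINT \<omega>|P. \<bar>u t x \<omega> - u t' x \<omega>\<bar>\<^sup>2) \<ge> c2 * \<bar>t - t'\<bar> powr (2 - \<beta>)) \<and>
     (\<exists>v. continuous_version P T u v) \<and>
     (\<forall>v. continuous_version P T u v \<longrightarrow>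
        (\<forall>t\<in>{0<..T}. AE \<omega> in P.
           (\<forall>\<gamma>>(2 - \<beta>) / 2. \<forall>K. compact K \<and> interior K \<noteq> {} \<longrightarrow>
              \<not> holder_on \<gamma> K (\<lambda>x. v t x \<omega>)) \<and>
           (\<forall>\<gamma>. 0 < \<gamma> \<and> \<gamma> < (2 - \<beta>) / 2 \<longrightarrow>
              (\<forall>K. compact K \<longrightarrow> holder_on \<gamma> K (\<lambda>x. v t x \<omega>)))) \<and>
        (\<forall>x. AE \<omega> in P.
           (\<forall>\<gamma>>(2 - \<beta>) / 2. \<forall>a b. 0 \<le> a \<and> a < b \<and> b \<le> T \<longrightarrow>
              \<not> holder_on \<gamma> {a..b} (\<lambda>t. v t x \<omega>)) \<and>
           (\<forall>\<gamma>. 0 < \<gamma> \<and> \<gamma> < (2 - \<beta>) / 2 \<longrightarrow>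
              holder_on \<gamma> {0..T} (\<lambda>t. v t x \<omega>))))"
proof -
  interpret stochastic_wave P F M u \<beta> T
    using assms by (simp add: stochastic_wave_def stochastic_wave_axioms_def)
  have H2: "2 * H = 2 - \<beta>" "(2 - \<beta>) / 2 = H" by (rule two_H) (simp add: H_def)
  have space: "\<exists>c1>0. \<forall>x\<in>K. \<forall>y\<in>K.
      (LINT \<omega>|P. \<bar>u t x \<omega> - u t y \<omega>\<bar>\<^sup>2) \<ge> c1 * norm (x - y) powr (2 - \<beta>)"
    if t: "t \<in> {0<..T}" and K: "compact K" for t K
  proof -
    obtain B where B: "B > 0" "\<And>x. x \<in> K \<Longrightarrow> norm x \<le> B"
      using compact_imp_bounded[OF K] by (auto simp: bounded_pos)
    have B2: "2 * B > 0" using B by simp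
    obtain c where c: "c > 0" "\<And>x y. norm (x - y) \<le> 2 * B \<Longrightarrow>
      c * norm (x - y) powr (2 * H) \<le> (LINT \<omega>|P. (u t x \<omega> - u t y \<omega>)\<^sup>2)"
      by (rule space_increment_lower[OF t B2]) blast
    have "norm (x - y) \<le> 2 * B" if "x \<in> K" "y \<in> K" for x y
      using norm_triangle_ineq4[of x y] B(2)[OF that(1)] B(2)[OF that(2)] by linarith
    then show ?thesis using c by (intro exI[of _ c]) (simp add: H2)
  qed
  have time: "\<exists>c2>0. \<exists>\<delta>>0. \<forall>t\<in>{t0..T}. \<forall>t'\<in>{t0..T}. \<bar>t' - t\<bar> < \<delta> \<longrightarrow>
        (LINT \<omega>|P. \<bar>u t x \<omega> - u t' x \<omega>\<bar>\<^sup>2) \<ge> c2 * \<bar>t - t'\<bar> powr (2 - \<beta>)"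
    if t0: "t0 > 0" for x t0
  proof -
    obtain c \<delta> where c: "c > 0" "\<delta> > 0" "\<And>t t' x. t \<in> {t0..T} \<Longrightarrow> t' \<in> {t0..T} \<Longrightarrow> \<bar>t - t'\<bar> < \<delta> \<Longrightarrow>
     c * \<bar>t - t'\<bar> powr (2 * H) \<le> (LINT \<omega>|P. (u t x \<omega> - u t' x \<omega>)\<^sup>2)"
      by (rule time_increment_lower[OF t0]) blast
    then show ?thesis
      by (intro exI[of _ c] exI[of _ \<delta>] conjI) (simp_all add: H2 abs_minus_commute)
  qed
  have versions: "(\<forall>t\<in>{0<..T}. AE \<omega> in P.
           (\<forall>\<gamma>>H. \<forall>K. compact K \<and> interior K \<noteq> {} \<longrightarrow> \<not> holder_on \<gamma> K (\<lambda>x. v t x \<omega>)) \<and>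
           (\<forall>\<gamma>. 0 < \<gamma> \<and> \<gamma> < H \<longrightarrow> (\<forall>K. compact K \<longrightarrow> holder_on \<gamma> K (\<lambda>x. v t x \<omega>)))) \<and>
        (\<forall>x. AE \<omega> in P.
           (\<forall>\<gamma>>H. \<forall>a b. 0 \<le> a \<and> a < b \<and> b \<le> T \<longrightarrow> \<not> holder_on \<gamma> {a..b} (\<lambda>t. v t x \<omega>)) \<and>
           (\<forall>\<gamma>. 0 < \<gamma> \<and> \<gamma> < H \<longrightarrow> holder_on \<gamma> {0..T} (\<lambda>t. v t x \<omega>)))"
    if v: "continuous_version P T u v" for v
  proof (intro conjI ballI allI AE_conjI)
    fix t assume "t \<in> {0<..T}"
    then show "AE \<omega> in P. \<forall>\<gamma>>H. \<forall>K. compact K \<and> interior K \<noteq> {} \<longrightarrow> \<not> holder_on \<gamma> K (\<lambda>x. v t x \<omega>)"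
      by (rule continuous_version_space_rough[OF v])
    show "AE \<omega> in P. \<forall>\<gamma>. 0 < \<gamma> \<and> \<gamma> < H \<longrightarrow> (\<forall>K. compact K \<longrightarrow> holder_on \<gamma> K (\<lambda>x. v t x \<omega>))"
      using \<open>t \<in> {0<..T}\<close> by (intro continuous_version_space_holder[OF v]) simp
  next
    fix x
    show "AE \<omega> in P. \<forall>\<gamma>>H. \<forall>a b. 0 \<le> a \<and> a < b \<and> b \<le> T \<longrightarrow> \<not> holder_on \<gamma> {a..b} (\<lambda>t. v t x \<omega>)"
      by (rule continuous_version_time_rough[OF v])
    show "AE \<omega> in P. \<forall>\<gamma>. 0 < \<gamma> \<and> \<gamma> < H \<longrightarrow> holder_on \<gamma> {0..T} (\<lambda>t. v t x \<omega>)"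
      by (rule continuous_version_time_holder[OF v])
  qed
  show ?thesis
    unfolding H2(2) using space time continuous_version_cont_field versions by blast
qed

end
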